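(* Let $\underline{\underline{B}}(\mathbb{Z}\rtimes\mathbb{Z})$ be the quotient, by the action of the Klein bottle group $\mathbb{Z}\rtimes\mathbb{Z}$, of the model $\underline{\underline{E}}(\mathbb{Z}\rtimes\mathbb{Z})=\mathbb{R}^2 * \coprod_{a\in\mathbb{Q}\cup\{\infty\}}\mathbb{R}$ for the classifying space for the family of virtually cyclic subgroups of $\mathbb{Z}\rtimes\mathbb{Z}$. The homology groups of $$\underline{\underline{B}}(\mathbb{Z}\rtimes\mathbb{Z})=\Big(\coprod_{J}\mathbb{S}^1\Big) * \mathcal{K},$$ where $J$ is a countably infinite set and $\mathcal{K}$ is the Klein bottle, are the following: $$H_i\Big(\big(\coprod_J\mathbb{S}^1\big) * \mathcal{K}\Big)=\begin{cases}\mathbb{Z}, & i=0;\\ 0, & i=1;\\ \bigoplus_{J'}(\mathbb{Z}\oplus\mathbb{Z}_2), & i=2;\\ \bigoplus_{J}(\mathbb{Z}\oplus\mathbb{Z}_2), & i=3;\\ 0, & i>3,\end{cases}$$ where $J'$ is a countably infinite set.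
   Context: $\mathbb{Z}\rtimes\mathbb{Z}$ is the Klein bottle group, with multiplication $(n_1,m_1)(n_2,m_2)=(n_1+(-1)^{m_1}n_2,\,m_1+m_2)$. It acts on $\mathbb{R}^2$ by $(n,m)(t,r)=(n+(-1)^m t,\,m+r)$, and $\mathcal{K}=(\mathbb{Z}\rtimes\mathbb{Z})\backslash\mathbb{R}^2$ is the Klein bottle. For a discrete group $G$ and a family $\mathcal{F}$ of subgroups (a nonempty set of subgroups closed under conjugation and taking subgroups), a model for the classifying space of $\mathcal{F}$ is a $G$-CW-complex $E$ with all isotropy groups in $\mathcal{F}$ such that every $G$-CW-complex with isotropy groups in $\mathcal{F}$ has precisely one $G$-map to $E$ up to $G$-homotopy; $\underline{\underline{E}}G$ denotes such a space when $\mathcal{F}$ is the family of virtually cyclic subgroups of $G$, and $\underline{\underline{B}}G$ its quotient by $G$. In the model used here, $\coprod_{a\in\mathbb{Q}\cup\{\infty\}}\mathbb{R}$ is the space of lines in $\mathbb{R}^2$ of slope $a\in\mathbb{Q}\cup\{\infty\}$ (one copy of $\mathbb{R}$ for each slope, parametrizing the parallel lines of that slope), with the action of $\mathbb{Z}\rtimes\mathbb{Z}$ induced from that on $\mathbb{R}^2$. The circles in the quotient are indexed by $J=\mathbb{Q}_{\geq 0}\cup\{\infty\}$. $X*Y$ denotes the join, $\coprod$ disjoint union, $\mathbb{S}^1$ the circle, $\mathbb{Z}_2=\mathbb{Z}/2\mathbb{Z}$, and homology is with integer coefficients.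
   Formalization: The asserted equality of the quotient B(Z⋊Z) with the join (∐S^1)*K is false (H_3 of the actual quotient has no 2-torsion); the formula is proved outright for the join, and for the quotient only under the premise, which never holds, that it is homeomorphic to the join. *)

theory Defs
  imports "HOL-Homology.Homology" "HOL-Algebra.Group_Action"
begin

definition quotient_topology :: "'a topology \<Rightarrow> ('a \<Rightarrow> 'b) \<Rightarrow> 'b topology" where
  "quotient_topology X f =
     topology (\<lambda>U. U \<subseteq> f ` topspace X \<and> openin X {x \<in> topspace X. f x \<in> U})"

lemma openin_quotient_topology:
  "openin (quotient_topology X f) U \<longleftrightarrow>
     U \<subseteq> f ` topspace X \<and> openin X {x \<in> topspace X. f x \<in> U}"
proof -
  have "istopology (\<lambda>U. U \<subseteq> f ` topspace X \<and> openin X {x \<in> topspace X. f x \<in> U})"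
    unfolding istopology_def
  proof (intro conjI allI impI)
    fix S T
    assume "S \<subseteq> f ` topspace X \<and> openin X {x \<in> topspace X. f x \<in> S}"
      and "T \<subseteq> f ` topspace X \<and> openin X {x \<in> topspace X. f x \<in> T}"
    moreover have "{x \<in> topspace X. f x \<in> S \<inter> T} =
        {x \<in> topspace X. f x \<in> S} \<inter> {x \<in> topspace X. f x \<in> T}" by blast
    ultimately show "S \<inter> T \<subseteq> f ` topspace X" "openin X {x \<in> topspace X. f x \<in> S \<inter> T}"
      by auto
  next
    fix K
    assume K: "\<forall>S\<in>K. S \<subseteq> f ` topspace X \<and> openin X {x \<in> topspace X. f x \<in> S}"
    have "{x \<in> topspace X. f x \<in> \<Union>K} = (\<Union>S\<in>K. {x \<in> topspace X. f x \<in> S})" by blast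
    with K show "\<Union>K \<subseteq> f ` topspace X" "openin X {x \<in> topspace X. f x \<in> \<Union>K}"
      by auto
  qed
  then show ?thesis
    by (simp add: quotient_topology_def topology_inverse')
qed

lemma topspace_quotient_topology [simp]:
  "topspace (quotient_topology X f) = f ` topspace X"
proof
  have *: "{x \<in> topspace X. f x \<in> f ` topspace X} = topspace X" by blast
  have "openin (quotient_topology X f) (f ` topspace X)"
    unfolding openin_quotient_topology * by simp
  then show "f ` topspace X \<subseteq> topspace (quotient_topology X f)"
    by (rule openin_subset)
  show "topspace (quotient_topology X f) \<subseteq> f ` topspace X"
    using openin_quotient_topology[of X f "topspace (quotient_topology X f)"] by simp
qed

lemma quotient_map_quotient_topology:
  "quotient_map X (quotient_topology X f) f"
  by (auto simp: quotient_map_def openin_quotient_topology)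

definition orbit_space ::
  "('g, 'm) monoid_scheme \<Rightarrow> ('g \<Rightarrow> 'a \<Rightarrow> 'a) \<Rightarrow> 'a topology \<Rightarrow> 'a set topology" where
  "orbit_space G \<phi> X = quotient_topology X (orbit G \<phi>)"

(* The join of nonempty spaces X and Y: the quotient of X * Y * [0,1] which forgets the
   Y-coordinate over 0 and the X-coordinate over 1.  The point (1-s)x + sy is encoded by the
   triple of its parameter s and those of x, y that s does not make irrelevant. *)
definition join_point :: "'a \<times> 'b \<times> real \<Rightarrow> 'a option \<times> 'b option \<times> real" where
  "join_point = (\<lambda>(x, y, s). (if s = 1 then None else Some x, if s = 0 then None else Some y, s))"

definition join :: "'a topology \<Rightarrow> 'b topology \<Rightarrow> ('a option \<times> 'b option \<times> real) topology" where
  "join X Y =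
     quotient_topology (prod_topology X (prod_topology Y (top_of_set {0..1}))) join_point"

definition join_action ::
  "('g \<Rightarrow> 'a \<Rightarrow> 'a) \<Rightarrow> ('g \<Rightarrow> 'b \<Rightarrow> 'b) \<Rightarrow>
     'g \<Rightarrow> 'a option \<times> 'b option \<times> real \<Rightarrow> 'a option \<times> 'b option \<times> real" where
  "join_action \<phi> \<psi> g = (\<lambda>(u, v, s). (map_option (\<phi> g) u, map_option (\<psi> g) v, s))"

(* (-1)^m for an integer m is written with the natural exponent nat |m|. *)
definition klein_group :: "(int \<times> int) monoid" where
  "klein_group =
     \<lparr>carrier = UNIV,
      mult = (\<lambda>(n1, m1) (n2, m2). (n1 + (-1) ^ nat \<bar>m1\<bar> * n2, m1 + m2)),
      one = (0, 0)\<rparr>"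

definition klein_action :: "int \<times> int \<Rightarrow> real \<times> real \<Rightarrow> real \<times> real" where
  "klein_action = (\<lambda>(n, m) (t, r). (of_int n + (-1) ^ nat \<bar>m\<bar> * t, of_int m + r))"

lemma minus_one_power_nat_abs:
  "(-1 :: 'a :: ring_1) ^ nat \<bar>m\<bar> = (if even m then 1 else -1)"
  by (simp add: minus_one_power_iff even_nat_iff)

lemma group_klein_group: "group klein_group"
proof (rule groupI)
  fix x assume "x \<in> carrier klein_group"
  obtain n m where x: "x = (n, m)" by (cases x)
  have "(- ((-1) ^ nat \<bar>m\<bar> * n), - m) \<otimes>\<^bsub>klein_group\<^esub> x = \<one>\<^bsub>klein_group\<^esub>"
    by (simp add: x klein_group_def minus_one_power_nat_abs)
  moreover have "(- ((-1) ^ nat \<bar>m\<bar> * n), - m) \<in> carrier klein_group"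
    by (simp add: klein_group_def)
  ultimately show "\<exists>y\<in>carrier klein_group. y \<otimes>\<^bsub>klein_group\<^esub> x = \<one>\<^bsub>klein_group\<^esub>"
    by (rule bexI)
qed (auto simp: klein_group_def minus_one_power_nat_abs split: prod.splits)

lemma klein_action_one: "klein_action \<one>\<^bsub>klein_group\<^esub> p = p"
  by (cases p) (simp add: klein_action_def klein_group_def)

lemma klein_action_mult:
  "klein_action (g \<otimes>\<^bsub>klein_group\<^esub> h) p = klein_action g (klein_action h p)"
  by (cases g, cases h, cases p)
     (auto simp: klein_action_def klein_group_def minus_one_power_nat_abs)

definition klein_bottle :: "(real \<times> real) set topology" where
  "klein_bottle = orbit_space klein_group klein_action euclidean"

(* The slope \<infinity> is None. *)
definition plane_line :: "rat option \<times> real \<Rightarrow> (real \<times> real) set" where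
  "plane_line = (\<lambda>(a, c). case a of
       Some q \<Rightarrow> {(t, r). r = of_rat q * t + c}
     | None \<Rightarrow> {(t, r). t = c})"

(* plane_line is injective, so this is the space of lines of slope in \<rat> \<union> {\<infinity>}, with one
   clopen copy of \<real> for each slope. *)
definition line_space :: "(real \<times> real) set topology" where
  "line_space = quotient_topology (sum_topology (\<lambda>_. euclideanreal) UNIV) plane_line"

definition line_action :: "int \<times> int \<Rightarrow> (real \<times> real) set \<Rightarrow> (real \<times> real) set" where
  "line_action g L = klein_action g ` L"

lemma inj_plane_line: "inj plane_line"
proof (rule injI)
  fix x y assume eq: "plane_line x = plane_line y"
  obtain a c b d where xy: "x = (a, c)" "y = (b, d)" by (cases x, cases y)
  have mem: "p \<in> plane_line (a, c) \<longleftrightarrow> p \<in> plane_line (b, d)" for p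
    using eq xy by simp
  show "x = y"
  proof (cases a; cases b)
    assume "a = None" "b = None"
    then show ?thesis using mem[of "(c, 0)"] by (simp add: xy plane_line_def)
  next
    fix q assume "a = None" "b = Some q"
    then show ?thesis
      using mem[of "(c, of_rat q * c + d + 1)"] by (simp add: xy plane_line_def)
  next
    fix q assume "a = Some q" "b = None"
    then show ?thesis
      using mem[of "(d, of_rat q * d + c + 1)"] by (simp add: xy plane_line_def)
  next
    fix p q assume "a = Some p" "b = Some q"
    then show ?thesis
      using mem[of "(0, c)"] mem[of "(1, of_rat p + c)"] by (simp add: xy plane_line_def)
  qed
qed

(* The slope of a line is multiplied by (-1)^m under the action of (n, m). *)
lemma line_action_plane_line:
  "line_action (n, m) (plane_line (Some q, c)) =
     plane_line (Some ((-1) ^ nat \<bar>m\<bar> * q), c + of_int m - (-1) ^ nat \<bar>m\<bar> * of_rat q * of_int n)"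
  "line_action (n, m) (plane_line (None, c)) = plane_line (None, of_int n + (-1) ^ nat \<bar>m\<bar> * c)"
proof -
  have mem: "(t, r) \<in> line_action (n, m) L \<longleftrightarrow>
      ((-1) ^ nat \<bar>m\<bar> * (t - of_int n), r - of_int m) \<in> L" for t r L
    by (force simp: line_action_def klein_action_def minus_one_power_nat_abs image_iff)
  show "line_action (n, m) (plane_line (Some q, c)) =
     plane_line (Some ((-1) ^ nat \<bar>m\<bar> * q), c + of_int m - (-1) ^ nat \<bar>m\<bar> * of_rat q * of_int n)"
    by (rule Set.set_eqI, rename_tac z, case_tac z)
       (auto simp: mem, auto simp: plane_line_def minus_one_power_nat_abs algebra_simps of_rat_minus
          split: if_splits)
  show "line_action (n, m) (plane_line (None, c)) = plane_line (None, of_int n + (-1) ^ nat \<bar>m\<bar> * c)"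
    by (rule Set.set_eqI, rename_tac z, case_tac z)
       (auto simp: mem, auto simp: plane_line_def minus_one_power_nat_abs algebra_simps
          split: if_splits)
qed

definition klein_E_vc ::
  "((real \<times> real) option \<times> (real \<times> real) set option \<times> real) topology" where
  "klein_E_vc = join euclidean line_space"

(* Pitfall: this quotient by the diagonal action is not homeomorphic to the space
   circles_join_klein_bottle J below.  Its middle part is the quotient of the product, not the
   product of the quotients, its part over the lines of slope \<infinity> is an interval, and its
   third homology has no 2-torsion.  An implication with that homeomorphism as premise is
   vacuously true. *)
definition klein_B_vc ::
  "((real \<times> real) option \<times> (real \<times> real) set option \<times> real) set topology" where
  "klein_B_vc = orbit_space klein_group (join_action klein_action line_action) klein_E_vc"

definition circles_join_klein_bottle ::
  "'j set \<Rightarrow> (('j \<times> (nat \<Rightarrow> real)) option \<times> (real \<times> real) set option \<times> real) topology" where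
  "circles_join_klein_bottle J = join (sum_topology (\<lambda>_. nsphere 1) J) klein_bottle"

end

theory Submission
  imports Defs "HOL-Analysis.Analysis"
begin

text \<open>Three spaces occur in the computation: the Klein bottle \<open>K\<close>, the product of a disjoint family of
circles \<open>X\<close> with \<open>K\<close>, and the join of \<open>X\<close> and \<open>K\<close>. Each of them arises from a cylinder
\<open>P \<times> [0,1]\<close> by identifying points of its two ends only, and its homology is read off from this description.
For such a quotient \<open>Z\<close> of \<open>P \<times> [0,1]\<close>, with \<open>F\<close> the image of the ends and \<open>f\<^sub>0, f\<^sub>1 : P \<rightarrow> F\<close> the two
end maps, excision gives \<open>H\<^sub>n\<^sub>+\<^sub>1(Z,F) \<cong> H\<^sub>n\<^sub>+\<^sub>1(P \<times> [0,1], P \<times> {0,1}) \<cong> H\<^sub>n(P)\<close>, and the boundary map of the pair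
becomes \<open>f\<^sub>1 - f\<^sub>0 : H\<^sub>n(P) \<rightarrow> H\<^sub>n(F)\<close> (\<open>iso_attach\<close>, \<open>boundary_attach\<close>). So there is one long exact
sequence, which is the Wang sequence of a mapping torus and the Mayer-Vietoris sequence of a join.

For \<open>K\<close> take \<open>P = F = S\<^sup>1\<close>, with \<open>f\<^sub>0\<close> the identity and \<open>f\<^sub>1\<close> a reflection. The difference is multiplication by
\<open>-2\<close> on \<open>H\<^sub>1\<close> and zero on \<open>H\<^sub>0\<close>, hence \<open>H\<^sub>1(K) \<cong> \<int> \<oplus> \<int>\<^sub>2\<close> and nothing lies above
(\<open>homology_klein_bottle_1\<close>, \<open>trivial_homology_klein_bottle\<close>).

For \<open>X \<times> K\<close>, where \<open>X = J \<times> S\<^sup>1\<close> with \<open>J\<close> discrete, take \<open>P = F = J \<times> K\<close> with equal end maps. Additivity gives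
\<open>H\<^sub>n(J \<times> K) = \<Oplus>\<^sub>J H\<^sub>n(K)\<close>, and the sequence yields \<open>H\<^sub>2(X \<times> K) \<cong> \<Oplus>\<^sub>J H\<^sub>1(K)\<close>. In degree one,
the classes killed by the projection to \<open>X\<close> are those that come from \<open>J \<times> K\<close>
(\<open>kernel_projection_circles\<close>).

For the join take \<open>P = X \<times> K\<close> and \<open>F = X + K\<close>, the end maps being the projections. Both parts of \<open>F\<close>
are contractible inside the join, so for \<open>n \<ge> 0\<close> the group \<open>H\<^sub>n\<^sub>+\<^sub>1\<close> of the join consists of
the classes of \<open>H\<^sub>n(X \<times> K)\<close> that both projections kill (\<open>homology_join\<close>). For \<open>n = 2\<close> these are all classes. For
\<open>n = 1\<close> they are the families in \<open>\<Oplus>\<^sub>J H\<^sub>1(K)\<close> with sum zero; such a family is determined by its entries away from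
one index \<open>j\<^sub>0\<close>, which may be arbitrary (\<open>kernel_projection_discrete_times\<close>), so \<open>H\<^sub>2\<close> of the join is a sum
over \<open>J - {j\<^sub>0}\<close>, and this set is countably infinite like \<open>J'\<close>. For \<open>n = 0\<close> no class but zero is
killed, because \<open>K\<close> is path connected, and for \<open>n \<ge> 3\<close> the group \<open>H\<^sub>n(X \<times> K)\<close> is trivial.

The statements about the quotient of the model for the classifying space follow by homeomorphism
invariance.\<close>

section \<open>Excision for a cylinder glued along its ends\<close>

definition cylinder :: "'a topology \<Rightarrow> ('a \<times> real) topology" where
  "cylinder P = prod_topology P (top_of_set {0..1})"

definition cylinder_ends :: "'a topology \<Rightarrow> ('a \<times> real) set" where
  "cylinder_ends P = topspace P \<times> {0, 1}"

definition cylinder_collar :: "'a topology \<Rightarrow> ('a \<times> real) set" where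
  "cylinder_collar P = topspace P \<times> ({0..<1/4} \<union> {3/4<..1})"

text \<open>At time \<open>t\<close> this moves \<open>s\<close> the fraction \<open>t\<close> of the way to the piecewise linear map which sends the quarters
of \<open>[0,1]\<close> next to \<open>0\<close> and \<open>1\<close> to those points and stretches the middle half over \<open>[0,1]\<close>. All stages fix the
ends and preserve the collar, and the last stage pushes the collar into the ends.\<close>

definition squeeze :: "real \<Rightarrow> real \<Rightarrow> real" where
  "squeeze t s = (1 - t) * s + t * max 0 (min 1 (2 * s - 1/2))"

lemma topspace_cylinder [simp]: "topspace (cylinder P) = topspace P \<times> {0..1}"
  by (simp add: cylinder_def)

lemma cylinder_ends_subset: "cylinder_ends P \<subseteq> topspace (cylinder P)"
  and cylinder_ends_subset_collar: "cylinder_ends P \<subseteq> cylinder_collar P"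
  and cylinder_collar_subset: "cylinder_collar P \<subseteq> topspace (cylinder P)"
  by (auto simp: cylinder_ends_def cylinder_collar_def)

lemma closedin_cylinder_ends: "closedin (cylinder P) (cylinder_ends P)"
proof -
  have "closedin (top_of_set {0..1}) {0, 1::real}"
    by (auto intro: closed_subset)
  then show ?thesis
    by (simp add: cylinder_def cylinder_ends_def closedin_prod_Times_iff)
qed

lemma openin_cylinder_collar: "openin (cylinder P) (cylinder_collar P)"
proof -
  have "{0..<1/4} \<union> {3/4<..1} = {0..1} \<inter> ({..<1/4} \<union> {3/4::real<..})"
    by auto
  then have "openin (top_of_set {0..1}) ({0..<1/4} \<union> {3/4<..1::real})"
    by (simp only:) (intro openin_open_Int open_Un open_lessThan open_greaterThan)
  then show ?thesis
    by (simp add: cylinder_def cylinder_collar_def openin_prod_Times_iff)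
qed

lemma continuous_map_squeeze:
  "continuous_map (prod_topology (top_of_set {0..1}) (cylinder P)) (cylinder P)
     (\<lambda>(t, x, s). (x, squeeze t s))"
proof -
  have 1: "continuous_map (prod_topology (top_of_set {0..1}) (cylinder P)) P (\<lambda>z. fst (snd z))"
    unfolding cylinder_def
    by (rule continuous_map_compose[OF continuous_map_snd continuous_map_fst, unfolded o_def])
  have t: "continuous_map (prod_topology (top_of_set {0..1}) (cylinder P)) euclideanreal fst"
    by (rule continuous_map_into_fulltopology[OF continuous_map_fst])
  have s: "continuous_map (prod_topology (top_of_set {0..1}) (cylinder P)) euclideanreal (\<lambda>z. snd (snd z))"
    unfolding cylinder_def
    by (rule continuous_map_into_fulltopology,
        rule continuous_map_compose[OF continuous_map_snd continuous_map_snd, unfolded o_def])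
  have "continuous_map (prod_topology (top_of_set {0..1}) (cylinder P)) euclideanreal
        (\<lambda>z. squeeze (fst z) (snd (snd z)))"
    unfolding squeeze_def
    by (intro continuous_map_add continuous_map_real_mult continuous_map_diff continuous_map_real_max
        continuous_map_real_min continuous_map_canonical_const t s)
  moreover have "squeeze t s \<in> {0..1}" if "t \<in> {0..1}" "s \<in> {0..1}" for t s
  proof -
    have "max 0 (min 1 (2 * s - 1/2)) \<in> {0..1}" by simp
    with convexD_alt[OF convex_real_interval(5) that(2) this, of t] that(1)
    show ?thesis by (simp only: squeeze_def real_scaleR_def atLeastAtMost_iff)
  qed
  ultimately have 2: "continuous_map (prod_topology (top_of_set {0..1}) (cylinder P)) (top_of_set {0..1})
        (\<lambda>z. squeeze (fst z) (snd (snd z)))"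
    unfolding continuous_map_in_subtopology Pi_iff by (simp add: cylinder_def mem_Times_iff)
  show ?thesis
    using continuous_map_pairedI[OF 1 2] by (simp add: cylinder_def case_prod_unfold)
qed

lemma squeeze_0 [simp]: "squeeze 0 s = s"
  by (simp add: squeeze_def)

lemma squeeze_ends [simp]: "squeeze t 0 = 0" "squeeze t 1 = 1"
  by (auto simp: squeeze_def)

lemma squeeze_preserves_collar:
  assumes "t \<in> {0..1}" "s \<in> {0..<1/4} \<union> {3/4<..1}"
  shows "squeeze t s \<in> {0..<1/4} \<union> {3/4<..1}"
proof (cases "s < 1/4")
  case True
  then have "squeeze t s = (1 - t) * s" by (simp add: squeeze_def)
  moreover have "0 \<le> (1 - t) * s" "(1 - t) * s \<le> 1 * s"
    using assms True mult_right_mono[of "1 - t" 1 s] by auto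
  ultimately show ?thesis using True by auto
next
  case False
  then have s: "3/4 < s" "s \<le> 1" using assms by auto
  then have "squeeze t s = 1 - (1 - t) * (1 - s)" by (simp add: squeeze_def algebra_simps)
  moreover have "0 \<le> (1 - t) * (1 - s)" "(1 - t) * (1 - s) \<le> 1 * (1 - s)"
    using assms s mult_right_mono[of "1 - t" 1 "1 - s"] by auto
  ultimately show ?thesis using s by auto
qed

lemma squeeze_collar_onto_ends:
  "s \<in> {0..<1/4} \<union> {3/4<..1} \<Longrightarrow> squeeze 1 s \<in> {0, 1}"
  by (auto simp: squeeze_def)

text \<open>Identifications take place among points of the ends only, but there they are
arbitrary: the ends may be glued to each other or partially collapsed.\<close>

locale glued_cylinder =
  fixes P :: "'a topology" and Z :: "'b topology" and q :: "'a \<times> real \<Rightarrow> 'b"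
  assumes quotient: "quotient_map (cylinder P) Z q"
    and inj: "\<lbrakk>x \<in> topspace (cylinder P); y \<in> topspace (cylinder P); q x = q y;
               x \<notin> cylinder_ends P\<rbrakk> \<Longrightarrow> x = y"
begin

abbreviation glued_ends :: "'b set" where "glued_ends \<equiv> q ` cylinder_ends P"

lemma continuous: "continuous_map (cylinder P) Z q"
  using quotient by (rule quotient_imp_continuous_map)

lemma surj: "q ` topspace (cylinder P) = topspace Z"
  using quotient by (rule quotient_imp_surjective_map)

text \<open>Every set that contains the ends is saturated, so the quotient topology can be tested on it directly.\<close>

lemma preimage:
  assumes "cylinder_ends P \<subseteq> S" "S \<subseteq> topspace (cylinder P)"
  shows "{x \<in> topspace (cylinder P). q x \<in> q ` S} = S"
proof
  show "{x \<in> topspace (cylinder P). q x \<in> q ` S} \<subseteq> S"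
  proof
    fix x assume "x \<in> {x \<in> topspace (cylinder P). q x \<in> q ` S}"
    then obtain y where x: "x \<in> topspace (cylinder P)" and y: "y \<in> S" "q x = q y" by blast
    then have "y \<in> topspace (cylinder P)" using assms(2) by blast
    with inj[OF x this y(2)] y assms(1) show "x \<in> S" by blast
  qed
  show "S \<subseteq> {x \<in> topspace (cylinder P). q x \<in> q ` S}"
    using assms by blast
qed

lemma closedin_glued_ends: "closedin Z glued_ends"
proof -
  have "glued_ends \<subseteq> topspace Z" using surj cylinder_ends_subset by blast
  with quotient have "closedin (cylinder P) {x \<in> topspace (cylinder P). q x \<in> glued_ends}
      \<longleftrightarrow> closedin Z glued_ends"
    unfolding quotient_map_closedin by blast
  then show ?thesis
    using closedin_cylinder_ends unfolding preimage[OF order_refl cylinder_ends_subset] by blast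
qed

lemma openin_glued_collar: "openin Z (q ` cylinder_collar P)"
proof -
  have "q ` cylinder_collar P \<subseteq> topspace Z" using surj cylinder_collar_subset by blast
  with quotient have "openin (cylinder P) {x \<in> topspace (cylinder P). q x \<in> q ` cylinder_collar P}
      \<longleftrightarrow> openin Z (q ` cylinder_collar P)"
    unfolding quotient_map_def by blast
  then show ?thesis
    using openin_cylinder_collar unfolding preimage[OF cylinder_ends_subset_collar cylinder_collar_subset]
    by blast
qed

text \<open>The homotopy that squeezes the collar into the ends is constant on the ends, so it descends to the
quotient; it is continuous there because the product of a quotient map with the compact interval is a
quotient map. Its last stage is a homotopy inverse, in the category of pairs, of the inclusion of the ends in the
collar.\<close>

lemma iso_ends_collar:
  "hom_induced n Z glued_ends Z (q ` cylinder_collar P) id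
     \<in> iso (relative_homology_group n Z glued_ends) (relative_homology_group n Z (q ` cylinder_collar P))"
proof -
  let ?I = "top_of_set {0..1::real}"
  let ?N = "q ` cylinder_collar P"
  have Q: "quotient_map (prod_topology ?I (cylinder P)) (prod_topology ?I Z) (\<lambda>(t, x). (t, q x))"
    by (intro quotient_map_prod_right quotient)
       (auto intro!: compact_imp_locally_compact_space Hausdorff_space_subtopology
          simp: compact_space_subtopology)
  have cont: "continuous_map (prod_topology ?I (cylinder P)) Z (q \<circ> (\<lambda>(t, x, s). (x, squeeze t s)))"
    using continuous_map_squeeze continuous by (rule continuous_map_compose)
  have wd: "(q \<circ> (\<lambda>(t, x, s). (x, squeeze t s))) v = (q \<circ> (\<lambda>(t, x, s). (x, squeeze t s))) w"
    if vw: "v \<in> topspace (prod_topology ?I (cylinder P))" "w \<in> topspace (prod_topology ?I (cylinder P))"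
       "(\<lambda>(t, x). (t, q x)) v = (\<lambda>(t, x). (t, q x)) w" for v w
  proof -
    obtain t x s y r where v: "v = (t, x, s)" and w: "w = (t, y, r)"
      using vw by (cases v; cases w) auto
    have q: "q (x, s) = q (y, r)" and X: "(x, s) \<in> topspace (cylinder P)" "(y, r) \<in> topspace (cylinder P)"
      using vw by (auto simp: v w)
    show ?thesis
    proof (cases "(x, s) \<in> cylinder_ends P \<and> (y, r) \<in> cylinder_ends P")
      case True
      then show ?thesis using q by (auto simp: v w cylinder_ends_def)
    next
      case False
      then have "(x, s) = (y, r)" using inj[OF X q] inj[OF X(2,1) q[symmetric]] by metis
      then show ?thesis by (simp add: v w)
    qed
  qed
  obtain h
    where conth: "continuous_map (prod_topology ?I Z) Z h"
      and h0: "\<And>v. v \<in> topspace (prod_topology ?I (cylinder P)) \<Longrightarrow>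
               h ((\<lambda>(t, x). (t, q x)) v) = (q \<circ> (\<lambda>(t, x, s). (x, squeeze t s))) v"
  proof (rule quotient_map_lift_exists[OF Q cont])
    fix g assume "continuous_map (prod_topology ?I Z) Z g"
      and "\<And>v. v \<in> topspace (prod_topology ?I (cylinder P)) \<Longrightarrow>
             g ((\<lambda>(t, x). (t, q x)) v) = (q \<circ> (\<lambda>(t, x, s). (x, squeeze t s))) v"
    then show thesis by (rule that)
  qed (rule wd)
  have h: "h (t, q (x, s)) = q (x, squeeze t s)"
    if "t \<in> {0..1}" "(x, s) \<in> topspace (cylinder P)" for t x s
    using h0[of "(t, x, s)"] that by simp
  have hE: "h (t, z) \<in> glued_ends" if "t \<in> {0..1}" "z \<in> glued_ends" for t z
    using that cylinder_ends_subset[of P] by (force simp: h cylinder_ends_def)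
  have hN: "h (t, z) \<in> ?N" if t: "t \<in> {0..1}" and z: "z \<in> ?N" for t z
  proof -
    obtain x s where "z = q (x, s)" "(x, s) \<in> cylinder_collar P" using z by auto
    then show ?thesis
      using t squeeze_preserves_collar[of t s] cylinder_collar_subset[of P]
      by (auto simp: h cylinder_collar_def)
  qed
  have h1: "h (1, z) \<in> glued_ends" if z: "z \<in> ?N" for z
  proof -
    obtain x s where "z = q (x, s)" "(x, s) \<in> cylinder_collar P" using z by auto
    then show ?thesis
      using squeeze_collar_onto_ends[of s] cylinder_collar_subset[of P]
      by (auto simp: h cylinder_collar_def cylinder_ends_def)
  qed
  have hid: "h (0, z) = z" if "z \<in> topspace Z" for z
    using that surj h[of 0] by force
  let ?g = "\<lambda>z. h (1, z)"
  have contg: "continuous_map Z Z ?g"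
  proof -
    have "continuous_map Z (prod_topology ?I Z) (\<lambda>z. (1, z))"
      by (simp add: continuous_map_pairwise o_def)
    from continuous_map_compose[OF this conth] show ?thesis by (simp add: o_def)
  qed
  have homo: "homotopic_with (\<lambda>k. k \<in> A \<rightarrow> A) Z Z ?g id"
    if A: "\<And>t z. \<lbrakk>t \<in> {0..1}; z \<in> A\<rbrakk> \<Longrightarrow> h (t, z) \<in> A" "A \<subseteq> topspace Z" for A
  proof (rule homotopic_with_symD)
    show "homotopic_with (\<lambda>k. k \<in> A \<rightarrow> A) Z Z id ?g"
    proof (subst homotopic_with)
      show "\<And>j k. (\<And>x. x \<in> topspace Z \<Longrightarrow> j x = k x) \<Longrightarrow> (j \<in> A \<rightarrow> A) = (k \<in> A \<rightarrow> A)"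
        using A(2) by (auto simp: Pi_iff subset_iff)
      show "\<exists>k. continuous_map (prod_topology ?I Z) Z k \<and>
              (\<forall>z\<in>topspace Z. k (0, z) = id z) \<and> (\<forall>z\<in>topspace Z. k (1, z) = h (1, z)) \<and>
              (\<forall>t\<in>{0..1}. (\<lambda>z. k (t, z)) \<in> A \<rightarrow> A)"
        by (rule exI[where x = h]) (use conth hid A(1) in auto)
    qed
  qed
  show ?thesis
  proof (rule homotopy_equivalence_relative_homology_group_isomorphism[where g = ?g])
    show "id \<in> glued_ends \<rightarrow> ?N" using cylinder_ends_subset_collar[of P] by auto
    show "?g \<in> ?N \<rightarrow> glued_ends" using h1 by blast
    have "glued_ends \<subseteq> topspace Z" "?N \<subseteq> topspace Z"
      using surj cylinder_ends_subset cylinder_collar_subset by blast+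
    then show "homotopic_with (\<lambda>k. k \<in> glued_ends \<rightarrow> glued_ends) Z Z (?g \<circ> id) id"
      "homotopic_with (\<lambda>k. k \<in> ?N \<rightarrow> ?N) Z Z (id \<circ> ?g) id"
      using homo[of glued_ends] homo[of ?N] hE hN by simp_all
  qed (simp_all add: contg)
qed

text \<open>Excision of the image of the ends, a closed set inside the open collar.\<close>

lemma iso_interior_collar:
  "hom_induced n (subtopology Z (topspace Z - glued_ends)) (q ` cylinder_collar P - glued_ends)
       Z (q ` cylinder_collar P) id
     \<in> iso (relative_homology_group n (subtopology Z (topspace Z - glued_ends))
              (q ` cylinder_collar P - glued_ends))
           (relative_homology_group n Z (q ` cylinder_collar P))"
proof -
  have "Z closure_of glued_ends \<subseteq> Z interior_of (q ` cylinder_collar P)"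
    using cylinder_ends_subset_collar[of P]
    by (simp add: closure_of_closedin closedin_glued_ends interior_of_openin openin_glued_collar image_mono)
  moreover have "q ` cylinder_collar P \<subseteq> topspace Z"
    by (simp add: openin_glued_collar openin_subset)
  ultimately show ?thesis
    using homology_excision_axiom[of Z glued_ends "q ` cylinder_collar P" "topspace Z" n] by simp
qed

lemma homeomorphic_interior:
  "homeomorphic_map (subtopology (cylinder P) (topspace (cylinder P) - cylinder_ends P))
     (subtopology Z (topspace Z - glued_ends)) q"
proof -
  have pre: "{x \<in> topspace (cylinder P). q x \<in> topspace Z - glued_ends}
       = topspace (cylinder P) - cylinder_ends P"
    using preimage[OF order_refl cylinder_ends_subset] surj by blast
  have "openin Z (topspace Z - glued_ends)"
    using closedin_glued_ends by blast
  then have Q: "quotient_map (subtopology (cylinder P) (topspace (cylinder P) - cylinder_ends P))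
     (subtopology Z (topspace Z - glued_ends)) q"
    using quotient_map_restriction[OF quotient pre] by blast
  moreover have inj_q: "inj_on q (topspace (subtopology (cylinder P) (topspace (cylinder P) - cylinder_ends P)))"
    by (rule inj_onI) (use inj in auto)
  ultimately have "continuous_map (subtopology (cylinder P) (topspace (cylinder P) - cylinder_ends P))
       (subtopology Z (topspace Z - glued_ends)) q \<and>
     open_map (subtopology (cylinder P) (topspace (cylinder P) - cylinder_ends P))
       (subtopology Z (topspace Z - glued_ends)) q"
    by (simp only: injective_quotient_map)
  with quotient_imp_surjective_map[OF Q] inj_q show ?thesis
    by (intro bijective_open_imp_homeomorphic_map) blast+
qed

end

text \<open>The cylinder itself is the case without identifications, so the lemmas on collars apply to it as well.\<close>

lemma glued_cylinder_id: "glued_cylinder P (cylinder P) id"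
proof
  show "quotient_map (cylinder P) (cylinder P) id"
    by (intro continuous_open_imp_quotient_map) (simp_all add: open_map_def)
qed simp_all

lemma iso_cancel_left:
  assumes "g \<circ> f \<in> iso G K" "g \<in> iso H K" "f \<in> hom G H"
  shows "f \<in> iso G H"
proof -
  have "y \<in> f ` carrier G" if y: "y \<in> carrier H" for y
  proof -
    obtain x where "x \<in> carrier G" "g (f x) = g y"
      using assms(1,2) y by (force simp: iso_iff)
    moreover have "f x \<in> carrier H"
      using assms(3) \<open>x \<in> carrier G\<close> by (auto simp: hom_def)
    ultimately show ?thesis
      using assms(2) y by (auto simp: iso_iff dest: inj_onD)
  qed
  moreover have "inj_on f (carrier G)"
    using assms(1) by (auto simp: iso_iff intro: inj_on_imageI2)
  ultimately show ?thesis
    using assms(3) by (auto simp: iso_iff hom_def Pi_iff)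
qed

context glued_cylinder
begin

text \<open>On both sides the ends may be enlarged to the collar and then excised, and away from the ends the quotient map is a
homeomorphism.\<close>

lemma iso_relative_homology:
  "hom_induced n (cylinder P) (cylinder_ends P) Z glued_ends q
     \<in> iso (relative_homology_group n (cylinder P) (cylinder_ends P))
           (relative_homology_group n Z glued_ends)"
proof -
  let ?C = "cylinder P" and ?E = "cylinder_ends P" and ?N = "cylinder_collar P"
  let ?C' = "subtopology ?C (topspace ?C - ?E)" and ?Z' = "subtopology Z (topspace Z - glued_ends)"
  interpret C: glued_cylinder P ?C id by (rule glued_cylinder_id)
  have im: "q ` (?N - ?E) = q ` ?N - glued_ends"
  proof
    show "q ` (?N - ?E) \<subseteq> q ` ?N - glued_ends"
    proof clarify
      fix x s assume x: "(x, s) \<in> ?N" "(x, s) \<notin> ?E"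
      have "q (x, s) \<noteq> q e" if "e \<in> ?E" for e
        using inj[OF subsetD[OF cylinder_collar_subset x(1)] subsetD[OF cylinder_ends_subset that]] x that
        by metis
      then show "q (x, s) \<in> q ` ?N - glued_ends" using x by blast
    qed
  qed blast
  have cont': "continuous_map ?C' Z q"
    by (rule continuous_map_from_subtopology[OF continuous])
  have *: "hom_induced n ?Z' (q ` ?N - glued_ends) Z (q ` ?N) id \<circ> hom_induced n ?C' (?N - ?E) ?Z' (q ` ?N - glued_ends) q
        \<in> iso (relative_homology_group n ?C' (?N - ?E)) (relative_homology_group n Z (q ` ?N))"
    using iso_set_trans[OF homeomorphic_map_relative_homology_iso[OF homeomorphic_interior, of "?N - ?E", OF _ im] iso_interior_collar]
      cylinder_collar_subset[of P] by auto
  have "hom_induced n ?Z' (q ` ?N - glued_ends) Z (q ` ?N) id \<circ> hom_induced n ?C' (?N - ?E) ?Z' (q ` ?N - glued_ends) q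
      = hom_induced n ?C' (?N - ?E) Z (q ` ?N) q"
    using homeomorphic_imp_continuous_map[OF homeomorphic_interior] im
    by (subst hom_induced_compose[symmetric]) (auto simp: continuous_map_from_subtopology)
  also have "\<dots> = hom_induced n ?C ?N Z (q ` ?N) q \<circ> hom_induced n ?C' (?N - ?E) ?C ?N id"
    using continuous by (subst hom_induced_compose[symmetric]) (auto simp: continuous_map_from_subtopology)
  finally have N: "hom_induced n ?C ?N Z (q ` ?N) q \<circ> hom_induced n ?C' (?N - ?E) ?C ?N id
     \<in> iso (relative_homology_group n ?C' (?N - ?E)) (relative_homology_group n Z (q ` ?N))"
    using * by simp
  have "hom_induced n ?C' (?N - ?E) ?C ?N id
      \<in> iso (relative_homology_group n ?C' (?N - ?E)) (relative_homology_group n ?C ?N)"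
    using C.iso_interior_collar[of n] by simp
  then have "hom_induced n ?C' (?N - ?E) ?C ?N id
      \<in> epi (relative_homology_group n ?C' (?N - ?E)) (relative_homology_group n ?C ?N)"
    by (simp add: iso_iff_mon_epi)
  from epi_iso_compose_rev[OF this hom_induced_hom N]
  have "hom_induced n ?C ?N Z (q ` ?N) q
      \<in> iso (relative_homology_group n ?C ?N) (relative_homology_group n Z (q ` ?N))" ..
  from iso_set_trans[OF C.iso_ends_collar[of n, simplified] this]
  have "hom_induced n ?C ?N Z (q ` ?N) q \<circ> hom_induced n ?C ?E ?C ?N id
      \<in> iso (relative_homology_group n ?C ?E) (relative_homology_group n Z (q ` ?N))" .
  also have "hom_induced n ?C ?N Z (q ` ?N) q \<circ> hom_induced n ?C ?E ?C ?N id = hom_induced n ?C ?E Z (q ` ?N) q"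
    using continuous cylinder_ends_subset_collar[of P]
    by (subst hom_induced_compose[symmetric]) auto
  also have "\<dots> = hom_induced n Z glued_ends Z (q ` ?N) id \<circ> hom_induced n ?C ?E Z glued_ends q"
    using continuous cylinder_ends_subset_collar[of P]
    by (subst hom_induced_compose[symmetric]) auto
  finally show ?thesis
    by (rule iso_cancel_left[OF _ iso_ends_collar hom_induced_hom])
qed

end

section \<open>The suspension isomorphism and the boundary map of a glued cylinder\<close>

lemma kernel_hom_boundary:
  "kernel (relative_homology_group p X S) (homology_group (p - 1) (subtopology X S)) (hom_boundary p X S)
     = hom_induced p X {} X S id ` carrier (homology_group p X)"
  using homology_exactness_axiom_1[of p X S] by simp

lemma kernel_hom_induced_inclusion:
  "kernel (homology_group (p - 1) (subtopology X S)) (homology_group (p - 1) X)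
       (hom_induced (p - 1) (subtopology X S) {} X {} id)
     = hom_boundary p X S ` carrier (relative_homology_group p X S)"
  using homology_exactness_axiom_2[of p X S] by simp

lemma kernel_hom_induced_relativization:
  "kernel (homology_group p X) (relative_homology_group p X S) (hom_induced p X {} X S id)
     = hom_induced p (subtopology X S) {} X {} id ` carrier (homology_group p (subtopology X S))"
  using homology_exactness_axiom_3[of p X S] by simp

lemma group_hom_hom_induced:
  "group_hom (relative_homology_group p X S) (relative_homology_group p Y T) (hom_induced p X S Y T f)"
  by (simp add: group_hom_def group_hom_axioms_def hom_induced_hom)

lemma group_hom_hom_boundary:
  "group_hom (relative_homology_group p X S) (homology_group (p - 1) (subtopology X S)) (hom_boundary p X S)"
  by (simp add: group_hom_def group_hom_axioms_def hom_boundary_hom)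

text \<open>Shows that a difference of two homomorphisms into an abelian group is a homomorphism.\<close>

lemma (in comm_group) diff_mult_diff:
  assumes "w \<in> carrier G" "x \<in> carrier G" "y \<in> carrier G" "z \<in> carrier G"
  shows "(w \<otimes> x) \<otimes> inv (y \<otimes> z) = (w \<otimes> inv y) \<otimes> (x \<otimes> inv z)"
  using assms by (simp add: inv_mult) (simp add: m_ac)

text \<open>Additivity for two pieces, in a form that lets the pieces be given by
embeddings of other spaces.\<close>

lemma iso_homology_disjoint_union:
  assumes g: "embedding_map A X g" "openin X (g ` topspace A)"
    and h: "embedding_map B X h" "openin X (h ` topspace B)"
    and disj: "disjnt (g ` topspace A) (h ` topspace B)"
    and cover: "g ` topspace A \<union> h ` topspace B = topspace X"
  shows "(\<lambda>(a, b). hom_induced p A {} X {} g a \<otimes>\<^bsub>homology_group p X\<^esub> hom_induced p B {} X {} h b)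
           \<in> iso (homology_group p A \<times>\<times> homology_group p B) (homology_group p X)"
proof -
  let ?S = "subtopology X (g ` topspace A)" and ?T = "subtopology X (h ` topspace B)"
  let ?H = "homology_group p X"
  have iso_g: "hom_induced p A {} ?S {} g \<in> iso (homology_group p A) (homology_group p ?S)"
    and iso_h: "hom_induced p B {} ?T {} h \<in> iso (homology_group p B) (homology_group p ?T)"
    using g(1) h(1) by (auto simp: embedding_map_def intro: homeomorphic_map_homology_iso)
  have "group (homology_group p A)" by simp
  from iso_set_trans[OF group.DirProd_iso_set_trans[OF this iso_g iso_h]
      homology_additivity_explicit[OF g(2) h(2) disj cover, of p]]
  have iso: "(\<lambda>(a, b). hom_induced p ?S {} X {} id a \<otimes>\<^bsub>?H\<^esub> hom_induced p ?T {} X {} id b)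
      \<circ> (\<lambda>(a, b). (hom_induced p A {} ?S {} g a, hom_induced p B {} ?T {} h b))
      \<in> iso (homology_group p A \<times>\<times> homology_group p B) ?H" .
  have "hom_induced p ?S {} X {} id (hom_induced p A {} ?S {} g a) = hom_induced p A {} X {} g a" for a
    using g(1)
    by (subst hom_induced_compose')
       (auto simp: embedding_map_def homeomorphic_imp_continuous_map continuous_map_from_subtopology)
  moreover have "hom_induced p ?T {} X {} id (hom_induced p B {} ?T {} h b) = hom_induced p B {} X {} h b" for b
    using h(1)
    by (subst hom_induced_compose')
       (auto simp: embedding_map_def homeomorphic_imp_continuous_map continuous_map_from_subtopology)
  ultimately show ?thesis
    using iso by (simp add: o_def case_prod_unfold)
qed

abbreviation cylinder_end :: "real \<Rightarrow> 'a \<Rightarrow> 'a \<times> real" where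
  "cylinder_end k \<equiv> (\<lambda>x. (x, k))"

abbreviation end_space :: "'a topology \<Rightarrow> ('a \<times> real) topology" where
  "end_space P \<equiv> subtopology (cylinder P) (cylinder_ends P)"

lemma continuous_map_cylinder_end:
  assumes "k \<in> {0..1}"
  shows "continuous_map P (cylinder P) (cylinder_end k)"
  using assms by (simp add: cylinder_def continuous_map_paired)

lemma embedding_map_cylinder_end:
  assumes k: "k \<in> {0, 1}"
  shows "embedding_map P (end_space P) (cylinder_end k)"
    and "openin (end_space P) (cylinder_end k ` topspace P)"
proof -
  have "continuous_map P (end_space P) (cylinder_end k)"
    using continuous_map_cylinder_end[of k P] k
    by (auto simp: continuous_map_in_subtopology cylinder_ends_def)
  moreover have "continuous_map (end_space P) P fst"
    by (simp add: cylinder_def continuous_map_from_subtopology continuous_map_fst)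
  ultimately show "embedding_map P (end_space P) (cylinder_end k)"
    unfolding embedding_map_def homeomorphic_map_maps homeomorphic_maps_def
    by (intro exI[where x = fst])
       (auto simp: continuous_map_in_subtopology continuous_map_from_subtopology)
  have "open {k - 1/2 <..< k + 1/2}" by simp
  then have "openin (cylinder P) (topspace P \<times> ({0..1} \<inter> {k - 1/2 <..< k + 1/2}))"
    unfolding cylinder_def by (simp add: openin_prod_Times_iff openin_open_Int)
  moreover have "cylinder_end k ` topspace P
      = (topspace P \<times> ({0..1} \<inter> {k - 1/2 <..< k + 1/2})) \<inter> cylinder_ends P"
    using k by (auto simp: cylinder_ends_def)
  ultimately show "openin (end_space P) (cylinder_end k ` topspace P)"
    unfolding openin_subtopology by blast
qed

lemma continuous_map_end_space:
  "k \<in> {0, 1} \<Longrightarrow> continuous_map P (end_space P) (cylinder_end k)"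
  by (rule continuous_map_into_fulltopology[OF homeomorphic_imp_continuous_map
        [OF embedding_map_cylinder_end(1)[unfolded embedding_map_def]]])

lemma iso_homology_end_space:
  "(\<lambda>(a, b). hom_induced n P {} (end_space P) {} (cylinder_end 0) a
      \<otimes>\<^bsub>homology_group n (end_space P)\<^esub> hom_induced n P {} (end_space P) {} (cylinder_end 1) b)
     \<in> iso (homology_group n P \<times>\<times> homology_group n P) (homology_group n (end_space P))"
  by (intro iso_homology_disjoint_union embedding_map_cylinder_end)
     (auto simp: disjnt_def cylinder_ends_def)

lemma homotopic_cylinder_projection:
  assumes "continuous_map X (cylinder P) f" "k \<in> {0..1}"
  shows "homotopic_with (\<lambda>_. True) X (cylinder P) f (\<lambda>x. (fst (f x), k))"
proof -
  let ?I = "top_of_set {0..1::real}"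
  have f: "continuous_map (prod_topology ?I X) (cylinder P) (\<lambda>z. f (snd z))"
    using continuous_map_compose[OF continuous_map_snd assms(1)] by (simp add: o_def)
  have 1: "continuous_map (prod_topology ?I X) P (\<lambda>z. fst (f (snd z)))"
    using f continuous_map_compose[OF f[unfolded cylinder_def] continuous_map_fst] by (simp add: o_def)
  have s: "continuous_map (prod_topology ?I X) euclideanreal (\<lambda>z. snd (f (snd z)))"
    using continuous_map_compose[OF f[unfolded cylinder_def] continuous_map_snd]
    by (simp add: o_def continuous_map_in_subtopology)
  have t: "continuous_map (prod_topology ?I X) euclideanreal fst"
    by (rule continuous_map_into_fulltopology[OF continuous_map_fst])
  have "continuous_map (prod_topology ?I X) euclideanreal
          (\<lambda>z. (1 - fst z) * snd (f (snd z)) + fst z * k)"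
    by (intro continuous_map_add continuous_map_real_mult continuous_map_diff
        continuous_map_canonical_const t s)
  moreover have "(1 - t) * snd (f x) + t * k \<in> {0..1}" if "t \<in> {0..1}" "x \<in> topspace X" for t x
  proof -
    have "f x \<in> topspace (cylinder P)"
      using continuous_map_funspace[OF assms(1)] that(2) by blast
    then have "snd (f x) \<in> {0..1}" by (auto simp: mem_Times_iff)
    from convexD_alt[OF convex_real_interval(5) this assms(2), of t] that(1) show ?thesis
      by (simp only: real_scaleR_def atLeastAtMost_iff)
  qed
  ultimately have 2: "continuous_map (prod_topology ?I X) ?I
          (\<lambda>z. (1 - fst z) * snd (f (snd z)) + fst z * k)"
    unfolding continuous_map_in_subtopology Pi_iff by (simp add: mem_Times_iff)
  show ?thesis
    unfolding homotopic_with_def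
    by (rule exI[where x = "\<lambda>z. (fst (f (snd z)), (1 - fst z) * snd (f (snd z)) + fst z * k)"])
       (use continuous_map_pairedI[OF 1 2] in \<open>simp add: cylinder_def\<close>)
qed

text \<open>The class of \<open>a \<times> [0,1]\<close>. It is described through its boundary \<open>a \<times> 1 - a \<times> 0\<close>, which determines it because the
boundary map of the pair is injective.\<close>

definition susp :: "int \<Rightarrow> 'a topology \<Rightarrow> 'a chain set \<Rightarrow> ('a \<times> real) chain set" where
  "susp n P a =
     inv_into (carrier (relative_homology_group (n + 1) (cylinder P) (cylinder_ends P)))
       (hom_boundary (n + 1) (cylinder P) (cylinder_ends P))
       (hom_induced n P {} (end_space P) {} (cylinder_end 1) a
          \<otimes>\<^bsub>homology_group n (end_space P)\<^esub>
        inv\<^bsub>homology_group n (end_space P)\<^esub> hom_induced n P {} (end_space P) {} (cylinder_end 0) a)"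

text \<open>The cylinder can be pushed into its lower end, so the absolute homology of the ends maps onto that of the
cylinder, and the exact sequence of the pair breaks up into short ones.\<close>

lemma inj_hom_boundary_cylinder:
  "inj_on (hom_boundary n (cylinder P) (cylinder_ends P))
     (carrier (relative_homology_group n (cylinder P) (cylinder_ends P)))"
proof -
  have "homotopic_with (\<lambda>_. True) (cylinder P) (cylinder P) id (\<lambda>x. (fst (id x), 0))"
    by (rule homotopic_cylinder_projection) simp_all
  moreover have "(\<lambda>x. (fst (id x), 0)) \<in> topspace (cylinder P) \<rightarrow> cylinder_ends P"
    by (auto simp: cylinder_ends_def)
  ultimately show ?thesis
    using mon_hom_boundary_inclusion by (fastforce simp: mon_def)
qed

text \<open>The image of the boundary map is the kernel of \<open>H\<^sub>n(P) \<oplus> H\<^sub>n(P) \<rightarrow> H\<^sub>n(P \<times> [0,1])\<close>. Both ends include into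
the cylinder by homotopic maps that are injective on homology, so this kernel is
the antidiagonal, a copy of \<open>H\<^sub>n(P)\<close>.\<close>

lemma susp_iso_boundary:
  shows iso_susp: "susp n P \<in> iso (homology_group n P)
      (relative_homology_group (n + 1) (cylinder P) (cylinder_ends P))"
    and boundary_susp: "a \<in> carrier (homology_group n P) \<Longrightarrow>
      hom_boundary (n + 1) (cylinder P) (cylinder_ends P) (susp n P a)
       = hom_induced n P {} (end_space P) {} (cylinder_end 1) a
          \<otimes>\<^bsub>homology_group n (end_space P)\<^esub>
        inv\<^bsub>homology_group n (end_space P)\<^esub> hom_induced n P {} (end_space P) {} (cylinder_end 0) a"
proof -
  let ?C = "cylinder P" and ?E = "cylinder_ends P"
  let ?R = "relative_homology_group (n + 1) ?C ?E" and ?H = "homology_group n P"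
  let ?HE = "homology_group n (end_space P)"
  let ?d = "hom_boundary (n + 1) ?C ?E"
  let ?e0 = "hom_induced n P {} (end_space P) {} (cylinder_end 0)"
  let ?e1 = "hom_induced n P {} (end_space P) {} (cylinder_end 1)"
  let ?i = "hom_induced n (end_space P) {} ?C {} id"
  let ?j = "hom_induced n P {} ?C {} (cylinder_end 0)"
  interpret e0: group_hom ?H ?HE ?e0 by (rule group_hom_hom_induced)
  interpret e1: group_hom ?H ?HE ?e1 by (rule group_hom_hom_induced)
  interpret i: group_hom ?HE "homology_group n ?C" ?i by (rule group_hom_hom_induced)
  interpret j: group_hom ?H "homology_group n ?C" ?j by (rule group_hom_hom_induced)
  interpret d: group_hom ?R ?HE ?d using group_hom_hom_boundary[of "n + 1" ?C ?E] by simp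
  interpret comm_group ?HE by simp
  have ie: "?i (?e0 a) = ?j a" "?i (?e1 a) = ?j a" for a
  proof -
    show "?i (?e0 a) = ?j a"
      by (subst hom_induced_compose')
         (simp_all add: continuous_map_end_space continuous_map_from_subtopology)
    have "homotopic_with (\<lambda>_. True) P ?C (cylinder_end 1) (\<lambda>x. (fst (x, 1::real), 0))"
      by (rule homotopic_cylinder_projection) (simp_all add: continuous_map_cylinder_end)
    then have "?j = hom_induced n P {} ?C {} (cylinder_end 1)"
      by (simp add: homology_homotopy_empty[symmetric])
    then show "?i (?e1 a) = ?j a"
      by (subst hom_induced_compose')
         (simp_all add: continuous_map_end_space continuous_map_from_subtopology)
  qed
  have inj_j: "inj_on ?j (carrier ?H)"
  proof (rule inj_on_hom_induced_section_map)
    show "section_map P ?C (cylinder_end 0)"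
      unfolding section_map_def retraction_maps_def
      by (intro exI[where x = fst])
         (simp add: continuous_map_cylinder_end, simp add: cylinder_def continuous_map_fst)
  qed
  have ker: "kernel ?HE (homology_group n ?C) ?i = ?d ` carrier ?R"
    using kernel_hom_induced_inclusion[of "n + 1" ?C ?E] by simp
  have inj_d: "inj_on ?d (carrier ?R)" by (rule inj_hom_boundary_cylinder)
  let ?D = "\<lambda>a. ?e1 a \<otimes>\<^bsub>?HE\<^esub> inv\<^bsub>?HE\<^esub> ?e0 a"
  have D: "?D a \<in> ?d ` carrier ?R" if "a \<in> carrier ?H" for a
    unfolding ker[symmetric] kernel_def using that by (simp add: ie)
  show bd: "?d (susp n P a) = ?D a" if "a \<in> carrier ?H" for a
    unfolding susp_def using D[OF that] by (rule f_inv_into_f)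
  have car: "susp n P a \<in> carrier ?R" if "a \<in> carrier ?H" for a
    unfolding susp_def using D[OF that] by (rule inv_into_into)
  have uniq: "a = a' \<and> b = b'"
    if "?e0 a \<otimes>\<^bsub>?HE\<^esub> ?e1 b = ?e0 a' \<otimes>\<^bsub>?HE\<^esub> ?e1 b'"
       "a \<in> carrier ?H" "a' \<in> carrier ?H" "b \<in> carrier ?H" "b' \<in> carrier ?H" for a b a' b'
    using inj_onD[OF conjunct2[OF conjunct2[OF iso_homology_end_space[unfolded iso_iff]]], of n P "(a, b)" "(a', b')"] that
    by simp
  have D_eq: "?D a = ?e0 (inv\<^bsub>?H\<^esub> a) \<otimes>\<^bsub>?HE\<^esub> ?e1 a" if "a \<in> carrier ?H" for a
    using that by (simp add: m_comm)
  show "susp n P \<in> iso ?H ?R"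
    unfolding iso_iff
  proof (intro conjI)
    show "susp n P \<in> hom ?H ?R"
    proof (rule homI)
      fix a b assume a: "a \<in> carrier ?H" and b: "b \<in> carrier ?H"
      have "?d (susp n P (a \<otimes>\<^bsub>?H\<^esub> b)) = ?D (a \<otimes>\<^bsub>?H\<^esub> b)"
        by (rule bd[OF e0.G.m_closed[OF a b]])
      also have "\<dots> = ?D a \<otimes>\<^bsub>?HE\<^esub> ?D b"
        unfolding e0.hom_mult[OF a b] e1.hom_mult[OF a b]
        by (rule diff_mult_diff) (rule e0.hom_closed[OF a] e0.hom_closed[OF b] e1.hom_closed[OF a] e1.hom_closed[OF b])+
      also have "\<dots> = ?d (susp n P a \<otimes>\<^bsub>?R\<^esub> susp n P b)"
        unfolding d.hom_mult[OF car[OF a] car[OF b]] bd[OF a] bd[OF b] ..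
      finally have "?d (susp n P (a \<otimes>\<^bsub>?H\<^esub> b)) = ?d (susp n P a \<otimes>\<^bsub>?R\<^esub> susp n P b)" .
      then show "susp n P (a \<otimes>\<^bsub>?H\<^esub> b) = susp n P a \<otimes>\<^bsub>?R\<^esub> susp n P b"
        by (rule inj_onD[OF inj_d _ car[OF e0.G.m_closed[OF a b]] d.G.m_closed[OF car[OF a] car[OF b]]])
    qed (rule car)
    show "inj_on (susp n P) (carrier ?H)"
    proof (rule inj_onI)
      fix a b assume ab: "a \<in> carrier ?H" "b \<in> carrier ?H" and "susp n P a = susp n P b"
      then have "?D a = ?D b" using bd by metis
      then show "a = b" using ab uniq[of "inv\<^bsub>?H\<^esub> a" a "inv\<^bsub>?H\<^esub> b" b] by (simp add: D_eq)
    qed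
    show "susp n P ` carrier ?H = carrier ?R"
    proof (rule Set.set_eqI, rule iffI)
      fix z assume "z \<in> susp n P ` carrier ?H"
      then show "z \<in> carrier ?R" using car by blast
    next
      fix z assume z: "z \<in> carrier ?R"
      then have "?d z \<in> kernel ?HE (homology_group n ?C) ?i"
        unfolding ker by (rule imageI)
      then have dz: "?d z \<in> carrier ?HE" "?i (?d z) = \<one>\<^bsub>homology_group n ?C\<^esub>"
        unfolding kernel_def by blast+
      obtain a b where ab: "a \<in> carrier ?H" "b \<in> carrier ?H" and eq: "?d z = ?e0 a \<otimes>\<^bsub>?HE\<^esub> ?e1 b"
        using dz(1) unfolding conjunct1[OF conjunct2[OF iso_homology_end_space[unfolded iso_iff]], symmetric]
        by (auto simp: DirProd_def)
      have "?j (a \<otimes>\<^bsub>?H\<^esub> b) = ?j \<one>\<^bsub>?H\<^esub>"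
        using dz(2) ab unfolding eq by (simp add: ie)
      then have "a \<otimes>\<^bsub>?H\<^esub> b = \<one>\<^bsub>?H\<^esub>"
        using ab by (intro inj_onD[OF inj_j]) simp_all
      then have "a = inv\<^bsub>?H\<^esub> b"
        using ab by (simp add: e0.G.inv_equality)
      then have "?d (susp n P b) = ?d z"
        using ab by (simp add: bd eq m_comm)
      then show "z \<in> susp n P ` carrier ?H"
        using inj_onD[OF inj_d _ car[OF ab(2)] z] ab(2) by blast
    qed
  qed
qed

text \<open>Both sides have the same boundary.\<close>

lemma susp_natural:
  assumes h: "continuous_map P Q h" and a: "a \<in> carrier (homology_group n P)"
  shows "hom_induced (n + 1) (cylinder P) (cylinder_ends P) (cylinder Q) (cylinder_ends Q)
           (\<lambda>(x, s). (h x, s)) (susp n P a)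
       = susp n Q (hom_induced n P {} Q {} h a)"
proof -
  let ?k = "\<lambda>(x, s::real). (h x, s)"
  let ?f = "hom_induced n (end_space P) {} (end_space Q) {} ?k"
  let ?F = "hom_induced (n + 1) (cylinder P) (cylinder_ends P) (cylinder Q) (cylinder_ends Q) ?k"
  let ?d = "\<lambda>Q. hom_boundary (n + 1) (cylinder Q) (cylinder_ends Q)"
  have contk: "continuous_map (cylinder P) (cylinder Q) ?k"
    using h unfolding cylinder_def by (simp add: continuous_map_prod_top)
  have kim: "?k \<in> cylinder_ends P \<rightarrow> cylinder_ends Q"
    using continuous_map_funspace[OF h] by (auto simp: cylinder_ends_def)
  have contk': "continuous_map (end_space P) (end_space Q) ?k"
    by (rule continuous_map_into_subtopology[OF continuous_map_from_subtopology[OF contk]])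
       (use kim in \<open>simp add: Pi_iff\<close>)
  interpret f: group_hom "homology_group n (end_space P)" "homology_group n (end_space Q)" ?f
    by (rule group_hom_hom_induced)
  have fe: "?f (hom_induced n P {} (end_space P) {} (cylinder_end k) a)
      = hom_induced n Q {} (end_space Q) {} (cylinder_end k) (hom_induced n P {} Q {} h a)"
    if "k \<in> {0, 1}" for k
    using that h contk' by (simp add: hom_induced_compose' continuous_map_end_space o_def)
  have *: "?d Q (?F z) = ?f (?d P z)" for z
    using naturality_hom_induced[OF contk kim, of "n + 1"] by (simp add: fun_eq_iff)
  have "?d Q (?F (susp n P a)) = ?d Q (susp n Q (hom_induced n P {} Q {} h a))"
    by (simp add: * boundary_susp[OF a] boundary_susp[OF hom_induced_carrier] hom_induced_carrier fe)
  moreover have "susp n Q (hom_induced n P {} Q {} h a)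
      \<in> carrier (relative_homology_group (n + 1) (cylinder Q) (cylinder_ends Q))"
    by (rule hom_in_carrier[OF iso_imp_homomorphism[OF iso_susp] hom_induced_carrier])
  ultimately show ?thesis
    by (rule inj_onD[OF inj_hom_boundary_cylinder _ hom_induced_carrier])
qed

context glued_cylinder
begin

text \<open>The image in \<open>H\<^sub>n\<^sub>+\<^sub>1(Z,F)\<close> of the class of \<open>a \<times> [0,1]\<close>.\<close>

definition attach :: "int \<Rightarrow> 'a chain set \<Rightarrow> 'b chain set" where
  "attach n a = hom_induced (n + 1) (cylinder P) (cylinder_ends P) Z glued_ends q (susp n P a)"

lemma iso_attach: "attach n \<in> iso (homology_group n P) (relative_homology_group (n + 1) Z glued_ends)"
  using iso_set_trans[OF iso_susp iso_relative_homology] by (simp add: attach_def[abs_def] o_def)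

lemma continuous_map_glued_end:
  "k \<in> {0, 1} \<Longrightarrow> continuous_map P (subtopology Z glued_ends) (\<lambda>x. q (x, k))"
  using continuous_map_compose[OF continuous_map_cylinder_end[of k P] continuous]
  by (auto simp: o_def continuous_map_in_subtopology cylinder_ends_def)

lemma boundary_attach:
  assumes a: "a \<in> carrier (homology_group n P)"
  shows "hom_boundary (n + 1) Z glued_ends (attach n a)
    = hom_induced n P {} (subtopology Z glued_ends) {} (\<lambda>x. q (x, 1)) a
        \<otimes>\<^bsub>homology_group n (subtopology Z glued_ends)\<^esub>
      inv\<^bsub>homology_group n (subtopology Z glued_ends)\<^esub>
        hom_induced n P {} (subtopology Z glued_ends) {} (\<lambda>x. q (x, 0)) a"
proof -
  let ?f = "hom_induced n (end_space P) {} (subtopology Z glued_ends) {} q"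
  have cont: "continuous_map (end_space P) (subtopology Z glued_ends) q"
    using continuous by (auto simp: continuous_map_in_subtopology continuous_map_from_subtopology)
  interpret f: group_hom "homology_group n (end_space P)" "homology_group n (subtopology Z glued_ends)" ?f
    by (rule group_hom_hom_induced)
  have "hom_boundary (n + 1) Z glued_ends (attach n a)
      = ?f (hom_boundary (n + 1) (cylinder P) (cylinder_ends P) (susp n P a))"
    using naturality_hom_induced[OF continuous, of "cylinder_ends P" glued_ends "n + 1"]
    by (auto simp: attach_def fun_eq_iff)
  then show ?thesis
    using cont by (simp add: boundary_susp[OF a] hom_induced_carrier hom_induced_compose' continuous_map_end_space o_def)
qed

end

lemma attach_natural:
  assumes q: "glued_cylinder P Z q" and r: "glued_cylinder Q W r"
    and h: "continuous_map P Q h" and k: "continuous_map Z W k"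
    and comm: "\<And>x s. \<lbrakk>x \<in> topspace P; s \<in> {0..1}\<rbrakk> \<Longrightarrow> k (q (x, s)) = r (h x, s)"
    and a: "a \<in> carrier (homology_group n P)"
  shows "hom_induced (n + 1) Z (q ` cylinder_ends P) W (r ` cylinder_ends Q) k (glued_cylinder.attach P Z q n a)
       = glued_cylinder.attach Q W r n (hom_induced n P {} Q {} h a)"
proof -
  interpret q: glued_cylinder P Z q by fact
  interpret r: glued_cylinder Q W r by fact
  let ?k = "\<lambda>(x, s::real). (h x, s)"
  have contk: "continuous_map (cylinder P) (cylinder Q) ?k"
    using h unfolding cylinder_def by (simp add: continuous_map_prod_top)
  have hP: "h x \<in> topspace Q" if "x \<in> topspace P" for x
    using continuous_map_funspace[OF h] that by blast
  have kim: "?k \<in> cylinder_ends P \<rightarrow> cylinder_ends Q"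
    using hP by (auto simp: cylinder_ends_def)
  have kq: "k \<in> q ` cylinder_ends P \<rightarrow> r ` cylinder_ends Q"
    using hP by (fastforce simp: cylinder_ends_def comm)
  have "hom_induced (n + 1) Z (q ` cylinder_ends P) W (r ` cylinder_ends Q) k (q.attach n a)
      = hom_induced (n + 1) (cylinder P) (cylinder_ends P) W (r ` cylinder_ends Q) (k \<circ> q) (susp n P a)"
    unfolding q.attach_def using q.continuous k kq by (subst hom_induced_compose') auto
  also have "\<dots> = hom_induced (n + 1) (cylinder P) (cylinder_ends P) W (r ` cylinder_ends Q) (r \<circ> ?k) (susp n P a)"
    by (rule fun_cong[OF hom_induced_eq]) (auto simp: comm)
  also have "\<dots> = r.attach n (hom_induced n P {} Q {} h a)"
    unfolding r.attach_def susp_natural[OF h a, symmetric]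
    using contk kim r.continuous by (subst hom_induced_compose') auto
  finally show ?thesis .
qed

section \<open>Homology in degree zero\<close>

text \<open>A singular \<open>0\<close>-simplex is a point, and a path from \<open>x\<close> to \<open>f x\<close> is a singular \<open>1\<close>-simplex whose boundary is
their difference.\<close>

lemma hom_induced_0_path_components:
  assumes f: "continuous_map X X f"
    and path: "\<And>x. x \<in> topspace X \<Longrightarrow> path_component_of X x (f x)"
    and c: "c \<in> carrier (homology_group 0 X)"
  shows "hom_induced 0 X {} X {} f c = c"
proof -
  let ?p = "\<lambda>j::nat. if j = 0 then 1 else 0 :: real"
  obtain a where a: "singular_relcycle 0 X {} a" and c_eq: "c = homologous_rel_set 0 X {} a"
    using c by (auto simp: carrier_relative_homology_group_0)
  have simplex: "homologous_rel 0 X {} (frag_of (simplex_map 0 f \<sigma>)) (frag_of \<sigma>)"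
    if \<sigma>: "singular_simplex 0 X \<sigma>" for \<sigma>
  proof -
    define T where "T = Collect (path_component_of X (\<sigma> ?p))"
    have p: "\<sigma> ?p \<in> topspace X"
      using \<sigma> by (auto simp: singular_simplex_def standard_simplex_0 continuous_map_def)
    have f\<sigma>: "singular_simplex 0 X (simplex_map 0 f \<sigma>)"
      by (rule singular_simplex_simplex_map[OF \<sigma> f])
    have "path_connected_space (subtopology X T)"
      using path_connectedin_path_component_of[of X "\<sigma> ?p"] by (simp add: T_def path_connectedin_def)
    moreover have "singular_simplex 0 (subtopology X T) \<sigma>"
      using \<sigma> p by (simp add: singular_simplex_subtopology standard_simplex_0 T_def path_component_of_refl)
    moreover have "singular_simplex 0 (subtopology X T) (simplex_map 0 f \<sigma>)"
      using f\<sigma> path[OF p]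
      by (simp add: singular_simplex_subtopology standard_simplex_0 T_def simplex_map_def)
    ultimately have "homologous_rel 0 (subtopology X T) {} (frag_of (simplex_map 0 f \<sigma>)) (frag_of \<sigma>)"
      by (intro iso_integer_zeroth_homology_group_aux)
    then show ?thesis
      unfolding homologous_rel_def using singular_boundary_mono[of T "topspace X" 0 X] 
      by (simp add: T_def path_component_of_subset_topspace)
  qed
  have "Poly_Mapping.keys a \<subseteq> singular_simplex_set 0 X"
    using a by (simp add: singular_relcycle singular_chain_def)
  then have "homologous_rel 0 X {} (chain_map 0 f a) a"
  proof (induction a rule: frag_induction)
    case (one \<sigma>)
    then show ?case using simplex by simp
  next
    case (diff a b)
    then show ?case by (simp add: chain_map_diff homologous_rel_diff)
  qed simp
  moreover have "hom_induced 0 X {} X {} f c = homologous_rel_set 0 X {} (chain_map 0 f a)"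
    using hom_induced_chain_map[OF f _ a] by (simp add: c_eq)
  ultimately show ?thesis
    by (simp add: c_eq homologous_rel_set_eq)
qed

lemma inj_on_hom_induced_0:
  assumes f: "continuous_map X Y f" and g: "continuous_map Y X g"
    and path: "\<And>x. x \<in> topspace X \<Longrightarrow> path_component_of X x (g (f x))"
  shows "inj_on (hom_induced 0 X {} Y {} f) (carrier (homology_group 0 X))"
proof (rule inj_on_inverseI)
  fix c assume "c \<in> carrier (homology_group 0 X)"
  then show "hom_induced 0 Y {} X {} g (hom_induced 0 X {} Y {} f c) = c"
    using hom_induced_0_path_components[of X "g \<circ> f" c] f g path
    by (simp add: hom_induced_compose' continuous_map_compose)
qed

lemma path_component_of_fibre:
  assumes Y: "path_connected_space Y" "y0 \<in> topspace Y" and x: "x \<in> topspace (prod_topology X Y)"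
  shows "path_component_of (prod_topology X Y) x (fst x, y0)"
proof -
  obtain g where g: "pathin Y g" "g 0 = snd x" "g 1 = y0"
    using Y x unfolding path_connected_space_def by (auto simp: mem_Times_iff)
  have "pathin (prod_topology X Y) (\<lambda>t. (fst x, g t))"
    using g(1) x unfolding pathin_def by (intro continuous_map_pairedI) (auto simp: mem_Times_iff)
  then show ?thesis
    unfolding path_component_of_def using g by (intro exI[of _ "\<lambda>t. (fst x, g t)"]) simp
qed

text \<open>A section of the projection moves points only within the path connected fibres.\<close>

lemma inj_on_hom_induced_0_fst:
  assumes Y: "path_connected_space Y" "topspace Y \<noteq> {}"
  shows "inj_on (hom_induced 0 (prod_topology X Y) {} X {} fst) (carrier (homology_group 0 (prod_topology X Y)))"
proof -
  obtain y0 where y0: "y0 \<in> topspace Y" using Y(2) by blast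
  show ?thesis
  proof (rule inj_on_hom_induced_0[OF continuous_map_fst, where g = "\<lambda>x. (x, y0)"])
    show "continuous_map X (prod_topology X Y) (\<lambda>x. (x, y0))"
      using y0 by (simp add: continuous_map_paired)
  qed (rule path_component_of_fibre[OF Y(1) y0])
qed

section \<open>The exact sequence of a glued cylinder\<close>

context glued_cylinder
begin

abbreviation glued_end_space :: "'b topology" where
  "glued_end_space \<equiv> subtopology Z glued_ends"

abbreviation end_map :: "real \<Rightarrow> int \<Rightarrow> 'a chain set \<Rightarrow> 'b chain set" where
  "end_map k n \<equiv> hom_induced n P {} glued_end_space {} (\<lambda>x. q (x, k))"

lemma boundary_attach_eq_one_iff:
  assumes a: "a \<in> carrier (homology_group n P)"
  shows "hom_boundary (n + 1) Z glued_ends (attach n a) = \<one>\<^bsub>homology_group n glued_end_space\<^esub>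
    \<longleftrightarrow> end_map 0 n a = end_map 1 n a"
proof -
  interpret group "homology_group n glued_end_space" by simp
  show ?thesis
    unfolding boundary_attach[OF a]
    using hom_induced_carrier[of n P "{}" glued_end_space "{}"]
    by (metis inv_closed inv_inv inv_equality r_inv)
qed

text \<open>The assumption makes \<open>H\<^sub>n\<^sub>+\<^sub>1(Z)\<close> a subgroup of \<open>H\<^sub>n\<^sub>+\<^sub>1(Z,F)\<close>, namely the kernel of the boundary map, and under the
isomorphism with \<open>H\<^sub>n(P)\<close> that map is the difference of the end maps.\<close>

proposition iso_homology_glued:
  assumes zero: "\<And>c. c \<in> carrier (homology_group (n + 1) glued_end_space) \<Longrightarrow>
      hom_induced (n + 1) glued_end_space {} Z {} id c = \<one>\<^bsub>homology_group (n + 1) Z\<^esub>"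
  shows "(homology_group n P)\<lparr>carrier := {a \<in> carrier (homology_group n P). end_map 0 n a = end_map 1 n a}\<rparr>
     \<cong> homology_group (n + 1) Z"
proof -
  let ?H = "homology_group (n + 1) Z" and ?R = "relative_homology_group (n + 1) Z glued_ends"
  let ?j = "hom_induced (n + 1) Z {} Z glued_ends id" and ?d = "hom_boundary (n + 1) Z glued_ends"
  let ?K = "{a \<in> carrier (homology_group n P). end_map 0 n a = end_map 1 n a}"
  let ?L = "?R\<lparr>carrier := ?j ` carrier ?H\<rparr>"
  interpret j: group_hom ?H ?R ?j by (rule group_hom_hom_induced)
  have "kernel ?H ?R ?j = {\<one>\<^bsub>?H\<^esub>}"
    unfolding kernel_hom_induced_relativization
    using zero hom_induced_carrier j.G.one_closed
      group_hom.hom_one[OF group_hom_hom_induced[of "n + 1" glued_end_space "{}" Z "{}" id]]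
    by (metis (no_types, lifting) group.is_monoid group_relative_homology_group image_cong image_constant monoid.one_closed)
  then have "inj_on ?j (carrier ?H)" by (rule j.trivial_ker_imp_inj)
  then have j: "?j \<in> iso ?H ?L"
    using j.homh by (simp add: iso_iff hom_def Pi_iff)
  have ker: "kernel ?R (homology_group n glued_end_space) ?d = ?j ` carrier ?H"
    using kernel_hom_boundary[of "n + 1" Z glued_ends] by simp
  have A: "attach n \<in> hom (homology_group n P) ?R" "attach n ` carrier (homology_group n P) = carrier ?R"
    "inj_on (attach n) (carrier (homology_group n P))"
    using iso_attach by (simp_all only: iso_iff)
  have "attach n ` ?K = ?j ` carrier ?H"
  proof -
    have "attach n ` ?K = {z \<in> attach n ` carrier (homology_group n P). ?d z = \<one>\<^bsub>homology_group n glued_end_space\<^esub>}"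
      using boundary_attach_eq_one_iff[of _ n] by blast
    also have "\<dots> = ?j ` carrier ?H"
      unfolding A(2) ker[symmetric] kernel_def ..
    finally show ?thesis .
  qed
  moreover have "inj_on (attach n) ?K"
    by (rule inj_on_subset[OF A(3)]) blast
  moreover have "attach n a \<in> attach n ` ?K" if "a \<in> ?K" for a using that by blast
  ultimately have "attach n \<in> iso ((homology_group n P)\<lparr>carrier := ?K\<rparr>) ?L"
    using A(1) by (simp add: iso_iff hom_def Pi_iff)
  then have "(homology_group n P)\<lparr>carrier := ?K\<rparr> \<cong> ?L" by (rule is_isoI)
  moreover have "?L \<cong> ?H"
    using j j.G.iso_sym is_isoI by blast
  ultimately show ?thesis by (rule iso_trans)
qed

corollary trivial_homology_glued:
  assumes "\<And>c. c \<in> carrier (homology_group (n + 1) glued_end_space) \<Longrightarrow>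
      hom_induced (n + 1) glued_end_space {} Z {} id c = \<one>\<^bsub>homology_group (n + 1) Z\<^esub>"
    and "\<And>a. \<lbrakk>a \<in> carrier (homology_group n P); end_map 0 n a = end_map 1 n a\<rbrakk>
      \<Longrightarrow> a = \<one>\<^bsub>homology_group n P\<^esub>"
  shows "trivial_group (homology_group (n + 1) Z)"
proof -
  let ?K = "{a \<in> carrier (homology_group n P). end_map 0 n a = end_map 1 n a}"
  obtain h where "h \<in> iso ((homology_group n P)\<lparr>carrier := ?K\<rparr>) (homology_group (n + 1) Z)"
    using iso_homology_glued[OF assms(1)] by (auto simp: is_iso_def)
  then have "carrier (homology_group (n + 1) Z) = h ` ?K" by (simp add: iso_iff)
  also have "\<dots> \<subseteq> {h \<one>\<^bsub>homology_group n P\<^esub>}" using assms(2) by blast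
  finally show ?thesis
    using group.trivial_group_alt[OF group_relative_homology_group] by blast
qed

end

section \<open>Disjoint copies of a space\<close>

lemma sum_group_reindex:
  assumes h: "bij_betw h I I'" and G: "\<And>i. i \<in> I' \<Longrightarrow> group (G i)"
  shows "sum_group I' G \<cong> sum_group I (\<lambda>i. G (h i))"
proof -
  have hI: "h i \<in> I'" if "i \<in> I" for i using h that by (auto simp: bij_betw_def)
  have inj: "inj_on h I" and img: "h ` I = I'" using h by (auto simp: bij_betw_def)
  let ?\<phi> = "\<lambda>x. \<lambda>i\<in>I. x (h i)"
  have fin: "finite {i \<in> I. x (h i) \<noteq> \<one>\<^bsub>G (h i)\<^esub>} \<longleftrightarrow> finite {i \<in> I'. x i \<noteq> \<one>\<^bsub>G i\<^esub>}" for x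
  proof -
    have "h ` {i \<in> I. x (h i) \<noteq> \<one>\<^bsub>G (h i)\<^esub>} = {i \<in> I'. x i \<noteq> \<one>\<^bsub>G i\<^esub>}"
      using img by auto
    moreover have "inj_on h {i \<in> I. x (h i) \<noteq> \<one>\<^bsub>G (h i)\<^esub>}"
      by (rule inj_on_subset[OF inj]) blast
    ultimately show ?thesis
      using finite_image_iff[of h "{i \<in> I. x (h i) \<noteq> \<one>\<^bsub>G (h i)\<^esub>}"] by simp
  qed
  have car': "carrier (sum_group I' G) = {x \<in> \<Pi>\<^sub>E i\<in>I'. carrier (G i). finite {i \<in> I'. x i \<noteq> \<one>\<^bsub>G i\<^esub>}}"
    using G by (rule carrier_sum_group)
  have car: "carrier (sum_group I (\<lambda>i. G (h i)))
      = {x \<in> \<Pi>\<^sub>E i\<in>I. carrier (G (h i)). finite {i \<in> I. x i \<noteq> \<one>\<^bsub>G (h i)\<^esub>}}"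
    using G hI by (intro carrier_sum_group) blast
  have fin_cong: "{i \<in> I. (if i \<in> I then x (h i) else undefined) \<noteq> \<one>\<^bsub>G (h i)\<^esub>} = {i \<in> I. x (h i) \<noteq> \<one>\<^bsub>G (h i)\<^esub>}" for x
    by auto
  have "?\<phi> \<in> iso (sum_group I' G) (sum_group I (\<lambda>i. G (h i)))"
    unfolding iso_iff
  proof (intro conjI)
    show "?\<phi> \<in> hom (sum_group I' G) (sum_group I (\<lambda>i. G (h i)))"
    proof (rule homI)
      show "?\<phi> x \<in> carrier (sum_group I (\<lambda>i. G (h i)))" if "x \<in> carrier (sum_group I' G)" for x
        using that fin[of x] hI unfolding car car' by (auto simp: PiE_iff restrict_def fin_cong extensional_def)
    qed (use hI in \<open>auto simp: restrict_def\<close>)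
    show "inj_on ?\<phi> (carrier (sum_group I' G))"
    proof (rule inj_onI)
      fix x y assume xy: "x \<in> carrier (sum_group I' G)" "y \<in> carrier (sum_group I' G)" and eq: "?\<phi> x = ?\<phi> y"
      have "x i = y i" if i: "i \<in> I'" for i
      proof -
        obtain k where "k \<in> I" "i = h k" using i img by blast
        then show ?thesis using fun_cong[OF eq, of k] by simp
      qed
      then show "x = y" using xy unfolding car' by (auto intro: PiE_ext)
    qed
    show "?\<phi> ` carrier (sum_group I' G) = carrier (sum_group I (\<lambda>i. G (h i)))"
    proof (rule Set.set_eqI, rule iffI)
      fix y assume y: "y \<in> carrier (sum_group I (\<lambda>i. G (h i)))"
      define x where "x = (\<lambda>i\<in>I'. y (inv_into I h i))"
      have xh: "x (h i) = y i" if "i \<in> I" for i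
        using that inj hI by (simp add: x_def)
      have "x i \<in> carrier (G i)" if i: "i \<in> I'" for i
      proof -
        obtain k where "k \<in> I" "i = h k" using i img by blast
        then show ?thesis using y xh unfolding car by (auto simp: PiE_iff)
      qed
      moreover have "{i \<in> I. x (h i) \<noteq> \<one>\<^bsub>G (h i)\<^esub>} = {i \<in> I. y i \<noteq> \<one>\<^bsub>G (h i)\<^esub>}"
        using xh by auto
      then have "finite {i \<in> I'. x i \<noteq> \<one>\<^bsub>G i\<^esub>}"
        using y fin[of x] unfolding car by simp
      moreover have "x \<in> extensional I'" by (simp add: x_def)
      ultimately have "x \<in> carrier (sum_group I' G)" unfolding car' by (simp add: PiE_iff)
      moreover have "?\<phi> x = y"
        using y unfolding car by (auto simp: fun_eq_iff PiE_iff extensional_def restrict_def xh)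
      ultimately show "y \<in> ?\<phi> ` carrier (sum_group I' G)" by blast
    next
      fix y assume "y \<in> ?\<phi> ` carrier (sum_group I' G)"
      then obtain x where "x \<in> carrier (sum_group I' G)" "y = ?\<phi> x" by blast
      then show "y \<in> carrier (sum_group I (\<lambda>i. G (h i)))"
        using fin[of x] hI unfolding car car' by (auto simp: PiE_iff restrict_def fin_cong extensional_def)
    qed
  qed
  then show ?thesis by (rule is_isoI)
qed

lemma homology_discrete_times:
  fixes J :: "'j set" and Y :: "'b topology"
  assumes "topspace Y \<noteq> {}"
  shows "homology_group n (prod_topology (discrete_topology J) Y) \<cong> sum_group J (\<lambda>_. homology_group n Y)"
proof -
  let ?P = "prod_topology (discrete_topology J) Y"
  define U where "U j = {j} \<times> topspace Y" for j :: 'j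
  have "pairwise disjnt (U ` J)" "\<Union> (U ` J) = topspace ?P" "\<And>V. V \<in> U ` J \<Longrightarrow> openin ?P V"
    by (auto simp: U_def pairwise_def disjnt_def openin_prod_Times_iff)
  from is_isoI[OF homology_additivity_axiom[OF this, of n]]
  have "homology_group n ?P \<cong> sum_group (U ` J) (\<lambda>V. homology_group n (subtopology ?P V))"
    by (rule group.iso_sym[OF sum_group[OF group_relative_homology_group]])
  also have "\<dots> \<cong> sum_group J (\<lambda>j. homology_group n (subtopology ?P (U j)))"
  proof (rule sum_group_reindex[OF _ group_relative_homology_group])
    show "bij_betw U J (U ` J)"
      using assms unfolding bij_betw_def inj_on_def U_def by blast
  qed
  also have "\<dots> \<cong> sum_group J (\<lambda>_. homology_group n Y)"
  proof (rule iso_sum_groupI)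
    fix j assume "j \<in> J"
    then have "homeomorphic_maps Y (subtopology ?P (U j)) (\<lambda>y. (j, y)) snd"
      by (auto simp: homeomorphic_maps_def U_def continuous_map_in_subtopology continuous_map_paired
          continuous_map_from_subtopology continuous_map_snd)
    then have "subtopology ?P (U j) homeomorphic_space Y"
      using homeomorphic_maps_sym homeomorphic_space_def by blast
    then show "homology_group n (subtopology ?P (U j)) \<cong> homology_group n Y"
      by (rule homeomorphic_space_imp_isomorphic_homology_groups)
  qed simp_all
  finally show ?thesis .
qed

text \<open>Split off the sheet over \<open>j0\<close>, on which the projection is the identity. A class is
killed by the projection iff its component on that sheet cancels the sum of the others, so the other
components can be prescribed freely.\<close>

lemma kernel_projection_discrete_times:
  assumes j0: "j0 \<in> J"
  shows "homology_group n (prod_topology (discrete_topology (J - {j0})) Y)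
     \<cong> (homology_group n (prod_topology (discrete_topology J) Y))\<lparr>carrier :=
          kernel (homology_group n (prod_topology (discrete_topology J) Y)) (homology_group n Y)
            (hom_induced n (prod_topology (discrete_topology J) Y) {} Y {} snd)\<rparr>"
proof -
  let ?P = "prod_topology (discrete_topology J) Y"
  let ?B = "prod_topology (discrete_topology (J - {j0})) Y"
  let ?HP = "homology_group n ?P" and ?HB = "homology_group n ?B" and ?HY = "homology_group n Y"
  let ?s = "hom_induced n Y {} ?P {} (\<lambda>y. (j0, y))" and ?i = "hom_induced n ?B {} ?P {} id"
  let ?r = "hom_induced n ?P {} Y {} snd"
  have sub: "?B = subtopology ?P ((J - {j0}) \<times> topspace Y)"
  proof -
    have eq: "J \<inter> (J - {j0}) = J - {j0}" by blast
    have "?B = prod_topology (subtopology (discrete_topology J) (J - {j0})) Y"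
      by (simp add: eq)
    then show ?thesis by (simp only: prod_topology_subtopology)
  qed
  have conts: "continuous_map Y ?P (\<lambda>y. (j0, y))"
    using j0 by (simp add: continuous_map_paired)
  have conti: "continuous_map ?B ?P id"
    unfolding sub by (simp add: continuous_map_from_subtopology)
  interpret s: group_hom ?HY ?HP ?s by (rule group_hom_hom_induced)
  interpret i: group_hom ?HB ?HP ?i by (rule group_hom_hom_induced)
  interpret r: group_hom ?HP ?HY ?r by (rule group_hom_hom_induced)
  interpret P: comm_group ?HP by simp
  have rs: "?r (?s u) = u" if "u \<in> carrier ?HY" for u
    using hom_induced_compose'[OF conts _ continuous_map_snd, of "{}" "{}" "{}" n u] hom_induced_id[OF that]
    by (simp add: o_def id_def)
  have "homeomorphic_map Y (subtopology ?P ((\<lambda>y. (j0, y)) ` topspace Y)) (\<lambda>y. (j0, y))"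
    unfolding homeomorphic_map_maps homeomorphic_maps_def
    by (rule exI[where x = snd])
       (use conts in \<open>auto simp: continuous_map_in_subtopology continuous_map_from_subtopology continuous_map_snd\<close>)
  then have emb_s: "embedding_map Y ?P (\<lambda>y. (j0, y))" by (simp add: embedding_map_def)
  have emb_i: "embedding_map ?B ?P id"
    unfolding embedding_map_def sub by (simp add: Int_absorb1 subset_iff)
  have im_s: "(\<lambda>y. (j0, y)) ` topspace Y = {j0} \<times> topspace Y" by auto
  have iso: "(\<lambda>(a, b). ?s a \<otimes>\<^bsub>?HP\<^esub> ?i b) \<in> iso (?HY \<times>\<times> ?HB) ?HP"
    by (rule iso_homology_disjoint_union[OF emb_s _ emb_i])
       (use j0 in \<open>auto simp: im_s openin_prod_Times_iff disjnt_def\<close>)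
  have uniq: "b = b'"
    if "?s a \<otimes>\<^bsub>?HP\<^esub> ?i b = ?s a' \<otimes>\<^bsub>?HP\<^esub> ?i b'"
      "a \<in> carrier ?HY" "a' \<in> carrier ?HY" "b \<in> carrier ?HB" "b' \<in> carrier ?HB" for a b a' b'
    using inj_onD[OF conjunct2[OF conjunct2[OF iso[unfolded iso_iff]]], of "(a, b)" "(a', b')"] that
    by simp
  let ?K = "kernel ?HP ?HY ?r"
  \<comment> \<open>Correct a class on the other sheets by the opposite of its projection, placed on the sheet over \<open>j0\<close>.\<close>
  let ?\<phi> = "\<lambda>b. ?i b \<otimes>\<^bsub>?HP\<^esub> inv\<^bsub>?HP\<^esub> ?s (?r (?i b))"
  have \<phi>_eq: "?\<phi> b = ?s (inv\<^bsub>?HY\<^esub> ?r (?i b)) \<otimes>\<^bsub>?HP\<^esub> ?i b" if "b \<in> carrier ?HB" for b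
    using that by (simp add: P.m_comm)
  have \<phi>K: "?\<phi> b \<in> ?K" if "b \<in> carrier ?HB" for b
    using that by (simp add: kernel_def rs)
  have "?\<phi> \<in> iso ?HB (?HP\<lparr>carrier := ?K\<rparr>)"
    unfolding iso_iff
  proof (intro conjI)
    show "?\<phi> \<in> hom ?HB (?HP\<lparr>carrier := ?K\<rparr>)"
    proof (rule homI)
      fix b b' assume b: "b \<in> carrier ?HB" "b' \<in> carrier ?HB"
      then show "?\<phi> (b \<otimes>\<^bsub>?HB\<^esub> b') = ?\<phi> b \<otimes>\<^bsub>?HP\<lparr>carrier := ?K\<rparr>\<^esub> ?\<phi> b'"
        using P.diff_mult_diff[of "?i b" "?i b'" "?s (?r (?i b))" "?s (?r (?i b'))"] by simp
    qed (use \<phi>K in simp)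
    show "inj_on ?\<phi> (carrier ?HB)"
    proof (rule inj_onI)
      fix b b' assume b: "b \<in> carrier ?HB" "b' \<in> carrier ?HB" and "?\<phi> b = ?\<phi> b'"
      then show "b = b'"
        using uniq[of "inv\<^bsub>?HY\<^esub> ?r (?i b)" b "inv\<^bsub>?HY\<^esub> ?r (?i b')" b'] unfolding \<phi>_eq[OF b(1)] \<phi>_eq[OF b(2)]
        by simp
    qed
    show "?\<phi> ` carrier ?HB = carrier (?HP\<lparr>carrier := ?K\<rparr>)"
    proof (rule Set.set_eqI, rule iffI)
      fix x assume "x \<in> carrier (?HP\<lparr>carrier := ?K\<rparr>)"
      then have x: "x \<in> carrier ?HP" "?r x = \<one>\<^bsub>?HY\<^esub>" by (simp_all add: kernel_def)
      obtain a b where ab: "a \<in> carrier ?HY" "b \<in> carrier ?HB" and eq: "x = ?s a \<otimes>\<^bsub>?HP\<^esub> ?i b"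
        using x(1) unfolding conjunct1[OF conjunct2[OF iso[unfolded iso_iff]], symmetric]
        by (auto simp: DirProd_def)
      have "a \<otimes>\<^bsub>?HY\<^esub> ?r (?i b) = \<one>\<^bsub>?HY\<^esub>"
        using x(2) ab unfolding eq by (simp add: rs)
      then have "a = inv\<^bsub>?HY\<^esub> ?r (?i b)"
        using ab by (simp add: s.G.inv_equality)
      then have "x = ?\<phi> b" unfolding \<phi>_eq[OF ab(2)] eq by simp
      then show "x \<in> ?\<phi> ` carrier ?HB" using ab(2) by blast
    next
      fix x assume "x \<in> ?\<phi> ` carrier ?HB"
      then show "x \<in> carrier (?HP\<lparr>carrier := ?K\<rparr>)" using \<phi>K by auto
    qed
  qed
  then show ?thesis by (rule is_isoI)
qed

section \<open>The circle\<close>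

text \<open>The sine comes first, so that \<open>t \<mapsto> -t\<close> changes the sign of coordinate \<open>0\<close>: this is the reflection whose
Brouwer degree is known.\<close>

definition circle_point :: "real \<Rightarrow> nat \<Rightarrow> real" where
  "circle_point t = (\<lambda>i. if i = 0 then sin (2 * pi * t) else if i = 1 then cos (2 * pi * t) else 0)"

lemma topspace_circle:
  "topspace (nsphere 1) = {x. (x 0)\<^sup>2 + (x 1)\<^sup>2 = 1 \<and> (\<forall>i>1. x i = 0)}"
  by (simp add: nsphere)

lemma circle_point_eq_iff: "circle_point s = circle_point t \<longleftrightarrow> (\<exists>n::int. s = t + of_int n)"
proof -
  have "circle_point s = circle_point t
      \<longleftrightarrow> sin (2 * pi * s) = sin (2 * pi * t) \<and> cos (2 * pi * s) = cos (2 * pi * t)"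
    by (auto simp: circle_point_def fun_eq_iff)
  also have "\<dots> \<longleftrightarrow> (\<exists>n::int. 2 * pi * s = 2 * pi * t + 2 * pi * of_int n)"
    by (rule sin_cos_eq_iff)
  also have "\<dots> \<longleftrightarrow> (\<exists>n::int. s = t + of_int n)"
    by (simp flip: distrib_left)
  finally show ?thesis .
qed

lemma continuous_map_circle_point: "continuous_map euclideanreal (nsphere 1) circle_point"
proof -
  have "continuous_map euclideanreal euclideanreal (\<lambda>t. circle_point t i)" for i
    by (cases "i = 0"; cases "i = 1") (auto simp: circle_point_def intro!: continuous_intros)
  then show ?thesis
    by (auto simp: nsphere continuous_map_in_subtopology continuous_map_componentwise_UNIV circle_point_def)
qed

lemma circle_point_onto: "circle_point ` {0..1} = topspace (nsphere 1)"
proof (rule Set.set_eqI, rule iffI)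
  fix x assume "x \<in> circle_point ` {0..1}"
  then show "x \<in> topspace (nsphere 1)"
    using continuous_map_funspace[OF continuous_map_circle_point] by auto
next
  fix x assume "x \<in> topspace (nsphere 1)"
  then have x: "(x 1)\<^sup>2 + (x 0)\<^sup>2 = 1" "\<And>i. i > 1 \<Longrightarrow> x i = 0"
    unfolding topspace_circle by auto
  obtain u where u: "0 \<le> u" "u < 2 * pi" "x 1 = cos u" "x 0 = sin u"
    using sincos_total_2pi[OF x(1)] by metis
  have "x = circle_point (u / (2 * pi))"
    using u x(2) by (auto simp: circle_point_def fun_eq_iff)
  moreover have "u / (2 * pi) \<in> {0..1}" using u by auto
  ultimately show "x \<in> circle_point ` {0..1}" by blast
qed

lemma Hausdorff_space_nsphere: "Hausdorff_space (nsphere n)"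
  unfolding nsphere_def by (rule Hausdorff_space_subtopology[OF Hausdorff_Euclidean_space])

lemma proper_map_circle_point: "proper_map (top_of_set {0..1}) (nsphere 1) circle_point"
  by (intro continuous_imp_proper_map Hausdorff_imp_kc_space Hausdorff_space_nsphere
      continuous_map_from_subtopology continuous_map_circle_point)
     (simp add: compact_space_subtopology)

lemma path_connected_space_circle: "path_connected_space (nsphere 1)"
proof -
  have "path_connectedin (nsphere 1) (circle_point ` {0..1})"
    by (rule path_connectedin_continuous_map_image[OF continuous_map_circle_point])
       (simp add: path_connectedin_euclidean is_interval_path_connected)
  then show ?thesis by (simp add: circle_point_onto path_connectedin_topspace)
qed

lemma sum_topology_const: "sum_topology (\<lambda>_. T) J = prod_topology (discrete_topology J) T"
proof (rule topology_eq[THEN iffD2], rule allI)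
  fix U :: "('a \<times> 'b) set"
  show "openin (sum_topology (\<lambda>_. T) J) U \<longleftrightarrow> openin (prod_topology (discrete_topology J) T) U"
  proof
    assume U: "openin (sum_topology (\<lambda>_. T) J) U"
    show "openin (prod_topology (discrete_topology J) T) U"
      unfolding openin_prod_topology_alt
    proof (intro allI impI)
      fix j x assume jx: "(j, x) \<in> U"
      then have "j \<in> J" "openin T {x. (j, x) \<in> U}"
        using U by (auto simp: openin_sum_topology)
      then show "\<exists>A B. openin (discrete_topology J) A \<and> openin T B \<and> j \<in> A \<and> x \<in> B \<and> A \<times> B \<subseteq> U"
        using jx by (intro exI[of _ "{j}"] exI[of _ "{x. (j, x) \<in> U}"]) auto
    qed
  next
    assume U: "openin (prod_topology (discrete_topology J) T) U"
    have "openin T {x. (j, x) \<in> U}" if "j \<in> J" for j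
    proof -
      have "openin T {x \<in> topspace T. (j, x) \<in> U}"
        by (rule openin_continuous_map_preimage[OF _ U]) (simp add: continuous_map_paired that)
      moreover have "{x \<in> topspace T. (j, x) \<in> U} = {x. (j, x) \<in> U}"
        using openin_subset[OF U] by auto
      ultimately show ?thesis by simp
    qed
    then show "openin (sum_topology (\<lambda>_. T) J) U"
      using openin_subset[OF U] by (auto simp: openin_sum_topology)
  qed
qed

section \<open>Products with a family of circles\<close>

abbreviation sheets :: "'j set \<Rightarrow> 'b topology \<Rightarrow> ('j \<times> 'b) topology" where
  "sheets J Y \<equiv> prod_topology (discrete_topology J) Y"

abbreviation circles :: "'j set \<Rightarrow> ('j \<times> (nat \<Rightarrow> real)) topology" where
  "circles J \<equiv> sheets J (nsphere 1)"

text \<open>Closes each interval \<open>{(j, y)} \<times> [0,1]\<close> to a circle over \<open>j\<close>, keeping \<open>y\<close>.\<close>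

definition wrap :: "('j \<times> 'b) \<times> real \<Rightarrow> ('j \<times> (nat \<Rightarrow> real)) \<times> 'b" where
  "wrap = (\<lambda>((j, y), s). ((j, circle_point s), y))"

definition base_point :: "'j \<times> 'b \<Rightarrow> ('j \<times> (nat \<Rightarrow> real)) \<times> 'b" where
  "base_point = (\<lambda>(j, y). ((j, circle_point 0), y))"

lemma wrap_ends [simp]: "wrap (x, 0) = base_point x" "wrap (x, 1) = base_point x"
proof -
  have "circle_point 1 = circle_point 0"
    unfolding circle_point_eq_iff by (rule exI[of _ 1]) simp
  then show "wrap (x, 0) = base_point x" "wrap (x, 1) = base_point x"
    by (auto simp: wrap_def base_point_def split: prod.splits)
qed

lemma wrap_image_ends: "wrap ` cylinder_ends P = base_point ` topspace P"
proof -
  have "cylinder_ends P = (\<lambda>x. (x, 0)) ` topspace P \<union> (\<lambda>x. (x, 1)) ` topspace P"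
    by (auto simp: cylinder_ends_def)
  then show ?thesis by (simp add: image_Un image_image)
qed

text \<open>The parametrisation of the circle by \<open>[0,1]\<close> is a proper map, hence so is its product with any
identity map; proper maps are closed, which makes the product a quotient map for arbitrary \<open>Y\<close>.\<close>

lemma glued_cylinder_wrap: "glued_cylinder (sheets J Y) (prod_topology (circles J) Y) wrap"
proof
  let ?I = "top_of_set {0..1::real}" and ?D = "discrete_topology J"
  let ?f = "\<lambda>((j, s), y). ((j, circle_point s), y)"
  let ?g = "\<lambda>((j, y), s). ((j, s), y)"
  have f_eq: "?f = (\<lambda>(x, y). ((\<lambda>(j, s). (id j, circle_point s)) x, id y))"
    by (auto simp: fun_eq_iff)
  have "proper_map (prod_topology ?D ?I) (circles J) (\<lambda>(j, s). (id j, circle_point s))"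
    unfolding proper_map_prod by (intro disjI2 conjI proper_map_id proper_map_circle_point)
  then have "proper_map (prod_topology (prod_topology ?D ?I) Y) (prod_topology (circles J) Y) ?f"
    unfolding f_eq proper_map_prod[where g = id] by (intro disjI2 conjI proper_map_id)
  then have "closed_map (prod_topology (prod_topology ?D ?I) Y) (prod_topology (circles J) Y) ?f"
    by (rule proper_imp_closed_map)
  moreover have "continuous_map (prod_topology (prod_topology ?D ?I) Y) (prod_topology (circles J) Y) ?f"
    unfolding f_eq continuous_map_prod_top
    by (intro disjI2 conjI continuous_map_id continuous_map_from_subtopology[OF continuous_map_circle_point])
  moreover have "?f ` topspace (prod_topology (prod_topology ?D ?I) Y) = topspace (prod_topology (circles J) Y)"
    using circle_point_onto by (force simp: image_iff)
  ultimately have f: "quotient_map (prod_topology (prod_topology ?D ?I) Y) (prod_topology (circles J) Y) ?f"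
    using continuous_closed_quotient_map by blast
  have 1: "continuous_map (prod_topology (prod_topology A B) C) (prod_topology (prod_topology A C) B) (\<lambda>((a, b), c). ((a, c), b))"
    for A :: "'c topology" and B :: "'d topology" and C :: "'e topology"
    unfolding case_prod_unfold
    by (intro continuous_map_pairedI continuous_map_snd continuous_map_compose[OF continuous_map_fst continuous_map_fst, unfolded o_def]
        continuous_map_compose[OF continuous_map_fst continuous_map_snd, unfolded o_def])
  have "homeomorphic_maps (cylinder (sheets J Y)) (prod_topology (prod_topology ?D ?I) Y) ?g ?g"
    unfolding homeomorphic_maps_def cylinder_def by (intro conjI 1) auto
  then have "homeomorphic_map (cylinder (sheets J Y)) (prod_topology (prod_topology ?D ?I) Y) ?g"
    by (rule homeomorphic_maps_imp_map)
  then have "quotient_map (cylinder (sheets J Y)) (prod_topology (prod_topology ?D ?I) Y) ?g"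
    by (simp add: homeomorphic_map_def)
  from quotient_map_compose[OF this f]
  have "quotient_map (cylinder (sheets J Y)) (prod_topology (circles J) Y) (?f \<circ> ?g)" .
  also have "?f \<circ> ?g = wrap" by (auto simp: wrap_def fun_eq_iff)
  finally show "quotient_map (cylinder (sheets J Y)) (prod_topology (circles J) Y) wrap" .
next
  fix v w :: "('a \<times> 'b) \<times> real"
  assume vw: "v \<in> topspace (cylinder (sheets J Y))" "w \<in> topspace (cylinder (sheets J Y))"
    and eq: "wrap v = wrap w" and v: "v \<notin> cylinder_ends (sheets J Y)"
  obtain j y s k z r where v_eq: "v = ((j, y), s)" and w_eq: "w = ((k, z), r)" by (cases v, cases w) auto
  have "j = k" "y = z" "circle_point s = circle_point r"
    using eq by (auto simp: v_eq w_eq wrap_def)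
  moreover obtain n :: int where n: "s = r + of_int n"
    using \<open>circle_point s = circle_point r\<close> unfolding circle_point_eq_iff by blast
  moreover have "0 < s" "s < 1" "0 \<le> r" "r \<le> 1"
    using vw v by (auto simp: v_eq w_eq cylinder_ends_def less_le)
  then have "\<bar>of_int n :: real\<bar> < 1" using n by linarith
  then have "n = 0" by linarith
  ultimately show "v = w" by (simp add: v_eq w_eq)
qed

lemma continuous_map_base_point: "continuous_map (sheets J Y) (prod_topology (circles J) Y) base_point"
  unfolding base_point_def case_prod_unfold
  using continuous_map_funspace[OF continuous_map_circle_point]
  by (intro continuous_map_pairedI continuous_map_fst continuous_map_snd) (simp add: Pi_iff)

lemma section_map_base_point: "section_map (sheets J Y) (prod_topology (circles J) Y) base_point"
  unfolding section_map_def retraction_maps_def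
proof (intro exI[of _ "\<lambda>((j, v), y). (j, y)"] conjI continuous_map_base_point)
  show "continuous_map (prod_topology (circles J) Y) (sheets J Y) (\<lambda>((j, v), y). (j, y))"
    unfolding case_prod_unfold
    by (intro continuous_map_pairedI continuous_map_snd continuous_map_compose[OF continuous_map_fst continuous_map_fst, unfolded o_def])
qed (auto simp: base_point_def)

lemma iso_base_point:
  "hom_induced n (sheets J Y) {} (subtopology (prod_topology (circles J) Y) (wrap ` cylinder_ends (sheets J Y))) {} base_point
    \<in> iso (homology_group n (sheets J Y))
         (homology_group n (subtopology (prod_topology (circles J) Y) (wrap ` cylinder_ends (sheets J Y))))"
proof (rule homeomorphic_map_homology_iso)
  have "embedding_map (sheets J Y) (prod_topology (circles J) Y) base_point"
    by (rule section_imp_embedding_map[OF section_map_base_point])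
  then show "homeomorphic_map (sheets J Y)
      (subtopology (prod_topology (circles J) Y) (wrap ` cylinder_ends (sheets J Y))) base_point"
    by (simp only: embedding_map_def wrap_image_ends)
qed

text \<open>The end maps agree, so the classes on which they agree are all of \<open>H\<^sub>n\<close> of the sheets.\<close>

lemma homology_circles_times:
  assumes "trivial_group (homology_group (n + 1) (sheets J Y))"
  shows "homology_group n (sheets J Y) \<cong> homology_group (n + 1) (prod_topology (circles J) Y)"
proof -
  let ?Z = "prod_topology (circles J) Y"
  interpret glued_cylinder "sheets J Y" ?Z wrap by (rule glued_cylinder_wrap)
  have "trivial_group (homology_group (n + 1) glued_end_space)"
    using isomorphic_group_triviality1[OF is_isoI[OF iso_base_point] group_relative_homology_group assms] .
  then have "hom_induced (n + 1) glued_end_space {} ?Z {} id c = \<one>\<^bsub>homology_group (n + 1) ?Z\<^esub>"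
    if "c \<in> carrier (homology_group (n + 1) glued_end_space)" for c
    using that group_hom.hom_one[OF group_hom_hom_induced[of "n + 1" glued_end_space "{}" ?Z "{}" id]]
    by (simp only: trivial_group_def singleton_iff)
  from iso_homology_glued[OF this] show ?thesis
    by simp
qed

lemma trivial_homology_circles_times:
  assumes "trivial_group (homology_group (n + 1) (sheets J Y))" "trivial_group (homology_group n (sheets J Y))"
  shows "trivial_group (homology_group (n + 1) (prod_topology (circles J) Y))"
  using isomorphic_group_triviality1[OF homology_circles_times[OF assms(1)] group_relative_homology_group assms(2)] .

lemma trivial_homology_sheets:
  assumes "topspace Y \<noteq> {}" "trivial_group (homology_group n Y)"
  shows "trivial_group (homology_group n (sheets J Y))"
proof -
  have "carrier (sum_group J (\<lambda>_. homology_group n Y)) \<subseteq> {\<lambda>_\<in>J. \<one>\<^bsub>homology_group n Y\<^esub>}"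
    using assms(2) by (auto simp: carrier_sum_group trivial_group_def PiE_iff fun_eq_iff extensional_def)
  then have "trivial_group (sum_group J (\<lambda>_. homology_group n Y))"
    by (intro group.trivial_group_alt[THEN iffD2] sum_group group_relative_homology_group exI)
  moreover have "sum_group J (\<lambda>_. homology_group n Y) \<cong> homology_group n (sheets J Y)"
    by (rule group.iso_sym[OF group_relative_homology_group homology_discrete_times[OF assms(1)]])
  ultimately show ?thesis
    by (intro isomorphic_group_triviality1[OF _ group_relative_homology_group])
qed

abbreviation point_space :: "unit topology" where
  "point_space \<equiv> discrete_topology {()}"

lemma trivial_homology_sheets_point:
  "n \<noteq> 0 \<Longrightarrow> trivial_group (homology_group n (sheets J point_space))"
  by (rule trivial_homology_sheets) (simp_all add: homology_dimension_axiom[where a = "()"])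

text \<open>The family of circles is its own product with a point.\<close>

lemma trivial_homology_circles:
  assumes "n \<ge> 2"
  shows "trivial_group (homology_group n (circles J))"
proof -
  have "trivial_group (homology_group (n - 1 + 1) (prod_topology (circles J) point_space))"
    using assms by (intro trivial_homology_circles_times trivial_homology_sheets_point) simp_all
  moreover have "prod_topology (circles J) point_space homeomorphic_space circles J"
    by (rule prod_topology_homeomorphic_space_left) simp
  then have "homology_group n (prod_topology (circles J) point_space) \<cong> homology_group n (circles J)"
    by (rule homeomorphic_space_imp_isomorphic_homology_groups)
  ultimately show ?thesis
    using isomorphic_group_triviality1[OF _ group_relative_homology_group] by simp
qed

text \<open>Compare the pair \<open>(X \<times> Y, J \<times> Y)\<close> with its analogue for a point in place of \<open>Y\<close>. Their
first relative homology groups are \<open>H\<^sub>0(J \<times> Y)\<close> and \<open>H\<^sub>0(J)\<close>, and the map between them is injective as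
\<open>Y\<close> is path connected. So a class that dies in \<open>X\<close> dies already in the first pair, that is, it
comes from \<open>J \<times> Y\<close>.\<close>

lemma kernel_projection_circles:
  fixes J :: "'j set" and Y :: "'b topology"
  assumes Y: "path_connected_space Y" "topspace Y \<noteq> {}"
    and z: "z \<in> carrier (homology_group 1 (prod_topology (circles J) Y))"
    and ker: "hom_induced 1 (prod_topology (circles J) Y) {} (circles J) {} fst z = \<one>\<^bsub>homology_group 1 (circles J)\<^esub>"
  shows "z \<in> hom_induced 1 (sheets J Y) {} (prod_topology (circles J) Y) {} base_point ` carrier (homology_group 1 (sheets J Y))"
proof -
  let ?P = "sheets J Y" and ?Q = "sheets J point_space"
  let ?Z = "prod_topology (circles J) Y" and ?W = "prod_topology (circles J) point_space"
  let ?F = "wrap ` cylinder_ends ?P" and ?F' = "wrap ` cylinder_ends ?Q"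
  let ?h = "\<lambda>x. (fst x, ())"
  let ?j = "hom_induced 1 ?Z {} ?Z ?F id"
  interpret z: glued_cylinder ?P ?Z wrap by (rule glued_cylinder_wrap)
  interpret w: glued_cylinder ?Q ?W wrap by (rule glued_cylinder_wrap)
  have conth: "continuous_map ?P ?Q ?h"
    by (intro continuous_map_pairedI continuous_map_fst) simp
  have contk: "continuous_map ?Z ?W ?h"
    by (intro continuous_map_pairedI continuous_map_fst) simp
  have kF: "?h \<in> ?F \<rightarrow> ?F'"
    unfolding wrap_image_ends by (auto simp: base_point_def)
  have contk': "continuous_map (circles J) ?W (\<lambda>x. (x, ()))"
    by (simp add: continuous_map_paired)
  have comm: "(fst (wrap (x, s)), ()) = wrap ((fst x, ()), s)" for x :: "'j \<times> 'b" and s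
    by (simp add: wrap_def case_prod_unfold)
  obtain a where a: "a \<in> carrier (homology_group 0 ?P)" and ja: "?j z = z.attach 0 a"
  proof -
    have "?j z \<in> z.attach 0 ` carrier (homology_group 0 ?P)"
      using z.iso_attach[of 0] hom_induced_carrier[of 1 ?Z "{}" ?Z ?F id z] by (simp add: iso_iff)
    then show thesis using that by blast
  qed
  \<comment> \<open>The map of pairs sends the relative class of \<open>z\<close> to that of its image in \<open>X\<close>, which is trivial.\<close>
  have "w.attach 0 (hom_induced 0 ?P {} ?Q {} ?h a) = hom_induced 1 ?Z ?F ?W ?F' ?h (?j z)"
    using attach_natural[OF z.glued_cylinder_axioms w.glued_cylinder_axioms conth contk comm a]
    unfolding ja by simp
  also have "\<dots> = hom_induced 1 ?Z {} ?W ?F' ?h z"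
    using contk kF by (simp add: hom_induced_compose')
  also have "\<dots> = hom_induced 1 ?W {} ?W ?F' id (hom_induced 1 ?Z {} ?W {} ?h z)"
    using contk by (subst hom_induced_compose') simp_all
  also have "hom_induced 1 ?Z {} ?W {} ?h z = hom_induced 1 (circles J) {} ?W {} (\<lambda>x. (x, ()))
       (hom_induced 1 ?Z {} (circles J) {} fst z)"
    using contk' by (subst hom_induced_compose') (simp_all add: continuous_map_fst o_def)
  also have "hom_induced 1 ?W {} ?W ?F' id (hom_induced 1 (circles J) {} ?W {} (\<lambda>x. (x, ()))
       (hom_induced 1 ?Z {} (circles J) {} fst z)) = \<one>\<^bsub>relative_homology_group 1 ?W ?F'\<^esub>"
    unfolding ker by (simp only: group_hom.hom_one[OF group_hom_hom_induced])
  also have "\<dots> = w.attach 0 \<one>\<^bsub>homology_group 0 ?Q\<^esub>"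
    using hom_one[OF iso_imp_homomorphism[OF w.iso_attach[of 0]]] by simp
  finally have eq: "w.attach 0 (hom_induced 0 ?P {} ?Q {} ?h a) = w.attach 0 \<one>\<^bsub>homology_group 0 ?Q\<^esub>" .
  have one_closed: "\<one>\<^bsub>homology_group 0 A\<^esub> \<in> carrier (homology_group 0 A)" for A :: "'c topology"
    by (rule monoid.one_closed[OF group.is_monoid[OF group_relative_homology_group]])
  have "inj_on (w.attach 0) (carrier (homology_group 0 ?Q))"
    using w.iso_attach[of 0] by (simp only: iso_iff)
  from inj_onD[OF this eq hom_induced_carrier one_closed]
  have "hom_induced 0 ?P {} ?Q {} ?h a = \<one>\<^bsub>homology_group 0 ?Q\<^esub>" .
  then have h_a: "hom_induced 0 ?P {} ?Q {} ?h a = hom_induced 0 ?P {} ?Q {} ?h \<one>\<^bsub>homology_group 0 ?P\<^esub>"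
    by (simp only: group_hom.hom_one[OF group_hom_hom_induced])
  obtain y0 where y0: "y0 \<in> topspace Y" using Y(2) by blast
  have "inj_on (hom_induced 0 ?P {} ?Q {} ?h) (carrier (homology_group 0 ?P))"
  proof (rule inj_on_hom_induced_0[OF conth, of "\<lambda>x. (fst x, y0)"])
    show "continuous_map ?Q ?P (\<lambda>x. (fst x, y0))"
      using y0 by (intro continuous_map_pairedI continuous_map_fst) simp
    fix x assume "x \<in> topspace ?P"
    from path_component_of_fibre[OF Y(1) y0 this]
    show "path_component_of ?P x (fst (?h x), y0)" by simp
  qed
  from inj_onD[OF this h_a a one_closed] have "a = \<one>\<^bsub>homology_group 0 ?P\<^esub>" .
  then have "?j z = \<one>\<^bsub>relative_homology_group 1 ?Z ?F\<^esub>"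
    using hom_one[OF iso_imp_homomorphism[OF z.iso_attach[of 0]]] unfolding ja by simp
  then have "z \<in> kernel (homology_group 1 ?Z) (relative_homology_group 1 ?Z ?F) ?j"
    using z by (simp add: kernel_def)
  then obtain c where c: "c \<in> carrier (homology_group 1 (subtopology ?Z ?F))"
    and zc: "z = hom_induced 1 (subtopology ?Z ?F) {} ?Z {} id c"
    unfolding kernel_hom_induced_relativization by blast
  obtain b where b: "b \<in> carrier (homology_group 1 ?P)"
    and cb: "c = hom_induced 1 ?P {} (subtopology ?Z ?F) {} base_point b"
    using c unfolding conjunct1[OF conjunct2[OF iso_base_point[unfolded iso_iff]], symmetric] by blast
  have "continuous_map ?P (subtopology ?Z ?F) base_point"
    by (rule continuous_map_into_subtopology[OF continuous_map_base_point]) (simp add: wrap_image_ends)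
  then have "z = hom_induced 1 ?P {} ?Z {} base_point b"
    unfolding zc cb by (simp add: hom_induced_compose' continuous_map_from_subtopology)
  then show ?thesis using b by blast
qed

text \<open>Conversely, classes from \<open>J \<times> Y\<close> die in \<open>X\<close>, since their images come from the discrete space
\<open>J\<close>; it remains to compare the projections to \<open>Y\<close>.\<close>

lemma kernel_projections_circles_times:
  assumes Y: "path_connected_space Y" "topspace Y \<noteq> {}"
  shows "(homology_group 1 (sheets J Y))\<lparr>carrier :=
            kernel (homology_group 1 (sheets J Y)) (homology_group 1 Y) (hom_induced 1 (sheets J Y) {} Y {} snd)\<rparr>
     \<cong> (homology_group 1 (prod_topology (circles J) Y))\<lparr>carrier :=
          {z \<in> carrier (homology_group 1 (prod_topology (circles J) Y)).
             hom_induced 1 (prod_topology (circles J) Y) {} (circles J) {} fst z = \<one>\<^bsub>homology_group 1 (circles J)\<^esub> \<and>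
             hom_induced 1 (prod_topology (circles J) Y) {} Y {} snd z = \<one>\<^bsub>homology_group 1 Y\<^esub>}\<rparr>"
proof -
  let ?P = "sheets J Y" and ?Z = "prod_topology (circles J) Y"
  let ?K = "kernel (homology_group 1 ?P) (homology_group 1 Y) (hom_induced 1 ?P {} Y {} snd)"
  let ?L = "{z \<in> carrier (homology_group 1 ?Z).
             hom_induced 1 ?Z {} (circles J) {} fst z = \<one>\<^bsub>homology_group 1 (circles J)\<^esub> \<and>
             hom_induced 1 ?Z {} Y {} snd z = \<one>\<^bsub>homology_group 1 Y\<^esub>}"
  let ?b = "hom_induced 1 ?P {} ?Z {} base_point"
  interpret b: group_hom "homology_group 1 ?P" "homology_group 1 ?Z" ?b by (rule group_hom_hom_induced)
  have snd_b: "hom_induced 1 ?Z {} Y {} snd (?b a) = hom_induced 1 ?P {} Y {} snd a" for a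
    using continuous_map_base_point[of J Y]
    by (simp add: hom_induced_compose' continuous_map_snd base_point_def o_def case_prod_unfold)
  have fst_b: "hom_induced 1 ?Z {} (circles J) {} fst (?b a) = \<one>\<^bsub>homology_group 1 (circles J)\<^esub>" for a
  proof -
    let ?Q = "sheets J point_space"
    have conth: "continuous_map ?P ?Q (\<lambda>x. (fst x, ()))"
      by (intro continuous_map_pairedI continuous_map_fst) simp
    have contk: "continuous_map ?Q (circles J) (\<lambda>x. (fst x, circle_point 0))"
      using continuous_map_funspace[OF continuous_map_circle_point]
      by (intro continuous_map_pairedI continuous_map_fst) (simp add: Pi_iff)
    have "hom_induced 1 ?Z {} (circles J) {} fst (?b a) = hom_induced 1 ?P {} (circles J) {} (\<lambda>x. (fst x, circle_point 0)) a"
      using continuous_map_base_point[of J Y]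
      by (simp add: hom_induced_compose' continuous_map_fst base_point_def o_def case_prod_unfold)
    also have "\<dots> = hom_induced 1 ?Q {} (circles J) {} (\<lambda>x. (fst x, circle_point 0)) (hom_induced 1 ?P {} ?Q {} (\<lambda>x. (fst x, ())) a)"
      using conth contk by (simp add: hom_induced_compose' o_def)
    also have "hom_induced 1 ?P {} ?Q {} (\<lambda>x. (fst x, ())) a = \<one>\<^bsub>homology_group 1 ?Q\<^esub>"
      using trivial_homology_sheets_point[of 1 J] hom_induced_carrier[of 1 ?P "{}" ?Q "{}"]
      by (simp add: trivial_group_def)
    also have "hom_induced 1 ?Q {} (circles J) {} (\<lambda>x. (fst x, circle_point 0)) \<one>\<^bsub>homology_group 1 ?Q\<^esub>
         = \<one>\<^bsub>homology_group 1 (circles J)\<^esub>"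
      by (simp only: group_hom.hom_one[OF group_hom_hom_induced])
    finally show ?thesis .
  qed
  have inj: "inj_on ?b ?K"
    by (rule inj_on_subset[OF inj_on_hom_induced_section_map[OF section_map_base_point]]) (simp only: kernel_def Collect_restrict)
  have img: "?b ` ?K = ?L"
  proof (rule Set.set_eqI, rule iffI)
    fix z assume "z \<in> ?b ` ?K"
    then obtain a where "z = ?b a" "hom_induced 1 ?P {} Y {} snd a = \<one>\<^bsub>homology_group 1 Y\<^esub>"
      unfolding kernel_def by blast
    then show "z \<in> ?L" by (simp only: mem_Collect_eq fst_b snd_b hom_induced_carrier simp_thms)
  next
    fix z assume z: "z \<in> ?L"
    have "z \<in> ?b ` carrier (homology_group 1 ?P)"
      using z unfolding mem_Collect_eq by (elim conjE) (rule kernel_projection_circles[OF Y])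
    then obtain a where a: "a \<in> carrier (homology_group 1 ?P)" "z = ?b a"
      by (rule imageE) (rule that)
    have "hom_induced 1 ?P {} Y {} snd a = \<one>\<^bsub>homology_group 1 Y\<^esub>"
      using z unfolding a(2) snd_b mem_Collect_eq by (elim conjE)
    with a(1) have "a \<in> ?K" by (simp only: kernel_def mem_Collect_eq simp_thms)
    then show "z \<in> ?b ` ?K" unfolding a(2) by (rule imageI)
  qed
  have "?b \<in> hom ((homology_group 1 ?P)\<lparr>carrier := ?K\<rparr>) ((homology_group 1 ?Z)\<lparr>carrier := ?L\<rparr>)"
  proof (rule homI)
    fix x assume "x \<in> carrier ((homology_group 1 ?P)\<lparr>carrier := ?K\<rparr>)"
    then have "?b x \<in> ?b ` ?K" by simp
    then show "?b x \<in> carrier ((homology_group 1 ?Z)\<lparr>carrier := ?L\<rparr>)" unfolding img by simp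
  next
    fix x y assume "x \<in> carrier ((homology_group 1 ?P)\<lparr>carrier := ?K\<rparr>)" "y \<in> carrier ((homology_group 1 ?P)\<lparr>carrier := ?K\<rparr>)"
    then show "?b (x \<otimes>\<^bsub>(homology_group 1 ?P)\<lparr>carrier := ?K\<rparr>\<^esub> y) = ?b x \<otimes>\<^bsub>(homology_group 1 ?Z)\<lparr>carrier := ?L\<rparr>\<^esub> ?b y"
      using b.hom_mult[of x y] by (simp add: kernel_def)
  qed
  with inj img have "?b \<in> iso ((homology_group 1 ?P)\<lparr>carrier := ?K\<rparr>) ((homology_group 1 ?Z)\<lparr>carrier := ?L\<rparr>)"
    unfolding iso_iff by simp
  then show ?thesis by (rule is_isoI)
qed

section \<open>Homology of joins\<close>

text \<open>A constant map factors through a point.\<close>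

lemma hom_induced_const:
  assumes n: "n \<noteq> 0" and w: "w \<in> topspace W"
  shows "hom_induced n X {} W {} (\<lambda>x. w) a = \<one>\<^bsub>homology_group n W\<^esub>"
proof -
  have X: "continuous_map X point_space (\<lambda>_. ())" by simp
  have W: "continuous_map point_space W (\<lambda>_. w)" using w by simp
  have "hom_induced n X {} W {} (\<lambda>x. w) a
      = hom_induced n point_space {} W {} (\<lambda>_. w) (hom_induced n X {} point_space {} (\<lambda>_. ()) a)"
    using X W by (simp add: hom_induced_compose' o_def)
  also have "hom_induced n X {} point_space {} (\<lambda>_. ()) a = \<one>\<^bsub>homology_group n point_space\<^esub>"
    using homology_dimension_axiom[of point_space "()" n] n hom_induced_carrier[of n X "{}" point_space "{}"]
    by (simp add: trivial_group_def)
  also have "hom_induced n point_space {} W {} (\<lambda>_. w) \<dots> = \<one>\<^bsub>homology_group n W\<^esub>"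
    by (simp only: group_hom.hom_one[OF group_hom_hom_induced])
  finally show ?thesis .
qed

definition join_left :: "'a \<Rightarrow> 'a option \<times> 'b option \<times> real" where
  "join_left x = (Some x, None, 0)"

definition join_right :: "'b \<Rightarrow> 'a option \<times> 'b option \<times> real" where
  "join_right y = (None, Some y, 1)"

definition join_glue :: "('a \<times> 'b) \<times> real \<Rightarrow> 'a option \<times> 'b option \<times> real" where
  "join_glue = (\<lambda>((x, y), s). join_point (x, y, s))"

lemma join_glue_ends [simp]:
  "join_glue (p, 0) = join_left (fst p)" "join_glue (p, 1) = join_right (snd p)"
  by (auto simp: join_glue_def join_point_def join_left_def join_right_def split: prod.splits)

lemma join_glue_parameter [simp]: "snd (snd (join_glue (p, s))) = s"
  by (auto simp: join_glue_def join_point_def split: prod.splits)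

lemma glued_cylinder_join: "glued_cylinder (prod_topology X Y) (join X Y) join_glue"
proof
  let ?I = "top_of_set {0..1::real}"
  let ?g = "\<lambda>((x, y), s). (x, y, s)" and ?g' = "\<lambda>(x, y, s). ((x, y), s)"
  have "homeomorphic_maps (cylinder (prod_topology X Y)) (prod_topology X (prod_topology Y ?I)) ?g ?g'"
    unfolding homeomorphic_maps_def cylinder_def case_prod_unfold
    by (intro conjI continuous_map_pairedI continuous_map_fst continuous_map_snd
        continuous_map_compose[OF continuous_map_fst continuous_map_fst, unfolded o_def]
        continuous_map_compose[OF continuous_map_fst continuous_map_snd, unfolded o_def]
        continuous_map_compose[OF continuous_map_snd continuous_map_fst, unfolded o_def]
        continuous_map_compose[OF continuous_map_snd continuous_map_snd, unfolded o_def]) auto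
  then have "homeomorphic_map (cylinder (prod_topology X Y)) (prod_topology X (prod_topology Y ?I)) ?g"
    by (rule homeomorphic_maps_imp_map)
  then have "quotient_map (cylinder (prod_topology X Y)) (prod_topology X (prod_topology Y ?I)) ?g"
    by (simp add: homeomorphic_map_def)
  from quotient_map_compose[OF this quotient_map_quotient_topology[of _ join_point]]
  have "quotient_map (cylinder (prod_topology X Y)) (join X Y) (join_point \<circ> ?g)"
    unfolding join_def .
  also have "join_point \<circ> ?g = join_glue" by (auto simp: join_glue_def fun_eq_iff)
  finally show "quotient_map (cylinder (prod_topology X Y)) (join X Y) join_glue" .
next
  fix v w :: "('a \<times> 'b) \<times> real"
  assume vw: "v \<in> topspace (cylinder (prod_topology X Y))" "w \<in> topspace (cylinder (prod_topology X Y))"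
    and eq: "join_glue v = join_glue w" and v: "v \<notin> cylinder_ends (prod_topology X Y)"
  obtain x y s x' y' s' where v_eq: "v = ((x, y), s)" and w_eq: "w = ((x', y'), s')" by (cases v, cases w) auto
  have "s = s'" using arg_cong[OF eq, of "\<lambda>z. snd (snd z)"] unfolding v_eq w_eq by simp
  moreover have "s \<noteq> 0" "s \<noteq> 1" using vw(1) v by (auto simp: v_eq cylinder_ends_def)
  ultimately show "v = w" using eq by (simp add: v_eq w_eq join_glue_def join_point_def)
qed

locale nonempty_join =
  fixes X :: "'a topology" and Y :: "'b topology"
  assumes nonempty: "topspace X \<noteq> {}" "topspace Y \<noteq> {}"
begin

abbreviation "W \<equiv> join X Y"

sublocale glued_cylinder "prod_topology X Y" "join X Y" join_glue
  by (rule glued_cylinder_join)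

lemma glued_ends_eq: "glued_ends = join_left ` topspace X \<union> join_right ` topspace Y"
proof -
  have "cylinder_ends (prod_topology X Y)
      = (\<lambda>p. (p, 0)) ` (topspace X \<times> topspace Y) \<union> (\<lambda>p. (p, 1)) ` (topspace X \<times> topspace Y)"
    by (auto simp: cylinder_ends_def)
  then have "glued_ends = join_left ` fst ` (topspace X \<times> topspace Y) \<union> join_right ` snd ` (topspace X \<times> topspace Y)"
    by (simp only: image_Un image_image join_glue_ends)
  moreover have "fst ` (topspace X \<times> topspace Y) = topspace X" "snd ` (topspace X \<times> topspace Y) = topspace Y"
    using nonempty by simp_all
  ultimately show ?thesis by (simp only:)
qed

lemma continuous_map_join_line:
  assumes "continuous_map A X f" "continuous_map A Y g" "continuous_map A (top_of_set {0..1}) k"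
  shows "continuous_map A W (\<lambda>a. join_glue ((f a, g a), k a))"
  using continuous_map_compose[OF _ continuous, of A "\<lambda>a. ((f a, g a), k a)"] assms
  by (simp add: cylinder_def continuous_map_paired o_def)

lemma continuous_map_join_left: "continuous_map X W join_left"
proof -
  obtain y where "y \<in> topspace Y" using nonempty by blast
  then show ?thesis
    using continuous_map_join_line[of X id "\<lambda>_. y" "\<lambda>_. 0"] by simp
qed

lemma continuous_map_join_right: "continuous_map Y W join_right"
proof -
  obtain x where "x \<in> topspace X" using nonempty by blast
  then show ?thesis
    using continuous_map_join_line[of Y "\<lambda>_. x" id "\<lambda>_. 1"] by simp
qed

text \<open>A coordinate of the join, given by \<open>f\<close> upstairs, is continuous on the open part of the join where it is
defined, because the quotient map restricts to a quotient map over open sets.\<close>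

lemma continuous_map_join_coordinate:
  assumes T: "open T" and f: "continuous_map (prod_topology X Y) C f"
    and g: "\<And>p s. \<lbrakk>s \<in> {0..1}; s \<in> T\<rbrakk> \<Longrightarrow> g (join_glue (p, s)) = f p"
  shows "openin W {w \<in> topspace W. snd (snd w) \<in> T}"
    and "continuous_map (subtopology W {w \<in> topspace W. snd (snd w) \<in> T}) C g"
proof -
  let ?V = "{w \<in> topspace W. snd (snd w) \<in> T}"
  let ?U = "(topspace X \<times> topspace Y) \<times> ({0..1} \<inter> T)"
  have pre: "{v \<in> topspace (cylinder (prod_topology X Y)). join_glue v \<in> ?V} = ?U"
    using surj by auto
  have "openin (cylinder (prod_topology X Y)) ?U"
    using T unfolding cylinder_def by (simp add: openin_prod_Times_iff openin_open_Int)
  moreover have "openin (cylinder (prod_topology X Y)) {v \<in> topspace (cylinder (prod_topology X Y)). join_glue v \<in> ?V}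
      \<longleftrightarrow> openin W ?V"
    by (rule conjunct2[OF quotient[unfolded quotient_map_def], rule_format]) (rule Collect_restrict)
  ultimately show V: "openin W ?V"
    unfolding pre by (rule iffD1[rotated])
  have Q: "quotient_map (subtopology (cylinder (prod_topology X Y)) ?U) (subtopology W ?V) join_glue"
    by (rule quotient_map_restriction[OF quotient pre disjI1[OF V]])
  have "continuous_map (subtopology (cylinder (prod_topology X Y)) ?U) C (f \<circ> fst)"
    unfolding cylinder_def
    by (intro continuous_map_from_subtopology continuous_map_compose[OF continuous_map_fst f])
  then have "continuous_map (subtopology (cylinder (prod_topology X Y)) ?U) C (g \<circ> join_glue)"
    by (rule continuous_map_eq) (auto simp: g)
  then show "continuous_map (subtopology W ?V) C g"
    by (simp only: continuous_compose_quotient_map_eq[OF Q])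
qed

text \<open>For the left end \<open>T\<close> will be \<open>{..<1}\<close>, for the right end \<open>{0<..}\<close>: an end is clopen in the union of both, and
is embedded because its coordinate extends continuously to a neighbourhood.\<close>

lemma embedding_map_join_end:
  assumes T: "open T" and sub: "S = glued_ends \<inter> {w \<in> topspace W. snd (snd w) \<in> T}"
    and e: "continuous_map A W e" "e ` topspace A = S"
    and g: "continuous_map (subtopology W {w \<in> topspace W. snd (snd w) \<in> T}) A g"
      "\<And>a. a \<in> topspace A \<Longrightarrow> g (e a) = a"
    and V: "openin W {w \<in> topspace W. snd (snd w) \<in> T}"
  shows "embedding_map A glued_end_space e" and "openin glued_end_space (e ` topspace A)"
proof -
  have SW: "S \<subseteq> topspace W" and SF: "glued_ends \<inter> S = S" using sub by blast+
  have "continuous_map (subtopology W S) A g"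
    by (rule continuous_map_from_subtopology_mono[OF g(1)]) (use sub in blast)
  moreover have "continuous_map A (subtopology W S) e"
    by (rule continuous_map_into_subtopology[OF e(1)]) (use e(2) in blast)
  moreover have "e (g w) = w" if "w \<in> S" for w
    using that g(2) unfolding e(2)[symmetric] by auto
  ultimately have "homeomorphic_maps A (subtopology W S) e g"
    using g(2) unfolding homeomorphic_maps_def by simp
  then show "embedding_map A glued_end_space e"
    unfolding embedding_map_def e(2) subtopology_subtopology SF by (rule homeomorphic_maps_imp_map)
  show "openin glued_end_space (e ` topspace A)"
    unfolding e(2) sub openin_subtopology using V by blast
qed

lemma embedding_join_left:
  "embedding_map X glued_end_space join_left" "openin glued_end_space (join_left ` topspace X)"
proof -
  have f: "continuous_map (prod_topology X Y) X fst" by (rule continuous_map_fst)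
  have g: "the (fst (join_glue (p, s))) = fst p" if "s \<in> {0..1}" "s \<in> {..<1}" for p s
    using that by (auto simp: join_glue_def join_point_def split: prod.splits)
  note c = continuous_map_join_coordinate[OF open_lessThan f g]
  have "join_left ` topspace X = glued_ends \<inter> {w \<in> topspace W. snd (snd w) \<in> {..<1}}"
    unfolding glued_ends_eq using continuous_map_funspace[OF continuous_map_join_left]
    by (auto simp: join_left_def join_right_def)
  from embedding_map_join_end[OF open_lessThan this continuous_map_join_left refl c(2) _ c(1)]
  show "embedding_map X glued_end_space join_left" "openin glued_end_space (join_left ` topspace X)"
    by (simp_all add: join_left_def)
qed

lemma embedding_join_right:
  "embedding_map Y glued_end_space join_right" "openin glued_end_space (join_right ` topspace Y)"
proof -
  have f: "continuous_map (prod_topology X Y) Y snd" by (rule continuous_map_snd)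
  have g: "the (fst (snd (join_glue (p, s)))) = snd p" if "s \<in> {0..1}" "s \<in> {0<..}" for p s
    using that by (auto simp: join_glue_def join_point_def split: prod.splits)
  note c = continuous_map_join_coordinate[OF open_greaterThan f g]
  have "join_right ` topspace Y = glued_ends \<inter> {w \<in> topspace W. snd (snd w) \<in> {0<..}}"
    unfolding glued_ends_eq using continuous_map_funspace[OF continuous_map_join_right]
    by (auto simp: join_left_def join_right_def)
  from embedding_map_join_end[OF open_greaterThan this continuous_map_join_right refl c(2) _ c(1)]
  show "embedding_map Y glued_end_space join_right" "openin glued_end_space (join_right ` topspace Y)"
    by (simp_all add: join_right_def)
qed

lemma continuous_map_join_ends:
  "continuous_map X glued_end_space join_left" "continuous_map Y glued_end_space join_right"
  by (rule continuous_map_into_fulltopology, rule homeomorphic_imp_continuous_map,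
      rule embedding_join_left(1)[unfolded embedding_map_def] embedding_join_right(1)[unfolded embedding_map_def])+

lemma iso_homology_join_ends:
  "(\<lambda>(u, v). hom_induced n X {} glued_end_space {} join_left u \<otimes>\<^bsub>homology_group n glued_end_space\<^esub>
             hom_induced n Y {} glued_end_space {} join_right v)
     \<in> iso (homology_group n X \<times>\<times> homology_group n Y) (homology_group n glued_end_space)"
proof (rule iso_homology_disjoint_union[OF embedding_join_left embedding_join_right])
  show "disjnt (join_left ` topspace X) (join_right ` topspace Y)"
    by (auto simp: disjnt_def join_left_def join_right_def)
  have "glued_ends \<subseteq> topspace W" using surj cylinder_ends_subset by blast
  then show "join_left ` topspace X \<union> join_right ` topspace Y = topspace glued_end_space"
    using glued_ends_eq by (simp add: Int_absorb1)
qed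

text \<open>In the join, each end can be slid along the segments that lead to a fixed point of the other end.\<close>

lemma trivial_hom_induced_join_ends:
  assumes n: "n \<noteq> 0"
  shows "hom_induced n X {} W {} join_left u = \<one>\<^bsub>homology_group n W\<^esub>"
    and "hom_induced n Y {} W {} join_right v = \<one>\<^bsub>homology_group n W\<^esub>"
proof -
  obtain x y where xy: "x \<in> topspace X" "y \<in> topspace Y" using nonempty by blast
  let ?I = "top_of_set {0..1::real}"
  have line: "homotopic_with (\<lambda>_. True) A W (\<lambda>a. join_glue ((f a, g a), 0)) (\<lambda>a. join_glue ((f a, g a), 1))"
    if f: "continuous_map A X f" and g: "continuous_map A Y g" for A :: "'c topology" and f g
    unfolding homotopic_with_def
    by (rule exI[where x = "\<lambda>z. join_glue ((f (snd z), g (snd z)), fst z)"])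
       (intro conjI ballI allI continuous_map_join_line continuous_map_fst
         continuous_map_compose[OF continuous_map_snd f, unfolded o_def]
         continuous_map_compose[OF continuous_map_snd g, unfolded o_def], simp_all)
  have "homotopic_with (\<lambda>_. True) X W join_left (\<lambda>_. join_right y)"
    using line[of X id "\<lambda>_. y"] xy by simp
  then have "hom_induced n X {} W {} join_left u = hom_induced n X {} W {} (\<lambda>_. join_right y) u"
    by (rule fun_cong[OF homology_homotopy_empty])
  also have "\<dots> = \<one>\<^bsub>homology_group n W\<^esub>"
    using n xy continuous_map_funspace[OF continuous_map_join_right] by (intro hom_induced_const) auto
  finally show "hom_induced n X {} W {} join_left u = \<one>\<^bsub>homology_group n W\<^esub>" .
  have "homotopic_with (\<lambda>_. True) Y W (\<lambda>_. join_left x) join_right"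
    using line[of Y "\<lambda>_. x" id] xy by simp
  then have "hom_induced n Y {} W {} join_right v = hom_induced n Y {} W {} (\<lambda>_. join_left x) v"
    by (rule fun_cong[OF homology_homotopy_empty[symmetric]])
  also have "\<dots> = \<one>\<^bsub>homology_group n W\<^esub>"
    using n xy continuous_map_funspace[OF continuous_map_join_left] by (intro hom_induced_const) auto
  finally show "hom_induced n Y {} W {} join_right v = \<one>\<^bsub>homology_group n W\<^esub>" .
qed

lemma join_ends_zero:
  assumes n: "n \<noteq> 0" and c: "c \<in> carrier (homology_group n glued_end_space)"
  shows "hom_induced n glued_end_space {} W {} id c = \<one>\<^bsub>homology_group n W\<^esub>"
proof -
  let ?i = "hom_induced n glued_end_space {} W {} id"
  let ?l = "hom_induced n X {} glued_end_space {} join_left" and ?r = "hom_induced n Y {} glued_end_space {} join_right"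
  interpret i: group_hom "homology_group n glued_end_space" "homology_group n W" ?i
    by (rule group_hom_hom_induced)
  obtain u v where c_eq: "c = ?l u \<otimes>\<^bsub>homology_group n glued_end_space\<^esub> ?r v"
    using c unfolding conjunct1[OF conjunct2[OF iso_homology_join_ends[unfolded iso_iff]], symmetric] by auto
  have "?i (?l u) = hom_induced n X {} W {} join_left u"
    using continuous_map_join_ends(1) by (subst hom_induced_compose') (simp_all add: continuous_map_from_subtopology)
  moreover have "?i (?r v) = hom_induced n Y {} W {} join_right v"
    using continuous_map_join_ends(2) by (subst hom_induced_compose') (simp_all add: continuous_map_from_subtopology)
  ultimately show ?thesis
    unfolding c_eq using trivial_hom_induced_join_ends[OF n] by (simp add: hom_induced_carrier)
qed

text \<open>The end maps take values in different summands of \<open>H\<^sub>n(X) \<oplus> H\<^sub>n(Y)\<close>, so they agree only where both vanish.\<close>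

lemma join_end_maps_eq_iff:
  assumes a: "a \<in> carrier (homology_group n (prod_topology X Y))"
  shows "end_map 0 n a = end_map 1 n a \<longleftrightarrow>
     hom_induced n (prod_topology X Y) {} X {} fst a = \<one>\<^bsub>homology_group n X\<^esub> \<and>
     hom_induced n (prod_topology X Y) {} Y {} snd a = \<one>\<^bsub>homology_group n Y\<^esub>"
proof -
  let ?l = "hom_induced n X {} glued_end_space {} join_left" and ?r = "hom_induced n Y {} glued_end_space {} join_right"
  let ?u = "hom_induced n (prod_topology X Y) {} X {} fst a" and ?v = "hom_induced n (prod_topology X Y) {} Y {} snd a"
  let ?H = "homology_group n glued_end_space"
  interpret l: group_hom "homology_group n X" ?H ?l by (rule group_hom_hom_induced)
  interpret r: group_hom "homology_group n Y" ?H ?r by (rule group_hom_hom_induced)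
  have 0: "end_map 0 n a = ?l ?u"
    using continuous_map_join_ends(1) by (subst hom_induced_compose') (simp_all add: continuous_map_fst o_def)
  have 1: "end_map 1 n a = ?r ?v"
    using continuous_map_join_ends(2) by (subst hom_induced_compose') (simp_all add: continuous_map_snd o_def)
  have inj: "inj_on (\<lambda>(u, v). ?l u \<otimes>\<^bsub>?H\<^esub> ?r v) (carrier (homology_group n X \<times>\<times> homology_group n Y))"
    using iso_homology_join_ends by (simp only: iso_iff)
  have u: "?u \<in> carrier (homology_group n X)" and v: "?v \<in> carrier (homology_group n Y)"
    by (rule hom_induced_carrier)+
  show ?thesis
  proof
    assume "end_map 0 n a = end_map 1 n a"
    then have "?l ?u = ?r ?v" unfolding 0 1 .
    then have "?l ?u \<otimes>\<^bsub>?H\<^esub> ?r \<one>\<^bsub>homology_group n Y\<^esub> = ?l \<one>\<^bsub>homology_group n X\<^esub> \<otimes>\<^bsub>?H\<^esub> ?r ?v"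
      using u v by simp
    then have "(?u, \<one>\<^bsub>homology_group n Y\<^esub>) = (\<one>\<^bsub>homology_group n X\<^esub>, ?v)"
      using u v by (intro inj_onD[OF inj]) simp_all
    then show "?u = \<one>\<^bsub>homology_group n X\<^esub> \<and> ?v = \<one>\<^bsub>homology_group n Y\<^esub>" by simp
  next
    assume "?u = \<one>\<^bsub>homology_group n X\<^esub> \<and> ?v = \<one>\<^bsub>homology_group n Y\<^esub>"
    then show "end_map 0 n a = end_map 1 n a" unfolding 0 1 by simp
  qed
qed

theorem homology_join:
  assumes "n \<ge> 0"
  shows "(homology_group n (prod_topology X Y))\<lparr>carrier :=
            {a \<in> carrier (homology_group n (prod_topology X Y)).
               hom_induced n (prod_topology X Y) {} X {} fst a = \<one>\<^bsub>homology_group n X\<^esub> \<and>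
               hom_induced n (prod_topology X Y) {} Y {} snd a = \<one>\<^bsub>homology_group n Y\<^esub>}\<rparr>
         \<cong> homology_group (n + 1) (join X Y)"
proof -
  have "n + 1 \<noteq> 0" using assms by simp
  note * = iso_homology_glued[OF join_ends_zero[OF this]]
  have "{a \<in> carrier (homology_group n (prod_topology X Y)). end_map 0 n a = end_map 1 n a}
      = {a \<in> carrier (homology_group n (prod_topology X Y)).
               hom_induced n (prod_topology X Y) {} X {} fst a = \<one>\<^bsub>homology_group n X\<^esub> \<and>
               hom_induced n (prod_topology X Y) {} Y {} snd a = \<one>\<^bsub>homology_group n Y\<^esub>}"
    by (intro Collect_cong conj_cong refl join_end_maps_eq_iff)
  with * show ?thesis by (simp only:)
qed

theorem trivial_homology_join:
  assumes "n \<ge> 0"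
    and "\<And>a. \<lbrakk>a \<in> carrier (homology_group n (prod_topology X Y));
               hom_induced n (prod_topology X Y) {} X {} fst a = \<one>\<^bsub>homology_group n X\<^esub>;
               hom_induced n (prod_topology X Y) {} Y {} snd a = \<one>\<^bsub>homology_group n Y\<^esub>\<rbrakk>
             \<Longrightarrow> a = \<one>\<^bsub>homology_group n (prod_topology X Y)\<^esub>"
  shows "trivial_group (homology_group (n + 1) (join X Y))"
proof (rule trivial_homology_glued)
  have "n + 1 \<noteq> 0" using assms(1) by simp
  then show "hom_induced (n + 1) glued_end_space {} W {} id c = \<one>\<^bsub>homology_group (n + 1) W\<^esub>"
    if "c \<in> carrier (homology_group (n + 1) glued_end_space)" for c
    using that by (rule join_ends_zero)
qed (use assms(2) join_end_maps_eq_iff in blast)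

text \<open>The cones over \<open>Y\<close> with apex at the points of \<open>X\<close> cover the join and share the end \<open>Y\<close>.\<close>

lemma path_connected_space_join:
  assumes Y: "path_connected_space Y"
  shows "path_connected_space (join X Y)"
proof -
  let ?L = "\<lambda>x. join_glue ` (({x} \<times> topspace Y) \<times> {0..1})"
  have "path_connectedin W (\<Union>x\<in>topspace X. ?L x)"
  proof (rule path_connectedin_Union)
    fix A assume "A \<in> ?L ` topspace X"
    then obtain x where x: "x \<in> topspace X" "A = ?L x" by blast
    have "path_connectedin (prod_topology (prod_topology X Y) (top_of_set {0..1::real})) (({x} \<times> topspace Y) \<times> {0..1})"
      using Y x convex_imp_path_connected[OF convex_real_interval(5)[of 0 1]]
      by (simp add: path_connectedin_Times path_connectedin_topspace path_connectedin_subtopology)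
    then show "path_connectedin W A"
      using path_connectedin_continuous_map_image[OF continuous] x by (simp add: cylinder_def)
  next
    obtain y where "y \<in> topspace Y" using nonempty by blast
    have "join_right y \<in> ?L x" for x
      by (rule image_eqI[of _ _ "((x, y), 1)"]) (use \<open>y \<in> topspace Y\<close> in simp_all)
    then have "join_right y \<in> \<Inter> (?L ` topspace X)" by (intro InterI) (elim imageE, simp only:)
    then show "\<Inter> (?L ` topspace X) \<noteq> {}" by (simp only: ex_in_conv[symmetric]) (rule exI)
  qed
  moreover have "(topspace X \<times> topspace Y) \<times> {0..1::real} = (\<Union>x\<in>topspace X. ({x} \<times> topspace Y) \<times> {0..1})"
    by auto
  then have "(\<Union>x\<in>topspace X. ?L x) = topspace W"
    unfolding surj[symmetric] by (simp add: image_UN)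
  ultimately show ?thesis by (simp add: path_connectedin_topspace)
qed

end

section \<open>The Klein bottle as a glued cylinder\<close>

abbreviation klein_orbit :: "real \<times> real \<Rightarrow> (real \<times> real) set" where
  "klein_orbit \<equiv> orbit klein_group klein_action"

abbreviation unit_square :: "(real \<times> real) topology" where
  "unit_square \<equiv> top_of_set ({0..1} \<times> {0..1})"

lemma klein_action_apply:
  "klein_action (n, m) (t, r) = (of_int n + (if even m then t else - t), of_int m + r)"
  by (simp add: klein_action_def minus_one_power_nat_abs)

lemma klein_orbit_eq_iff: "klein_orbit p = klein_orbit p' \<longleftrightarrow> (\<exists>g. p' = klein_action g p)"
proof
  assume eq: "klein_orbit p = klein_orbit p'"
  have "p' = klein_action \<one>\<^bsub>klein_group\<^esub> p' \<and> \<one>\<^bsub>klein_group\<^esub> \<in> carrier klein_group"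
    by (simp add: klein_action_one) (simp add: klein_group_def)
  then have "p' \<in> klein_orbit p" unfolding eq unfolding orbit_def by (intro CollectI exI)
  then show "\<exists>g. p' = klein_action g p" unfolding orbit_def by blast
next
  assume "\<exists>g. p' = klein_action g p"
  then obtain g where g: "p' = klein_action g p" by blast
  interpret group klein_group by (rule group_klein_group)
  have car: "h \<in> carrier klein_group" for h by (simp add: klein_group_def)
  have "p = klein_action (inv\<^bsub>klein_group\<^esub> g) p'"
    unfolding g klein_action_mult[symmetric] l_inv[OF car] klein_action_one ..
  then have "klein_action h p = klein_action (h \<otimes>\<^bsub>klein_group\<^esub> inv\<^bsub>klein_group\<^esub> g) p'" for h
    by (simp add: klein_action_mult)
  moreover have "klein_action h p' = klein_action (h \<otimes>\<^bsub>klein_group\<^esub> g) p" for h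
    by (simp add: g klein_action_mult)
  ultimately show "klein_orbit p = klein_orbit p'"
    unfolding orbit_def using car by blast
qed

lemma klein_orbit_eq:
  "klein_orbit (t, r) = klein_orbit (t', r')
     \<longleftrightarrow> (\<exists>n m :: int. t' = of_int n + (if even m then t else - t) \<and> r' = of_int m + r)"
  unfolding klein_orbit_eq_iff split_paired_Ex klein_action_apply by simp

lemma quotient_map_klein_orbit: "quotient_map euclidean klein_bottle klein_orbit"
  unfolding klein_bottle_def orbit_space_def by (rule quotient_map_quotient_topology)

text \<open>Only finitely many translates of the unit square meet a given ball of radius \<open>1\<close>, so the union of the
translates of \<open>C\<close> is locally a finite union of compact sets.\<close>

lemma closed_klein_saturation:
  assumes C: "closed C" "C \<subseteq> {0..1} \<times> {0..1}"
  shows "closed (\<Union>g. klein_action g ` C)"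
proof -
  let ?D = "\<Union>g. klein_action g ` C"
  have compC: "compact C"
    using C compact_Times[OF compact_Icc compact_Icc] by (metis compact_Int_closed inf.absorb_iff2)
  have closed_image: "closed (klein_action g ` C)" for g
  proof -
    obtain n m where g: "g = (n, m)" by (cases g)
    have "continuous_on C (klein_action g)"
      unfolding g klein_action_def case_prod_conv case_prod_unfold by (intro continuous_intros)
    then show ?thesis using compC by (simp add: compact_continuous_image compact_imp_closed)
  qed
  have "\<exists>T. open T \<and> p \<in> T \<and> T \<subseteq> - ?D" if p: "p \<in> - ?D" for p
  proof -
    obtain t r where p_eq: "p = (t, r)" by (cases p)
    \<comment> \<open>The translate of the square by \<open>(n, m)\<close> has coordinates within \<open>1\<close> of \<open>n\<close> and \<open>m\<close>, and the ball has radius \<open>1\<close>.\<close>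
    let ?N = "\<lceil>\<bar>t\<bar>\<rceil> + 2" and ?M = "\<lceil>\<bar>r\<bar>\<rceil> + 2"
    let ?B = "{- ?N..?N} \<times> {- ?M..?M}"
    let ?T = "ball p 1 - (\<Union>g\<in>?B. klein_action g ` C)"
    have "closed (\<Union>g\<in>?B. klein_action g ` C)"
      using closed_image by (intro closed_UN) simp_all
    then have "open ?T" by (intro open_Diff open_ball)
    moreover have "p \<in> ?T" using p by auto
    moreover have "?T \<subseteq> - ?D"
    proof (rule subsetI, rule ComplI)
      fix x assume x: "x \<in> ?T" and "x \<in> ?D"
      then obtain g c where "c \<in> C" "x = klein_action g c" by (elim UN_E imageE) (rule that)
      then obtain n m u v where uv: "(u, v) \<in> C" and x_eq: "x = klein_action (n, m) (u, v)"
        by (cases g; cases c) simp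
      have u: "0 \<le> u" "u \<le> 1" "0 \<le> v" "v \<le> 1" using uv C(2) by auto
      have "dist t (fst x) \<le> dist p x" "dist r (snd x) \<le> dist p x"
        using dist_fst_le[of p x] dist_snd_le[of p x] by (simp_all add: p_eq)
      moreover have "dist p x < 1" using x by simp
      ultimately have d: "\<bar>t - fst x\<bar> < 1" "\<bar>r - snd x\<bar> < 1" by (simp_all add: dist_real_def)
      have "\<bar>real_of_int n\<bar> \<le> \<bar>t\<bar> + 2" "\<bar>real_of_int m\<bar> \<le> \<bar>r\<bar> + 2"
        using d u unfolding x_eq klein_action_apply by (auto split: if_splits)
      then have "(n, m) \<in> ?B" by (simp add: abs_le_iff) linarith
      then have "x \<in> (\<Union>g\<in>?B. klein_action g ` C)" using uv unfolding x_eq by blast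
      then show False using x by blast
    qed
    ultimately show ?thesis by blast
  qed
  then have "open (- ?D)" by (subst open_subopen) blast
  then show ?thesis by (simp add: closed_def)
qed

text \<open>The closed set in the plane that corresponds to the image of \<open>C\<close> is the union of the translates of \<open>C\<close>. This
lemma makes all identifications below topological, without a separate proof that the Klein bottle is
Hausdorff.\<close>

lemma closed_map_klein_orbit: "closed_map unit_square klein_bottle klein_orbit"
  unfolding closed_map_def
proof (intro allI impI)
  fix C :: "(real \<times> real) set" assume "closedin unit_square C"
  then have C: "closed C" "C \<subseteq> {0..1} \<times> {0..1}"
    using closedin_closed_trans[OF _ closed_Times[OF closed_real_atLeastAtMost closed_real_atLeastAtMost]]
    by (auto dest: closedin_imp_subset)
  have "{p \<in> topspace euclidean. klein_orbit p \<in> klein_orbit ` C} = (\<Union>g. klein_action g ` C)"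
    using klein_orbit_eq_iff by (auto simp: image_iff) (metis klein_orbit_eq_iff)+
  then have "closedin euclidean {p \<in> topspace euclidean. klein_orbit p \<in> klein_orbit ` C}"
    using closed_klein_saturation[OF C] by simp
  moreover have "klein_orbit ` C \<subseteq> topspace klein_bottle"
    using quotient_imp_surjective_map[OF quotient_map_klein_orbit] by auto
  ultimately show "closedin klein_bottle (klein_orbit ` C)"
    using quotient_map_klein_orbit unfolding quotient_map_closedin by blast
qed

lemma klein_orbit_onto: "klein_orbit ` ({0..1} \<times> {0..1}) = topspace klein_bottle"
proof -
  have "klein_orbit p \<in> klein_orbit ` ({0..1} \<times> {0..1})" for p
  proof -
    obtain t r where p: "p = (t, r)" by (cases p)
    let ?m = "- \<lfloor>r\<rfloor>"
    let ?u = "if even ?m then t else - t"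
    have "klein_orbit p = klein_orbit (of_int (- \<lfloor>?u\<rfloor>) + ?u, of_int ?m + r)"
      unfolding p klein_orbit_eq by blast
    moreover have "(of_int (- \<lfloor>?u\<rfloor>) + ?u, of_int ?m + r) \<in> {0..1} \<times> {0..1}"
      by (simp only: mem_Times_iff fst_conv snd_conv atLeastAtMost_iff of_int_minus) linarith
    ultimately show ?thesis by (rule image_eqI)
  qed
  then have "range klein_orbit = klein_orbit ` ({0..1} \<times> {0..1})" by blast
  then show ?thesis
    using quotient_imp_surjective_map[OF quotient_map_klein_orbit] by simp
qed

text \<open>The circle is the first coordinate of the plane modulo \<open>1\<close>; any choice of the preimage gives the same
orbit.\<close>

definition klein_glue :: "(nat \<Rightarrow> real) \<times> real \<Rightarrow> (real \<times> real) set" where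
  "klein_glue = (\<lambda>(v, s). klein_orbit (inv_into {0..1} circle_point v, s))"

lemma klein_glue_circle_point: "klein_glue (circle_point t, s) = klein_orbit (t, s)"
proof -
  have "circle_point t \<in> circle_point ` {0..1}"
    using continuous_map_funspace[OF continuous_map_circle_point] circle_point_onto by auto
  then have "circle_point (inv_into {0..1} circle_point (circle_point t)) = circle_point t"
    by (rule f_inv_into_f)
  then obtain n :: int where "t = inv_into {0..1} circle_point (circle_point t) + of_int n"
    unfolding circle_point_eq_iff by (metis add_diff_cancel_right' diff_conv_add_uminus of_int_minus)
  then show ?thesis
    unfolding klein_glue_def case_prod_conv klein_orbit_eq by (intro exI[of _ n] exI[of _ 0]) simp
qed

lemma quotient_map_unit_square_cylinder:
  "quotient_map unit_square (cylinder (nsphere 1)) (\<lambda>(t, s). (circle_point t, s))"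
proof -
  let ?I = "top_of_set {0..1::real}"
  have eq: "(\<lambda>(t, s). (circle_point t, s)) = (\<lambda>(t, s). (circle_point t, id s :: real))"
    by simp
  have "closed_map (prod_topology ?I ?I) (prod_topology (nsphere 1) ?I) (\<lambda>(t, s). (circle_point t, s))"
    unfolding eq
    by (intro proper_imp_closed_map proper_map_prod[THEN iffD2] disjI2 conjI proper_map_id proper_map_circle_point)
  moreover have "continuous_map (prod_topology ?I ?I) (prod_topology (nsphere 1) ?I) (\<lambda>(t, s). (circle_point t, s))"
    unfolding eq continuous_map_prod_top
    by (intro disjI2 conjI continuous_map_id continuous_map_from_subtopology[OF continuous_map_circle_point])
  moreover have "(\<lambda>(t, s). (circle_point t, s)) ` topspace (prod_topology ?I ?I) = topspace (prod_topology (nsphere 1) ?I)"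
    unfolding topspace_prod_topology circle_point_onto[symmetric] by auto
  ultimately have "quotient_map (prod_topology ?I ?I) (prod_topology (nsphere 1) ?I) (\<lambda>(t, s). (circle_point t, s))"
    by (intro continuous_closed_imp_quotient_map)
  then show ?thesis by (simp add: cylinder_def)
qed

lemma klein_glue_comp: "klein_glue \<circ> (\<lambda>(t, s). (circle_point t, s)) = klein_orbit"
  by (auto simp: klein_glue_circle_point)

text \<open>Both the square and the cylinder over the circle map onto the Klein bottle, and the first map factors through the
second.\<close>

lemma glued_cylinder_klein: "glued_cylinder (nsphere 1) klein_bottle klein_glue"
proof
  have "continuous_map unit_square klein_bottle klein_orbit"
    by (intro continuous_map_from_subtopology quotient_imp_continuous_map quotient_map_klein_orbit)
  then have "quotient_map unit_square klein_bottle klein_orbit"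
    using closed_map_klein_orbit klein_orbit_onto by (intro continuous_closed_imp_quotient_map) simp_all
  then show "quotient_map (cylinder (nsphere 1)) klein_bottle klein_glue"
    unfolding klein_glue_comp[symmetric] quotient_map_compose_eq[OF quotient_map_unit_square_cylinder] .
next
  fix v w assume vw: "v \<in> topspace (cylinder (nsphere 1))" "w \<in> topspace (cylinder (nsphere 1))"
    and eq: "klein_glue v = klein_glue w" and v: "v \<notin> cylinder_ends (nsphere 1)"
  obtain x s y r where xy: "v = (x, s)" "w = (y, r)" by (cases v, cases w)
  have xS: "x \<in> topspace (nsphere 1)" and yS: "y \<in> topspace (nsphere 1)"
    and s: "0 < s" "s < 1" and r: "0 \<le> r" "r \<le> 1"
    using vw v by (auto simp: xy cylinder_ends_def less_le)
  obtain t where t: "x = circle_point t" using xS unfolding circle_point_onto[symmetric] by blast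
  obtain u where u: "y = circle_point u" using yS unfolding circle_point_onto[symmetric] by blast
  obtain n m :: int where nm: "u = of_int n + (if even m then t else - t)" "r = of_int m + s"
    using eq unfolding xy t u klein_glue_circle_point klein_orbit_eq by blast
  have "\<bar>of_int m :: real\<bar> < 1" using s r nm(2) by linarith
  then have m: "m = 0" by linarith
  then have "circle_point u = circle_point t"
    unfolding circle_point_eq_iff nm(1) by (intro exI[of _ n]) simp
  then show "v = w" using nm(2) m by (simp add: xy t u)
qed

abbreviation circle_reflection :: "(nat \<Rightarrow> real) \<Rightarrow> nat \<Rightarrow> real" where
  "circle_reflection \<equiv> (\<lambda>x i. if i = 0 then - x i else x i)"

lemma circle_reflection_circle_point: "circle_reflection (circle_point t) = circle_point (- t)"
  by (auto simp: circle_point_def fun_eq_iff)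

text \<open>The group element \<open>(0, 1)\<close> takes \<open>(-t, 0)\<close> to \<open>(t, 1)\<close>.\<close>

lemma klein_glue_upper_end:
  assumes "v \<in> topspace (nsphere 1)"
  shows "klein_glue (v, 1) = klein_glue (circle_reflection v, 0)"
proof -
  obtain t where "v = circle_point t" using assms unfolding circle_point_onto[symmetric] by blast
  then show ?thesis
    unfolding circle_reflection_circle_point klein_glue_circle_point klein_orbit_eq
    by (simp only: circle_reflection_circle_point klein_glue_circle_point klein_orbit_eq)
       (intro exI[of _ 0] exI[of _ "-1"], simp)
qed

interpretation klein: glued_cylinder "nsphere 1" klein_bottle klein_glue
  by (rule glued_cylinder_klein)

abbreviation klein_fibre :: "(nat \<Rightarrow> real) \<Rightarrow> (real \<times> real) set" where
  "klein_fibre \<equiv> (\<lambda>v. klein_glue (v, 0))"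

lemma klein_glued_ends: "klein.glued_ends = klein_fibre ` topspace (nsphere 1)"
proof -
  have "cylinder_ends (nsphere 1)
      = (\<lambda>v. (v, 0)) ` topspace (nsphere 1) \<union> (\<lambda>v. (v, 1)) ` topspace (nsphere 1)"
    by (auto simp: cylinder_ends_def)
  moreover have "klein_glue (v, 1) \<in> klein_fibre ` topspace (nsphere 1)" if "v \<in> topspace (nsphere 1)" for v
    unfolding klein_glue_upper_end[OF that]
    using continuous_map_funspace[OF continuous_map_nsphere_reflection[of 1 0]] that by blast
  ultimately show ?thesis by (auto simp only: image_Un image_image)
qed

text \<open>A closed set of the circle, pulled back to the bottom edge of the square, has closed image in the Klein bottle.\<close>

lemma homeomorphic_klein_fibre: "homeomorphic_map (nsphere 1) klein.glued_end_space klein_fibre"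
proof -
  have cont: "continuous_map (nsphere 1) klein_bottle klein_fibre"
    by (rule continuous_map_into_fulltopology[OF klein.continuous_map_glued_end]) simp
  have "closed_map (nsphere 1) klein_bottle klein_fibre"
    unfolding closed_map_def
  proof (intro allI impI)
    fix C assume C: "closedin (nsphere 1) C"
    let ?D = "{t \<in> {0..1}. circle_point t \<in> C} \<times> {0::real}"
    have "closedin (top_of_set {0..1}) {t \<in> {0..1}. circle_point t \<in> C}"
      using closedin_continuous_map_preimage[OF continuous_map_from_subtopology[OF continuous_map_circle_point, of "{0..1}"] C]
      by simp
    then have "closedin unit_square ?D"
      unfolding prod_topology_subtopology_eu[symmetric] closedin_prod_Times_iff
      by (auto intro: closed_subset)
    then have "closedin klein_bottle (klein_orbit ` ?D)"
      using closed_map_klein_orbit unfolding closed_map_def by blast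
    also have "klein_orbit ` ?D = klein_fibre ` circle_point ` {t \<in> {0..1}. circle_point t \<in> C}"
      by (auto simp: klein_glue_circle_point image_iff)
    also have "circle_point ` {t \<in> {0..1}. circle_point t \<in> C} = C"
      using closedin_subset[OF C] unfolding circle_point_onto[symmetric] by blast
    finally show "closedin klein_bottle (klein_fibre ` C)" .
  qed
  moreover have "inj_on klein_fibre (topspace (nsphere 1))"
  proof (rule inj_onI)
    fix x y assume xy: "x \<in> topspace (nsphere 1)" "y \<in> topspace (nsphere 1)" "klein_fibre x = klein_fibre y"
    obtain t where t: "x = circle_point t" using xy unfolding circle_point_onto[symmetric] by blast
    obtain u where u: "y = circle_point u" using xy unfolding circle_point_onto[symmetric] by blast
    obtain n m :: int where nm: "u = of_int n + (if even m then t else - t)" "0 = of_int m + (0::real)"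
      using xy(3) unfolding t u klein_glue_circle_point klein_orbit_eq by blast
    then have "circle_point u = circle_point t"
      unfolding circle_point_eq_iff by (intro exI[of _ n]) simp
    then show "x = y" by (simp add: t u)
  qed
  ultimately have "embedding_map (nsphere 1) klein_bottle klein_fibre"
    using cont by (intro injective_closed_imp_embedding_map)
  then show ?thesis unfolding embedding_map_def klein_glued_ends .
qed

lemma topspace_klein_bottle_nonempty: "topspace klein_bottle \<noteq> {}"
  unfolding klein_orbit_onto[symmetric] by auto

lemma path_connected_space_klein_bottle: "path_connected_space klein_bottle"
proof -
  have "path_connectedin euclidean ({0..1} \<times> {0..1} :: (real \<times> real) set)"
    by (simp add: convex_imp_path_connected convex_Times)
  from path_connectedin_continuous_map_image[OF quotient_imp_continuous_map[OF quotient_map_klein_orbit] this]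
  show ?thesis by (simp add: klein_orbit_onto path_connectedin_topspace)
qed

section \<open>Homology of the Klein bottle\<close>

text \<open>An extension of \<open>\<int>\<close> by a group of order two splits, by the choice of a preimage of \<open>1\<close>.\<close>

lemma (in comm_group) iso_integer_times_mod_2:
  assumes \<phi>: "\<phi> \<in> hom G integer_group" "\<phi> ` carrier G = UNIV"
    and ker: "kernel G integer_group \<phi> = {\<one>, b}" and b: "b \<noteq> \<one>"
  shows "G \<cong> integer_group \<times>\<times> integer_mod_group 2"
proof -
  interpret \<phi>: group_hom G integer_group \<phi>
    using \<phi>(1) by (simp add: group_hom_def group_hom_axioms_def)
  have "b \<in> kernel G integer_group \<phi>" using ker by blast
  then have bG: "b \<in> carrier G" and \<phi>b: "\<phi> b = 0" by (simp_all add: kernel_def)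
  have "b \<otimes> b \<in> {\<one>, b}" unfolding ker[symmetric] using bG \<phi>b by (simp add: kernel_def)
  then have bb: "b \<otimes> b = \<one>" using b bG by auto
  have "1 \<in> \<phi> ` carrier G" unfolding \<phi>(2) by simp
  then obtain t where t: "t \<in> carrier G" "\<phi> t = 1" by auto
  have \<phi>t: "\<phi> (t [^] m) = m" for m :: int
    using \<phi>.hom_int_pow[OF t(1), of m] t(2) by simp
  let ?Z = "integer_group \<times>\<times> integer_mod_group 2"
  let ?\<psi> = "\<lambda>(m::int, e::int). t [^] m \<otimes> (if e = 0 then \<one> else b)"
  have car: "carrier ?Z = UNIV \<times> {0, 1}"
    by (auto simp: DirProd_def carrier_integer_mod_group)
  have \<psi>: "?\<psi> x \<in> carrier G" for x using t bG by (auto split: prod.splits)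
  have \<phi>\<psi>: "\<phi> (?\<psi> (m, e)) = m" for m e using t bG by (simp add: \<phi>t \<phi>b)
  have "?\<psi> \<in> iso ?Z G"
    unfolding iso_iff
  proof (intro conjI)
    show "?\<psi> \<in> hom ?Z G"
    proof (rule homI)
      fix x y assume "x \<in> carrier ?Z" "y \<in> carrier ?Z"
      then obtain m e n f where xy: "x = (m, e)" "y = (n, f)" "e \<in> {0, 1}" "f \<in> {0, 1}"
        unfolding car by blast
      have 1: "(if (e + f) mod 2 = 0 then \<one> else b) = (if e = 0 then \<one> else b) \<otimes> (if f = 0 then \<one> else b)"
        using xy(3,4) bG bb by auto
      have "?\<psi> (x \<otimes>\<^bsub>?Z\<^esub> y) = t [^] (m + n) \<otimes> (if (e + f) mod 2 = 0 then \<one> else b)"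
        by (simp add: xy(1,2))
      also have "\<dots> = ?\<psi> x \<otimes> ?\<psi> y"
        unfolding 1 using t bG by (simp add: xy(1,2) int_pow_mult m_ac)
      finally show "?\<psi> (x \<otimes>\<^bsub>?Z\<^esub> y) = ?\<psi> x \<otimes> ?\<psi> y" .
    qed (rule \<psi>)
    show "inj_on ?\<psi> (carrier ?Z)"
    proof (rule inj_onI)
      fix x y assume "x \<in> carrier ?Z" "y \<in> carrier ?Z" and eq: "?\<psi> x = ?\<psi> y"
      then obtain m e n f where xy: "x = (m, e)" "y = (n, f)" "e \<in> {0, 1}" "f \<in> {0, 1}"
        unfolding car by blast
      have mn: "m = n" using arg_cong[OF eq, of \<phi>] unfolding xy(1,2) \<phi>\<psi> .
      then have "(if e = 0 then \<one> else b) = (if f = 0 then \<one> else b)"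
        using eq t bG unfolding xy(1,2) by simp
      then show "x = y" using mn xy b by auto
    qed
    show "?\<psi> ` carrier ?Z = carrier G"
    proof (rule Set.set_eqI, rule iffI)
      fix g assume g: "g \<in> carrier G"
      let ?m = "\<phi> g"
      have "inv (t [^] ?m) \<otimes> g \<in> kernel G integer_group \<phi>"
        using g t by (simp add: kernel_def \<phi>t)
      then have "inv (t [^] ?m) \<otimes> g \<in> {\<one>, b}" unfolding ker .
      moreover have "g = t [^] ?m \<otimes> (inv (t [^] ?m) \<otimes> g)"
        using g t by (simp add: m_assoc[symmetric])
      ultimately have "g = ?\<psi> (?m, 0) \<or> g = ?\<psi> (?m, 1)" by auto
      moreover have "(?m, 0) \<in> carrier ?Z" "(?m, 1) \<in> carrier ?Z" unfolding car by simp_all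
      ultimately show "g \<in> ?\<psi> ` carrier ?Z" by blast
    next
      fix g assume "g \<in> ?\<psi> ` carrier ?Z"
      then show "g \<in> carrier G" using \<psi> by blast
    qed
  qed
  then have "?Z \<cong> G" by (rule is_isoI)
  then show ?thesis by (rule group.iso_sym[rotated]) (simp add: DirProd_group)
qed

lemma homology_circle_1: "homology_group 1 (nsphere 1) \<cong> integer_group"
  using reduced_homology_group_nsphere(1)[of 1] by (simp add: un_reduced_homology_group)

lemma trivial_homology_circle: "n \<ge> 2 \<Longrightarrow> trivial_group (homology_group n (nsphere 1))"
  using reduced_homology_group_nsphere(2)[of n 1] by (simp add: un_reduced_homology_group)

lemma circle_reflection_homology_1:
  assumes "a \<in> carrier (homology_group 1 (nsphere 1))"
  shows "hom_induced 1 (nsphere 1) {} (nsphere 1) {} circle_reflection a = inv\<^bsub>homology_group 1 (nsphere 1)\<^esub> a"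
proof -
  interpret group "homology_group 1 (nsphere 1)" by simp
  have "reduced_homology_group 1 (nsphere 1) = homology_group 1 (nsphere 1)"
    by (rule un_reduced_homology_group) simp
  with Brouwer_degree2[of a 1 circle_reflection] assms
  show ?thesis by (simp only: of_nat_1 Brouwer_degree2_reflection int_pow_neg int_pow_1)
qed

lemma circle_reflection_homology_0:
  assumes "a \<in> carrier (homology_group 0 (nsphere 1))"
  shows "hom_induced 0 (nsphere 1) {} (nsphere 1) {} circle_reflection a = a"
proof (rule hom_induced_0_path_components[OF continuous_map_nsphere_reflection _ assms])
  fix x assume x: "x \<in> topspace (nsphere 1)"
  then have "circle_reflection x \<in> topspace (nsphere 1)"
    using continuous_map_funspace[OF continuous_map_nsphere_reflection[of 1 0]] by blast
  with x show "path_component_of (nsphere 1) x (circle_reflection x)"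
    using path_connected_space_circle unfolding path_connected_space_iff_path_component by blast
qed

lemma klein_end_map_1:
  "klein.end_map 1 n a = klein.end_map 0 n (hom_induced n (nsphere 1) {} (nsphere 1) {} circle_reflection a)"
proof -
  have "klein.end_map 1 n a
      = hom_induced n (nsphere 1) {} klein.glued_end_space {} (klein_fibre \<circ> circle_reflection) a"
    by (rule fun_cong[OF hom_induced_eq]) (simp only: klein_glue_upper_end o_apply)
  then show ?thesis
    using klein.continuous_map_glued_end[of 0] continuous_map_nsphere_reflection[of 1 0]
    by (subst hom_induced_compose') simp_all
qed

lemma iso_klein_end_map:
  "klein.end_map 0 n \<in> iso (homology_group n (nsphere 1)) (homology_group n klein.glued_end_space)"
  by (rule homeomorphic_map_homology_iso[OF homeomorphic_klein_fibre])

lemma inj_klein_end_map: "inj_on (klein.end_map 0 n) (carrier (homology_group n (nsphere 1)))"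
  using iso_klein_end_map[of n] by (simp only: iso_iff)

text \<open>For \<open>n = 2\<close> the classes of \<open>H\<^sub>1(S\<^sup>1)\<close> on which the end maps agree satisfy \<open>a = -a\<close>, so they vanish in
\<open>\<int>\<close>.\<close>

lemma trivial_homology_klein_bottle:
  assumes n: "n \<ge> 2"
  shows "trivial_group (homology_group n klein_bottle)"
proof -
  have "trivial_group (homology_group (n - 1 + 1) klein_bottle)"
  proof (rule klein.trivial_homology_glued)
    have "trivial_group (homology_group (n - 1 + 1) klein.glued_end_space)"
      by (rule isomorphic_group_triviality1[OF is_isoI[OF iso_klein_end_map] group_relative_homology_group])
         (use n in \<open>simp add: trivial_homology_circle[unfolded One_nat_def]\<close>)
    then show "hom_induced (n - 1 + 1) klein.glued_end_space {} klein_bottle {} id c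
        = \<one>\<^bsub>homology_group (n - 1 + 1) klein_bottle\<^esub>"
      if "c \<in> carrier (homology_group (n - 1 + 1) klein.glued_end_space)" for c
      using that group_hom.hom_one[OF group_hom_hom_induced[of "n - 1 + 1" klein.glued_end_space "{}" klein_bottle "{}" id]]
      by (simp only: trivial_group_def singleton_iff)
  next
    fix a assume a: "a \<in> carrier (homology_group (n - 1) (nsphere 1))"
      and eq: "klein.end_map 0 (n - 1) a = klein.end_map 1 (n - 1) a"
    show "a = \<one>\<^bsub>homology_group (n - 1) (nsphere 1)\<^esub>"
    proof (cases "n = 2")
      case False
      then show ?thesis using a trivial_homology_circle[of "n - 1"] n by (simp add: trivial_group_def)
    next
      case True
      let ?H = "homology_group 1 (nsphere 1)"
      interpret group ?H by simp
      have a1: "a \<in> carrier ?H" using a True by simp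
      have "klein.end_map 0 1 a = klein.end_map 0 1 (inv\<^bsub>?H\<^esub> a)"
        using eq unfolding klein_end_map_1 True by (simp add: circle_reflection_homology_1[OF a1, unfolded One_nat_def])
      then have inv_a: "a = inv\<^bsub>?H\<^esub> a"
        by (rule inj_onD[OF inj_klein_end_map]) (simp_all only: a1 inv_closed)
      obtain h where h: "h \<in> iso ?H integer_group"
        using homology_circle_1 by (auto simp: is_iso_def)
      interpret h: group_hom ?H integer_group h
        using h by (simp add: group_hom_def group_hom_axioms_def iso_iff)
      have "h a = - h a" using arg_cong[OF inv_a, of h] h.hom_inv[OF a1] by simp
      then have "h a = h \<one>\<^bsub>?H\<^esub>" using h.hom_one by simp
      then have "a = \<one>\<^bsub>?H\<^esub>"
        using h a1 one_closed unfolding iso_iff by (meson inj_onD)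
      then show ?thesis using True by simp
    qed
  qed
  then show ?thesis by simp
qed

text \<open>The exact sequence of the pair of the Klein bottle and a fibre \<open>F\<close> reads
\<open>\<int> \<rightarrow> H\<^sub>1(F) = \<int> \<rightarrow> H\<^sub>1(K) \<rightarrow> \<int> \<rightarrow> 0\<close>: its first map is multiplication by \<open>-2\<close>, since the reflection acts by
\<open>-1\<close> on \<open>H\<^sub>1(S\<^sup>1)\<close>, and its last map is onto, since the reflection acts trivially on \<open>H\<^sub>0(S\<^sup>1)\<close>.\<close>

theorem homology_klein_bottle_1:
  "homology_group 1 klein_bottle \<cong> integer_group \<times>\<times> integer_mod_group 2"
proof -
  let ?C = "homology_group 1 (nsphere 1)" and ?F = "homology_group 1 klein.glued_end_space"
  let ?H = "homology_group 1 klein_bottle" and ?R = "relative_homology_group 1 klein_bottle klein.glued_ends"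
  let ?e = "klein.end_map 0 1"
  let ?i = "hom_induced 1 klein.glued_end_space {} klein_bottle {} id"
  let ?j = "hom_induced 1 klein_bottle {} klein_bottle klein.glued_ends id"
  interpret C: comm_group ?C by simp
  interpret F: comm_group ?F by simp
  interpret H: comm_group ?H by simp
  interpret e: group_hom ?C ?F ?e by (rule group_hom_hom_induced)
  interpret i: group_hom ?F ?H ?i by (rule group_hom_hom_induced)
  interpret j: group_hom ?H ?R ?j by (rule group_hom_hom_induced)
  have e_surj: "?e ` carrier ?C = carrier ?F" using iso_klein_end_map[of 1] by (simp only: iso_iff)
  obtain h where h: "h \<in> iso integer_group ?C"
    using group.iso_sym[OF group_relative_homology_group homology_circle_1] by (auto simp: is_iso_def)
  interpret h: group_hom integer_group ?C h
    using h by (simp add: group_hom_def group_hom_axioms_def iso_iff)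
  have h_surj: "range h = carrier ?C" and h_inj: "inj h" using h by (simp_all add: iso_iff)
  have hC: "h k \<in> carrier ?C" for k by (rule h.hom_closed) simp
  \<comment> \<open>A parametrisation of \<open>H\<^sub>1\<close> of the fibre by the integers.\<close>
  define f where "f k = ?e (h k)" for k
  have fF: "f k \<in> carrier ?F" for k unfolding f_def by (rule e.hom_closed[OF hC])
  have f_add: "f (k + l) = f k \<otimes>\<^bsub>?F\<^esub> f l" for k l
    unfolding f_def using h.hom_mult[of k l] e.hom_mult[OF hC hC, of k l] by simp
  have f_minus: "f (- k) = inv\<^bsub>?F\<^esub> f k" for k
    unfolding f_def using h.hom_inv[of k] e.hom_inv[OF hC, of k] by simp
  have f_surj: "range f = carrier ?F"
    unfolding e_surj[symmetric] h_surj[symmetric] f_def image_image ..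
  have f_inj: "inj f"
    unfolding f_def using comp_inj_on[OF h_inj, of ?e] inj_klein_end_map[of 1] h_surj by (simp add: comp_def)
  have bd: "hom_boundary 2 klein_bottle klein.glued_ends (klein.attach 1 (h k)) = f (- 2 * k)" for k
  proof -
    have "hom_boundary (1 + 1) klein_bottle klein.glued_ends (klein.attach 1 (h k))
        = ?e (inv\<^bsub>?C\<^esub> h k) \<otimes>\<^bsub>?F\<^esub> inv\<^bsub>?F\<^esub> ?e (h k)"
      unfolding klein.boundary_attach[OF hC] klein_end_map_1 circle_reflection_homology_1[OF hC] ..
    also have "\<dots> = f (- k) \<otimes>\<^bsub>?F\<^esub> f (- k)"
      unfolding f_minus unfolding f_def e.hom_inv[OF hC] ..
    also have "\<dots> = f (- 2 * k)" unfolding f_add[symmetric] by simp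
    finally show ?thesis by simp
  qed
  have ker_i: "kernel ?F ?H ?i = range (\<lambda>k. f (2 * k))"
  proof -
    have "carrier (relative_homology_group 2 klein_bottle klein.glued_ends) = klein.attach 1 ` range h"
      unfolding h_surj using klein.iso_attach[of 1] by (simp add: iso_iff)
    moreover have "(2 :: int) - 1 = 1" by simp
    ultimately have "kernel ?F ?H ?i = range (\<lambda>k. f (- 2 * k))"
      using kernel_hom_induced_inclusion[of 2 klein_bottle klein.glued_ends] by (simp only: image_image bd)
    also have "\<dots> = (\<lambda>k. f (2 * k)) ` range uminus" unfolding image_image by simp
    also have "range uminus = (UNIV :: int set)" by (rule surj_uminus)
    finally show ?thesis .
  qed
  \<comment> \<open>The element of order two is the class of the fibre.\<close>
  define b where "b = ?i (f 1)"
  have bH: "b \<in> carrier ?H" unfolding b_def by (rule i.hom_closed[OF fF])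
  have b: "b \<noteq> \<one>\<^bsub>?H\<^esub>"
  proof
    assume "b = \<one>\<^bsub>?H\<^esub>"
    then have "f 1 \<in> kernel ?F ?H ?i" using fF unfolding b_def kernel_def by blast
    then obtain k where "f 1 = f (2 * k)" unfolding ker_i by blast
    then have "1 = 2 * k" by (rule injD[OF f_inj])
    then show False by presburger
  qed
  have even: "?i (f (2 * k)) = \<one>\<^bsub>?H\<^esub>" for k
  proof -
    have "f (2 * k) \<in> kernel ?F ?H ?i" unfolding ker_i by blast
    then show ?thesis unfolding kernel_def by blast
  qed
  have im_i: "?i ` carrier ?F = {\<one>\<^bsub>?H\<^esub>, b}"
  proof (rule Set.set_eqI, rule iffI)
    fix x assume "x \<in> ?i ` carrier ?F"
    then obtain k where x: "x = ?i (f k)" unfolding f_surj[symmetric] by blast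
    show "x \<in> {\<one>\<^bsub>?H\<^esub>, b}"
    proof (cases "even k")
      case True
      then show ?thesis using even unfolding x by (auto elim: evenE)
    next
      case False
      then obtain l where "k = 2 * l + 1" by (rule oddE)
      then have "x = b"
        unfolding x f_add[of "2 * l" 1] \<open>k = 2 * l + 1\<close> i.hom_mult[OF fF fF] even b_def[symmetric] by (simp add: bH)
      then show ?thesis by simp
    qed
  next
    fix x assume "x \<in> {\<one>\<^bsub>?H\<^esub>, b}"
    moreover have "\<one>\<^bsub>?H\<^esub> \<in> ?i ` carrier ?F"
      unfolding even[of 0, symmetric] by (rule imageI[OF fF])
    moreover have "b \<in> ?i ` carrier ?F"
      unfolding b_def by (rule imageI[OF fF])
    ultimately show "x \<in> ?i ` carrier ?F" by (elim insertE emptyE) (simp_all only:)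
  qed
  have j_surj: "?j ` carrier ?H = carrier ?R"
  proof -
    have bd0: "hom_boundary 1 klein_bottle klein.glued_ends z = \<one>\<^bsub>homology_group 0 klein.glued_end_space\<^esub>"
      if z: "z \<in> carrier ?R" for z
    proof -
      have "z \<in> klein.attach 0 ` carrier (homology_group 0 (nsphere 1))"
        using z klein.iso_attach[of 0] by (simp add: iso_iff)
      then obtain a where a: "a \<in> carrier (homology_group 0 (nsphere 1))" "z = klein.attach 0 a"
        by (rule imageE) (rule that)
      show ?thesis
        using klein.boundary_attach_eq_one_iff[OF a(1)] unfolding a(2) klein_end_map_1 circle_reflection_homology_0[OF a(1)]
        by simp
    qed
    have "kernel ?R (homology_group 0 klein.glued_end_space) (hom_boundary 1 klein_bottle klein.glued_ends) = carrier ?R"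
      unfolding kernel_def
      by (rule subset_antisym[OF Collect_restrict], rule subsetI, rule CollectI, rule conjI, assumption, rule bd0)
    then show ?thesis using kernel_hom_boundary[of 1 klein_bottle klein.glued_ends] by simp
  qed
  have "homology_group 0 (nsphere 1) \<cong> ?R"
    using is_isoI[OF klein.iso_attach[of 0]] by simp
  moreover have "homology_group 0 (nsphere 1) \<cong> integer_group"
    by (rule isomorphic_integer_zeroth_homology_group[OF path_connected_space_circle]) simp
  ultimately have "?R \<cong> integer_group"
    using group.iso_sym[OF group_relative_homology_group] iso_trans by blast
  then obtain \<rho> where \<rho>: "\<rho> \<in> iso ?R integer_group" by (auto simp: is_iso_def)
  interpret \<rho>: group_hom ?R integer_group \<rho>
    using \<rho> by (simp add: group_hom_def group_hom_axioms_def iso_iff)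
  have \<rho>_inj: "inj_on \<rho> (carrier ?R)" and \<rho>_surj: "\<rho> ` carrier ?R = UNIV"
    using \<rho> by (simp_all add: iso_iff)
  show ?thesis
  proof (rule H.iso_integer_times_mod_2[of "\<rho> \<circ> ?j" b])
    show "\<rho> \<circ> ?j \<in> hom ?H integer_group" by (rule hom_compose[OF j.homh \<rho>.homh])
    show "(\<rho> \<circ> ?j) ` carrier ?H = UNIV" unfolding image_comp[symmetric] j_surj \<rho>_surj ..
    have "(\<rho> \<circ> ?j) x = \<one>\<^bsub>integer_group\<^esub> \<longleftrightarrow> ?j x = \<one>\<^bsub>?R\<^esub>" if x: "x \<in> carrier ?H" for x
      unfolding \<rho>.hom_one[symmetric] o_apply
      by (rule inj_on_eq_iff[OF \<rho>_inj j.hom_closed[OF x] j.H.one_closed])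
    then have "kernel ?H integer_group (\<rho> \<circ> ?j) = kernel ?H ?R ?j"
      unfolding kernel_def by (intro Collect_cong conj_cong refl)
    also have "\<dots> = {\<one>\<^bsub>?H\<^esub>, b}"
      unfolding kernel_hom_induced_relativization im_i ..
    finally show "kernel ?H integer_group (\<rho> \<circ> ?j) = {\<one>\<^bsub>?H\<^esub>, b}" .
  qed (rule b)
qed

section \<open>The join of circles with the Klein bottle\<close>

lemma sum_group_countable_cong:
  fixes I :: "'i set" and J :: "'j set" and G :: "'a monoid" and H :: "'b monoid"
  assumes "countable I" "infinite I" "countable J" "infinite J"
    and "G \<cong> H" "group G" "group H"
  shows "sum_group I (\<lambda>_. G) \<cong> sum_group J (\<lambda>_. H)"
proof -
  have "bij_betw (from_nat_into I \<circ> to_nat_on J) J I"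
    by (rule bij_betw_trans[OF to_nat_on_infinite[OF assms(3,4)] bij_betw_from_nat_into[OF assms(1,2)]])
  then have "sum_group I (\<lambda>_. G) \<cong> sum_group J (\<lambda>_. G)"
    using assms(6) by (rule sum_group_reindex)
  also have "\<dots> \<cong> sum_group J (\<lambda>_. H)"
    using assms(5-7) by (rule iso_sum_groupI)
  finally show ?thesis .
qed

theorem homology_circles_join_klein_bottle:
  fixes J :: "'j set" and J' :: "'k set"
  assumes J: "countable J" "infinite J" and J': "countable J'" "infinite J'"
  shows "homology_group 0 (circles_join_klein_bottle J) \<cong> integer_group"
    and "trivial_group (homology_group 1 (circles_join_klein_bottle J))"
    and "homology_group 2 (circles_join_klein_bottle J)
           \<cong> sum_group J' (\<lambda>_. integer_group \<times>\<times> integer_mod_group 2)"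
    and "homology_group 3 (circles_join_klein_bottle J)
           \<cong> sum_group J (\<lambda>_. integer_group \<times>\<times> integer_mod_group 2)"
    and "i > 3 \<Longrightarrow> trivial_group (homology_group i (circles_join_klein_bottle J))"
proof -
  let ?X = "circles J" and ?K = klein_bottle
  let ?W = "circles_join_klein_bottle J" and ?P = "prod_topology ?X ?K"
  have W: "?W = join ?X ?K"
    unfolding circles_join_klein_bottle_def sum_topology_const ..
  obtain j0 where j0: "j0 \<in> J" using J(2) by fastforce
  have X: "topspace ?X \<noteq> {}"
    using j0 circle_point_onto[symmetric] by auto
  note K = path_connected_space_klein_bottle topspace_klein_bottle_nonempty
  interpret nonempty_join ?X ?K by standard (rule X K(2))+
  show "homology_group 0 ?W \<cong> integer_group"
  proof (rule isomorphic_integer_zeroth_homology_group)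
    show "path_connected_space ?W" unfolding W by (rule path_connected_space_join[OF K(1)])
    show "topspace ?W \<noteq> {}"
      unfolding W surj[symmetric] using X K(2) by simp
  qed
  have sheets: "trivial_group (homology_group n (sheets J ?K))" if "n \<ge> 2" for n
    by (rule trivial_homology_sheets[OF K(2) trivial_homology_klein_bottle[OF that]])
  have P: "trivial_group (homology_group n ?P)" if "n \<ge> 3" for n
    using trivial_homology_circles_times[OF sheets sheets, of "n - 1"] that by simp
  show "trivial_group (homology_group i ?W)" if "i > 3"
  proof -
    have "trivial_group (homology_group (i - 1 + 1) ?W)"
      unfolding W
    proof (rule trivial_homology_join)
      fix a assume "a \<in> carrier (homology_group (i - 1) ?P)"
      then show "a = \<one>\<^bsub>homology_group (i - 1) ?P\<^esub>"
        using P[of "i - 1"] that by (simp add: trivial_group_def)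
    qed (use that in simp)
    then show ?thesis by simp
  qed
  show "trivial_group (homology_group 1 ?W)"
  proof -
    have "trivial_group (homology_group (0 + 1) ?W)"
      unfolding W
    proof (rule trivial_homology_join)
      fix a assume a: "a \<in> carrier (homology_group 0 ?P)"
        and fst_a: "hom_induced 0 ?P {} ?X {} fst a = \<one>\<^bsub>homology_group 0 ?X\<^esub>"
      show "a = \<one>\<^bsub>homology_group 0 ?P\<^esub>"
        by (rule inj_onD[OF inj_on_hom_induced_0_fst[OF K] _ a])
           (simp_all only: fst_a group_hom.hom_one[OF group_hom_hom_induced] monoid.one_closed[OF group.is_monoid[OF group_relative_homology_group]])
    qed simp
    then show ?thesis by simp
  qed
  have Z2: "group (integer_group \<times>\<times> integer_mod_group 2)" by (simp add: DirProd_group)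
  note H1 = homology_klein_bottle_1 group_relative_homology_group Z2
  have "sum_group J' (\<lambda>_. integer_group \<times>\<times> integer_mod_group 2) \<cong> homology_group 2 ?W"
  proof -
    \<comment> \<open>One copy of \<open>H\<^sub>1(K)\<close> is lost to the condition that the entries of a family sum to zero.\<close>
    have J0: "countable (J - {j0})" "infinite (J - {j0})" using J by simp_all
    have "sum_group J' (\<lambda>_. integer_group \<times>\<times> integer_mod_group 2) \<cong> sum_group (J - {j0}) (\<lambda>_. homology_group 1 ?K)"
      by (rule sum_group_countable_cong[OF J' J0 group.iso_sym[OF group_relative_homology_group H1(1)] Z2 group_relative_homology_group])
    also have "\<dots> \<cong> homology_group 1 (sheets (J - {j0}) ?K)"
      by (rule group.iso_sym[OF group_relative_homology_group homology_discrete_times[OF K(2)]])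
    also note kernel_projection_discrete_times[OF j0]
    also note kernel_projections_circles_times[OF K]
    also have "(homology_group 1 ?P)\<lparr>carrier :=
            {a \<in> carrier (homology_group 1 ?P).
               hom_induced 1 ?P {} ?X {} fst a = \<one>\<^bsub>homology_group 1 ?X\<^esub> \<and>
               hom_induced 1 ?P {} ?K {} snd a = \<one>\<^bsub>homology_group 1 ?K\<^esub>}\<rparr> \<cong> homology_group 2 ?W"
      using homology_join[of 1] unfolding W by simp
    finally show ?thesis .
  qed
  then show "homology_group 2 ?W \<cong> sum_group J' (\<lambda>_. integer_group \<times>\<times> integer_mod_group 2)"
    by (rule group.iso_sym[OF sum_group[OF Z2]])
  have "sum_group J (\<lambda>_. integer_group \<times>\<times> integer_mod_group 2) \<cong> homology_group 3 ?W"
  proof -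
    have "sum_group J (\<lambda>_. integer_group \<times>\<times> integer_mod_group 2) \<cong> sum_group J (\<lambda>_. homology_group 1 ?K)"
      by (rule sum_group_countable_cong[OF J J group.iso_sym[OF group_relative_homology_group H1(1)] Z2 group_relative_homology_group])
    also have "\<dots> \<cong> homology_group 1 (sheets J ?K)"
      by (rule group.iso_sym[OF group_relative_homology_group homology_discrete_times[OF K(2)]])
    also have "\<dots> \<cong> homology_group 2 ?P"
      using homology_circles_times[of 1 J ?K] sheets[of 2] by simp
    also have "homology_group 2 ?P \<cong> homology_group 3 ?W"
    proof -
      have one: "hom_induced 2 ?P {} Y {} f a = \<one>\<^bsub>homology_group 2 Y\<^esub>"
        if "trivial_group (homology_group 2 Y)" for Y :: "'c topology" and f a
        using that hom_induced_carrier[of 2 ?P "{}" Y "{}" f a] by (simp only: trivial_group_def singleton_iff)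
      have "hom_induced 2 ?P {} ?X {} fst a = \<one>\<^bsub>homology_group 2 ?X\<^esub> \<and>
               hom_induced 2 ?P {} ?K {} snd a = \<one>\<^bsub>homology_group 2 ?K\<^esub>" for a
        by (intro conjI one trivial_homology_circles trivial_homology_klein_bottle) simp_all
      then have "{a \<in> carrier (homology_group 2 ?P).
               hom_induced 2 ?P {} ?X {} fst a = \<one>\<^bsub>homology_group 2 ?X\<^esub> \<and>
               hom_induced 2 ?P {} ?K {} snd a = \<one>\<^bsub>homology_group 2 ?K\<^esub>} = carrier (homology_group 2 ?P)"
        by (simp only: simp_thms Collect_mem_eq)
      with homology_join[of 2] show ?thesis unfolding W by simp
    qed
    finally show ?thesis .
  qed
  then show "homology_group 3 ?W \<cong> sum_group J (\<lambda>_. integer_group \<times>\<times> integer_mod_group 2)"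
    by (rule group.iso_sym[OF sum_group[OF Z2]])
qed

theorem proposition5p1:
  fixes J :: "'j set" and J' :: "'k set"
  assumes "countable J" and "infinite J"
    and "countable J'" and "infinite J'"
  shows
    "(homology_group 0 (circles_join_klein_bottle J) \<cong> integer_group \<and>
      trivial_group (homology_group 1 (circles_join_klein_bottle J)) \<and>
      homology_group 2 (circles_join_klein_bottle J) \<cong>
        sum_group J' (\<lambda>_. integer_group \<times>\<times> integer_mod_group 2) \<and>
      homology_group 3 (circles_join_klein_bottle J) \<cong>
        sum_group J (\<lambda>_. integer_group \<times>\<times> integer_mod_group 2) \<and>
      (\<forall>i>3. trivial_group (homology_group i (circles_join_klein_bottle J))))
     \<and>
     (klein_B_vc homeomorphic_space circles_join_klein_bottle J \<longrightarrow>
      homology_group 0 klein_B_vc \<cong> integer_group \<and>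
      trivial_group (homology_group 1 klein_B_vc) \<and>
      homology_group 2 klein_B_vc \<cong>
        sum_group J' (\<lambda>_. integer_group \<times>\<times> integer_mod_group 2) \<and>
      homology_group 3 klein_B_vc \<cong>
        sum_group J (\<lambda>_. integer_group \<times>\<times> integer_mod_group 2) \<and>
      (\<forall>i>3. trivial_group (homology_group i klein_B_vc)))"
proof -
  note H = homology_circles_join_klein_bottle[OF assms]
  have iso: "homology_group n klein_B_vc \<cong> homology_group n (circles_join_klein_bottle J)"
    if "klein_B_vc homeomorphic_space circles_join_klein_bottle J" for n
    using that by (rule homeomorphic_space_imp_isomorphic_homology_groups)
  have trivial: "trivial_group (homology_group n klein_B_vc)"
    if "klein_B_vc homeomorphic_space circles_join_klein_bottle J"
      "trivial_group (homology_group n (circles_join_klein_bottle J))" for n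
    using isomorphic_group_triviality[OF iso[OF that(1)]] that(2) by simp
  show ?thesis
    by (intro conjI impI allI H iso_trans[OF iso H(1)] iso_trans[OF iso H(3)] iso_trans[OF iso H(4)]
        trivial[OF _ H(2)] trivial[OF _ H(5)])
qed

end
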